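(* Let $\mathcal{J}=(a,b)$ be a finite interval, $m\geq3$, $Q\in L_1(\mathcal{J};\mathbb{R})$, and let $\Gamma_1,\Gamma_2:\operatorname{Dom}(L_{\max})\to\mathbb{C}^m$ be the maps defined in the context. For a bounded operator $K$ on $\mathbb{C}^m$ let $L^K$ be the restriction of $L_{\max}$ to $\{y\in\operatorname{Dom}(L_{\max}): (K-I)\Gamma_1y-i(K+I)\Gamma_2y=0\}$. Then for every contraction $K$ on $\mathbb{C}^m$, $L^K$ is a maximal accumulative extension of $L_{\min}$. Conversely, for every maximal accumulative extension $\widetilde L$ of $L_{\min}$ there is a contraction $K$ with $\widetilde L=L^K$. The correspondence between contractions $K$ and maximal accumulative extensions $\widetilde L$ is bijective.
   Context: Quasi-derivatives: $D^{[k]}y=y^{(k)}$ for $k=0,\dots,m-2$; $D^{[m-1]}y=y^{(m-1)}+i^{-m}Qy$; $D^{[m]}y=(D^{[m-1]}y)'-i^{-m}QD^{[1]}y$. $L_{\max}$ acts by $y\mapsto i^mD^{[m]}y$ in $L_2(\mathcal{J};\mathbb{C})$ on $\{y: D^{[k]}y\in AC([a,b];\mathbb{C}),\ k=0,\dots,m-1,\ D^{[m]}y\in L_2\}$; $L_{\min}$ is its restriction to functions with $D^{[k]}y(a)=D^{[k]}y(b)=0$, $k=0,\dots,m-1$ (a closed symmetric operator). The maps: if $m=2n$, $\Gamma_1y=i^{2n}(-D^{[2n-1]}y(a),\dots,(-1)^nD^{[n]}y(a),D^{[2n-1]}y(b),\dots,(-1)^{n-1}D^{[n]}y(b))$ (entries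 $(-1)^kD^{[2n-k]}y(a)$, then $(-1)^{k-1}D^{[2n-k]}y(b)$, $k=1,\dots,n$) and $\Gamma_2y=(D^{[0]}y(a),\dots,D^{[n-1]}y(a),D^{[0]}y(b),\dots,D^{[n-1]}y(b))$; if $m=2n+1$, $\Gamma_1y=i^{2n+1}(-D^{[2n]}y(a),\dots,(-1)^nD^{[n+1]}y(a),D^{[2n]}y(b),\dots,(-1)^{n-1}D^{[n+1]}y(b),D^{[n]}y(b)+D^{[n]}y(a))$ and $\Gamma_2y=(D^{[0]}y(a),\dots,D^{[n-1]}y(a),D^{[0]}y(b),\dots,D^{[n-1]}y(b),\gamma D^{[n]}y(b)+\delta D^{[n]}y(a))$ with $\gamma=\frac{(-1)^n}{2}+i$, $\delta=\frac{(-1)^{n+1}}{2}+i$. A densely defined operator $L$ in a Hilbert space is accumulative if $\operatorname{Im}(Lf,f)\leq0$ for all $f\in\operatorname{Dom}L$, and maximal accumulative if moreover it has no nontrivial accumulative extension in that space. *)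

theory Defs
  imports "HOL-Analysis.Analysis"
begin

text \<open>Elements of L2((a,b);C) are represented by complex-valued functions, identified
  up to equality almost everywhere on [a,b].  A (linear) operator in L2 is represented by
  its graph: a set of pairs (f, Lf) that is a linear subspace, saturated under a.e.-equality
  and single-valued modulo a.e.-equality.\<close>

definition ae_on :: "real \<Rightarrow> real \<Rightarrow> (real \<Rightarrow> complex) \<Rightarrow> (real \<Rightarrow> complex) \<Rightarrow> bool" where
  "ae_on a b f g \<longleftrightarrow> (AE x in lebesgue_on {a..b}. f x = g x)"

definition L2 :: "real \<Rightarrow> real \<Rightarrow> (real \<Rightarrow> complex) set" where
  "L2 a b = {f. f \<in> borel_measurable (lebesgue_on {a..b}) \<and>
                integrable (lebesgue_on {a..b}) (\<lambda>x. (cmod (f x))\<^sup>2)}"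

definition L2_inner :: "real \<Rightarrow> real \<Rightarrow> (real \<Rightarrow> complex) \<Rightarrow> (real \<Rightarrow> complex) \<Rightarrow> complex" where
  "L2_inner a b f g = (LINT x|lebesgue_on {a..b}. f x * cnj (g x))"

definition is_operator :: "real \<Rightarrow> real \<Rightarrow> ((real \<Rightarrow> complex) \<times> (real \<Rightarrow> complex)) set \<Rightarrow> bool" where
  "is_operator a b G \<longleftrightarrow>
     G \<subseteq> L2 a b \<times> L2 a b \<and>
     ((\<lambda>x. 0), (\<lambda>x. 0)) \<in> G \<and>
     (\<forall>f g f' g'. (f, g) \<in> G \<and> (f', g') \<in> G \<longrightarrow> ((\<lambda>x. f x + f' x), (\<lambda>x. g x + g' x)) \<in> G) \<and>
     (\<forall>c f g. (f, g) \<in> G \<longrightarrow> ((\<lambda>x. c * f x), (\<lambda>x. c * g x)) \<in> G) \<and>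
     (\<forall>f g f' g'. (f, g) \<in> G \<and> ae_on a b f f' \<and> ae_on a b g g' \<longrightarrow> (f', g') \<in> G) \<and>
     (\<forall>f g f' g'. (f, g) \<in> G \<and> (f', g') \<in> G \<and> ae_on a b f f' \<longrightarrow> ae_on a b g g')"

definition densely_defined :: "real \<Rightarrow> real \<Rightarrow> ((real \<Rightarrow> complex) \<times> (real \<Rightarrow> complex)) set \<Rightarrow> bool" where
  "densely_defined a b G \<longleftrightarrow>
     (\<forall>f \<in> L2 a b. \<forall>\<epsilon>>0. \<exists>u v. (u, v) \<in> G \<and>
        (LINT x|lebesgue_on {a..b}. (cmod (f x - u x))\<^sup>2) < \<epsilon>)"

definition accumulative :: "real \<Rightarrow> real \<Rightarrow> ((real \<Rightarrow> complex) \<times> (real \<Rightarrow> complex)) set \<Rightarrow> bool" where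
  "accumulative a b G \<longleftrightarrow> is_operator a b G \<and> densely_defined a b G \<and>
     (\<forall>f g. (f, g) \<in> G \<longrightarrow> Im (L2_inner a b g f) \<le> 0)"

definition max_accumulative :: "real \<Rightarrow> real \<Rightarrow> ((real \<Rightarrow> complex) \<times> (real \<Rightarrow> complex)) set \<Rightarrow> bool" where
  "max_accumulative a b G \<longleftrightarrow> accumulative a b G \<and>
     (\<forall>G'. accumulative a b G' \<and> G \<subseteq> G' \<longrightarrow> G' = G)"

definition abs_cont_on :: "real \<Rightarrow> real \<Rightarrow> (real \<Rightarrow> complex) \<Rightarrow> bool" where
  "abs_cont_on a b f \<longleftrightarrow>
     (\<forall>\<epsilon>>0. \<exists>\<delta>>0. \<forall>(n::nat) (u::nat \<Rightarrow> real) v.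
        (\<forall>i<n. a \<le> u i \<and> u i \<le> v i \<and> v i \<le> b) \<and>
        (\<forall>i<n. \<forall>j<n. i \<noteq> j \<longrightarrow> v i \<le> u j \<or> v j \<le> u i) \<and>
        (\<Sum>i<n. v i - u i) < \<delta>
        \<longrightarrow> (\<Sum>i<n. cmod (f (v i) - f (u i))) < \<epsilon>)"

definition dw :: "real \<Rightarrow> real \<Rightarrow> (real \<Rightarrow> complex) \<Rightarrow> real \<Rightarrow> complex" where
  "dw a b f = (\<lambda>x. vector_derivative f (at x within {a..b}))"

text \<open>\<open>in_Dmax a b m Q y z\<close>: y lies in Dom(L_max), and z is the absolutely continuous
  representative of the quasi-derivative D^[m-1] y = y^(m-1) + i^(-m) Q y
  (which is only determined almost everywhere by y and Q).\<close>
definition in_Dmax :: "real \<Rightarrow> real \<Rightarrow> nat \<Rightarrow> (real \<Rightarrow> real) \<Rightarrow> (real \<Rightarrow> complex) \<Rightarrow> (real \<Rightarrow> complex) \<Rightarrow> bool" where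
  "in_Dmax a b m Q y z \<longleftrightarrow>
     (\<forall>k \<le> m - 2. abs_cont_on a b ((dw a b ^^ k) y)) \<and>
     abs_cont_on a b z \<and>
     (AE x in lebesgue_on {a..b}. z x = (dw a b ^^ (m - 1)) y x + inverse (\<i> ^ m) * complex_of_real (Q x) * y x) \<and>
     (\<lambda>x. dw a b z x - inverse (\<i> ^ m) * complex_of_real (Q x) * dw a b y x) \<in> L2 a b"

definition qd :: "real \<Rightarrow> real \<Rightarrow> nat \<Rightarrow> (real \<Rightarrow> real) \<Rightarrow> (real \<Rightarrow> complex) \<Rightarrow> (real \<Rightarrow> complex) \<Rightarrow> nat \<Rightarrow> real \<Rightarrow> complex" where
  "qd a b m Q y z k =
     (if k \<le> m - 2 then (dw a b ^^ k) y
      else if k = m - 1 then z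
      else (\<lambda>x. dw a b z x - inverse (\<i> ^ m) * complex_of_real (Q x) * dw a b y x))"

definition Lmax_graph :: "real \<Rightarrow> real \<Rightarrow> nat \<Rightarrow> (real \<Rightarrow> real) \<Rightarrow> ((real \<Rightarrow> complex) \<times> (real \<Rightarrow> complex)) set" where
  "Lmax_graph a b m Q = {(u, v). u \<in> L2 a b \<and> v \<in> L2 a b \<and>
      (\<exists>y z. in_Dmax a b m Q y z \<and> ae_on a b u y \<and> ae_on a b v (\<lambda>x. \<i> ^ m * qd a b m Q y z m x))}"

definition Lmin_graph :: "real \<Rightarrow> real \<Rightarrow> nat \<Rightarrow> (real \<Rightarrow> real) \<Rightarrow> ((real \<Rightarrow> complex) \<times> (real \<Rightarrow> complex)) set" where
  "Lmin_graph a b m Q = {(u, v). u \<in> L2 a b \<and> v \<in> L2 a b \<and>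
      (\<exists>y z. in_Dmax a b m Q y z \<and> ae_on a b u y \<and> ae_on a b v (\<lambda>x. \<i> ^ m * qd a b m Q y z m x) \<and>
         (\<forall>k<m. qd a b m Q y z k a = 0 \<and> qd a b m Q y z k b = 0))}"

definition Gamma1 :: "real \<Rightarrow> real \<Rightarrow> nat \<Rightarrow> (real \<Rightarrow> real) \<Rightarrow> (real \<Rightarrow> complex) \<Rightarrow> (real \<Rightarrow> complex) \<Rightarrow> nat \<Rightarrow> complex" where
  "Gamma1 a b m Q y z j =
     (let n = m div 2; D = qd a b m Q y z in
      if j < n then \<i> ^ m * (-1) ^ (j + 1) * D (m - (j + 1)) a
      else if j < 2 * n then \<i> ^ m * (-1) ^ (j - n) * D (m - (j - n + 1)) b
      else if odd m \<and> j = 2 * n then \<i> ^ m * (D n b + D n a)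
      else 0)"

definition Gamma2 :: "real \<Rightarrow> real \<Rightarrow> nat \<Rightarrow> (real \<Rightarrow> real) \<Rightarrow> (real \<Rightarrow> complex) \<Rightarrow> (real \<Rightarrow> complex) \<Rightarrow> nat \<Rightarrow> complex" where
  "Gamma2 a b m Q y z j =
     (let n = m div 2; D = qd a b m Q y z;
          \<gamma> = (-1) ^ n / 2 + \<i>; \<delta> = (-1) ^ (n + 1) / 2 + \<i> in
      if j < n then D j a
      else if j < 2 * n then D (j - n) b
      else if odd m \<and> j = 2 * n then \<gamma> * D n b + \<delta> * D n a
      else 0)"

definition cmat :: "nat \<Rightarrow> (nat \<Rightarrow> nat \<Rightarrow> complex) set" where
  "cmat m = {K. \<forall>i j. (m \<le> i \<or> m \<le> j) \<longrightarrow> K i j = 0}"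

definition mv :: "nat \<Rightarrow> (nat \<Rightarrow> nat \<Rightarrow> complex) \<Rightarrow> (nat \<Rightarrow> complex) \<Rightarrow> nat \<Rightarrow> complex" where
  "mv m K v = (\<lambda>i. if i < m then (\<Sum>j<m. K i j * v j) else 0)"

definition vnorm :: "nat \<Rightarrow> (nat \<Rightarrow> complex) \<Rightarrow> real" where
  "vnorm m v = sqrt (\<Sum>i<m. (cmod (v i))\<^sup>2)"

definition contraction :: "nat \<Rightarrow> (nat \<Rightarrow> nat \<Rightarrow> complex) \<Rightarrow> bool" where
  "contraction m K \<longleftrightarrow> K \<in> cmat m \<and> (\<forall>v. vnorm m (mv m K v) \<le> vnorm m v)"

definition LK_graph :: "real \<Rightarrow> real \<Rightarrow> nat \<Rightarrow> (real \<Rightarrow> real) \<Rightarrow> (nat \<Rightarrow> nat \<Rightarrow> complex)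
    \<Rightarrow> ((real \<Rightarrow> complex) \<times> (real \<Rightarrow> complex)) set" where
  "LK_graph a b m Q K = {(u, v). u \<in> L2 a b \<and> v \<in> L2 a b \<and>
      (\<exists>y z. in_Dmax a b m Q y z \<and> ae_on a b u y \<and> ae_on a b v (\<lambda>x. \<i> ^ m * qd a b m Q y z m x) \<and>
         (\<forall>i<m. (mv m K (Gamma1 a b m Q y z) i - Gamma1 a b m Q y z i)
                 - \<i> * (mv m K (Gamma2 a b m Q y z) i + Gamma2 a b m Q y z i) = 0))}"

end

theory Submission
  imports Defs "Jordan_Normal_Form.Determinant"
begin

text \<open>
  Write \<open>Y k\<close> for the \<open>k\<close>-th quasi-derivative of \<open>y\<close>, so that \<open>L y = f\<close> becomes a linear
  first-order system with integrable coefficients.  The Lagrange identity puts the boundary term of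
  \<open>(L y, w) - (y, L w)\<close> into the form \<open>(\<Gamma>1 y, \<Gamma>2 w) - (\<Gamma>2 y, \<Gamma>1 w)\<close>, and polarisation gives
  \<open>|\<Gamma>1 y + i \<Gamma>2 y|^2 - |\<Gamma>1 y - i \<Gamma>2 y|^2 = 4 Im (L y, y)\<close>, while the condition defining \<open>L^K\<close>
  reads \<open>K (\<Gamma>1 y - i \<Gamma>2 y) = \<Gamma>1 y + i \<Gamma>2 y\<close>.  Hence an accumulative restriction of \<open>L_max\<close> is the
  same as a contractive linear relation between the two boundary vectors, and the maximal ones are
  the contractions defined on all of \<open>C^m\<close>, because the boundary vectors can be prescribed
  arbitrarily and every partial contraction extends.

  An accumulative extension of \<open>L_min\<close> is contained in \<open>(L_min)* = L_max\<close>.  This inclusion, and the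
  density of \<open>Dom L_min\<close>, rest on the fact that every element of \<open>L2\<close> differs from the range of
  \<open>L_min\<close> by an element of \<open>ker L_max\<close>.  Absolutely continuous functions are identified with
  indefinite integrals through their variation and the Radon-Nikodym theorem.
\<close>

text \<open>The obstacle at the start is that \<open>abs_cont_on\<close> is the \<epsilon>-\<delta>
  notion, while the differential equation, its uniqueness and integration by parts speak of
  indefinite integrals; hence both directions of the equivalence come before any operator.
  \<open>Q\<close> is merely integrable, so y^(m-1) need not be continuous and D^[m-1] y is known
  only almost everywhere. Passing to the whole vector of quasi-derivatives keeps every unknown
  absolutely continuous and confines \<open>Q\<close> to two entries of the coefficient matrix. For
  the adjoint, the decisive point is a dimension count: the solution of \<open>L Y = p\<close> with
  zero state at \<open>a\<close> misses the zero state at \<open>b\<close> by a vector in C^m, and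
  the elements of ker \<open>L_max\<close>, also parametrised by C^m, suffice to remove it. For odd
  \<open>m\<close> each endpoint contributes one unpaired middle quasi-derivative; \<gamma> and
  \<delta> merge the two into a single coordinate of each boundary map.\<close>

section \<open>Absolutely continuous functions as indefinite integrals\<close>

text \<open>Intervals witnessing a bad difference quotient form a Vitali cover, and Henstock's lemma bounds
  the total length of disjoint ones.\<close>
lemma indefinite_integral_has_vector_derivative_AE:
  fixes f :: "real \<Rightarrow> 'a::euclidean_space"
  assumes f: "f integrable_on {a..b}"
  shows "negligible {x \<in> {a..b}. \<not> ((\<lambda>u. integral {a..u} f) has_vector_derivative f x) (at x within {a..b})}"
proof -
  define F where "F = (\<lambda>u. integral {a..u} f)"
  have F_diff: "F v - F u = integral {u..v} f" if "a \<le> u" "u \<le> v" "v \<le> b" for u v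
  proof -
    have "f integrable_on {a..v}"
      using f that by (auto intro: integrable_subinterval_real)
    then show ?thesis
      using Henstock_Kurzweil_Integration.integral_combine[OF that(1,2), of f] that by (simp add: F_def algebra_simps)
  qed
  \<comment> \<open>\<open>bad k x y\<close> says that the error of the difference quotient exceeds
    \<open>1 / Suc k\<close>; \<open>N k\<close> collects the points where this happens arbitrarily
    near. Every point without the derivative \<open>f x\<close> lies in some \<open>N k\<close>, so
    countably many null sets suffice.\<close>
  define bad where "bad = (\<lambda>(k::nat) x y. \<bar>y - x\<bar> < real (Suc k) * norm (F y - F x - (y - x) *\<^sub>R f x))"
  define N where "N = (\<lambda>k. {x \<in> {a..b}. \<forall>d>0. \<exists>y\<in>{a..b}. y \<noteq> x \<and> \<bar>y - x\<bar> < d \<and> bad k x y})"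
  have negl: "negligible (N k)" for k
    unfolding negligible_outer_le
  proof (intro allI impI)
    fix e :: real assume "e > 0"
    \<comment> \<open>Each bad interval is shorter than \<open>Suc k\<close> times its own Henstock
      error, so errors summing to less than \<open>e / Suc k\<close> bound the total length by
      \<open>e\<close>.\<close>
    define e' where "e' = e / real (Suc k)"
    have "e' > 0" using \<open>e > 0\<close> by (simp add: e'_def)
    have "f integrable_on cbox a b" using f by simp
    obtain \<gamma> where "gauge \<gamma>"
      and \<gamma>: "\<And>p. \<lbrakk>p tagged_partial_division_of (cbox a b); \<gamma> fine p\<rbrakk> \<Longrightarrow>
               (\<Sum>(x,k)\<in>p. norm (measure lborel k *\<^sub>R f x - integral k f)) < e'"
      by (rule Henstock_lemma[OF \<open>f integrable_on cbox a b\<close> \<open>e' > 0\<close>]) (rule that)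
    define I where "I = (\<lambda>(x::real,y). {min x y..max x y})"
    define K where "K = {(x,y). x \<in> {a..b} \<and> y \<in> {a..b} \<and> x \<noteq> y \<and> I (x,y) \<subseteq> \<gamma> x \<and> bad k x y}"
    \<comment> \<open>The covering theorem is about closed balls; the interval between
      \<open>x\<close> and \<open>y\<close> is one, although its tag \<open>x\<close> is an endpoint
      and not its centre.\<close>
    define c where "c = (\<lambda>(x::real,y). (x + y) / 2)"
    define r where "r = (\<lambda>(x::real,y). \<bar>y - x\<bar> / 2)"
    have cball_eq: "cball (c p) (r p) = I p" for p
      by (cases p) (auto simp: c_def r_def I_def cball_eq_atLeastAtMost field_simps abs_if min_def max_def)
    have r_pos: "0 < r p" if "p \<in> K" for p
      using that by (auto simp: K_def r_def)
    have fineK: "\<exists>p. p \<in> K \<and> x \<in> cball (c p) (r p) \<and> r p < d" if "x \<in> N k" "0 < d" for x d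
    proof -
      from \<open>gauge \<gamma>\<close> obtain \<delta> where \<delta>: "\<delta> > 0" "ball x \<delta> \<subseteq> \<gamma> x"
        unfolding gauge_def by (meson open_contains_ball)
      obtain y where y: "y \<in> {a..b}" "y \<noteq> x" "\<bar>y - x\<bar> < min \<delta> d" "bad k x y"
        using \<open>x \<in> N k\<close> \<delta> \<open>0 < d\<close> unfolding N_def by (auto dest!: spec[of _ "min \<delta> d"])
      have "I (x,y) \<subseteq> ball x \<delta>"
        using y by (auto simp: I_def dist_real_def)
      then have "(x,y) \<in> K"
        using y \<delta> that by (auto simp: K_def N_def)
      moreover have "x \<in> cball (c (x,y)) (r (x,y))"
        unfolding cball_eq by (auto simp: I_def)
      moreover have "r (x,y) < d" using y by (auto simp: r_def)
      ultimately show ?thesis by blast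
    qed
    obtain C where C: "countable C" "C \<subseteq> K"
      and disj: "pairwise (\<lambda>i j. disjnt (cball (c i) (r i)) (cball (c j) (r j))) C"
      and negC: "negligible (N k - (\<Union>i\<in>C. cball (c i) (r i)))"
      by (rule Vitali_covering_theorem_cballs[of K r "N k" c, OF r_pos fineK]) (assumption | rule that)+
    have finite_bound: "measure lebesgue (\<Union>i\<in>C'. cball (c i) (r i)) \<le> e" if C': "C' \<subseteq> C" "finite C'" for C'
    proof -
      define P where "P = (\<lambda>p. (fst p, I p)) ` C'"
      have inj: "inj_on (\<lambda>p. (fst p, I p)) C'"
      proof (rule inj_onI)
        fix p q assume "p \<in> C'" "q \<in> C'" and eq: "(fst p, I p) = (fst q, I q)"
        show "p = q"
        proof (rule ccontr)
          assume "p \<noteq> q"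
          then have "disjnt (I p) (I q)"
            using disj \<open>p \<in> C'\<close> \<open>q \<in> C'\<close> C' by (auto simp: pairwise_def cball_eq)
          moreover have "I p \<noteq> {}" by (cases p) (auto simp: I_def)
          ultimately show False using eq by (auto simp: disjnt_def)
        qed
      qed
      have part: "P tagged_partial_division_of (cbox a b)"
        unfolding tagged_partial_division_of_def
      proof (intro conjI allI impI)
        show "finite P" using C' by (simp add: P_def)
        fix x J assume "(x,J) \<in> P"
        then obtain y where y: "(x,y) \<in> C'" "J = I (x,y)" by (auto simp: P_def)
        then have "(x,y) \<in> K" using C C' by auto
        then show "x \<in> J" "J \<subseteq> cbox a b" "\<exists>u v. J = cbox u v"
          using y by (auto simp: I_def K_def simp flip: box_real(2))
      next
        fix x1 J1 x2 J2 assume *: "(x1,J1) \<in> P \<and> (x2,J2) \<in> P \<and> (x1,J1) \<noteq> (x2,J2)"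
        then obtain p q where "p \<in> C'" "q \<in> C'" "(x1,J1) = (fst p, I p)" "(x2,J2) = (fst q, I q)"
          by (auto simp: P_def)
        moreover from this * have "p \<noteq> q" by auto
        ultimately have "disjnt J1 J2"
          using disj C' by (auto simp: pairwise_def cball_eq)
        then show "interior J1 \<inter> interior J2 = {}"
          using interior_subset[of J1] interior_subset[of J2] by (auto simp: disjnt_def)
      qed
      have fine: "\<gamma> fine P"
        using C C' by (fastforce simp: fine_def P_def K_def)
      have term_le: "measure lebesgue (cball (c p) (r p))
          \<le> real (Suc k) * norm (measure lborel (I p) *\<^sub>R f (fst p) - integral (I p) f)" if "p \<in> C'" for p
      proof -
        obtain x y where p: "p = (x,y)" by (cases p)
        then have K: "(x,y) \<in> K" using that C C' by auto
        then have bad: "bad k x y" and xy: "x \<in> {a..b}" "y \<in> {a..b}" "x \<noteq> y" by (auto simp: K_def)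
        have "norm (F y - F x - (y - x) *\<^sub>R f x) = norm (measure lborel (I p) *\<^sub>R f (fst p) - integral (I p) f)"
        proof (cases "x < y")
          case True
          then have "I p = {x..y}" by (simp add: I_def p)
          moreover have "F y - F x = integral {x..y} f" using F_diff[of x y] True xy by auto
          ultimately show ?thesis using True by (simp add: p norm_minus_commute)
        next
          case False
          then have "I p = {y..x}" using xy by (simp add: I_def p min_def max_def)
          moreover have "F x - F y = integral {y..x} f" using F_diff[of y x] False xy by auto
          moreover have "F y - F x - (y - x) *\<^sub>R f x = (x - y) *\<^sub>R f x - (F x - F y)"
            by (simp add: algebra_simps)
          ultimately show ?thesis using False xy by (simp add: p)
        qed
        moreover have "measure lebesgue (cball (c p) (r p)) = \<bar>y - x\<bar>"
          unfolding cball_eq by (auto simp: I_def p)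
        ultimately show ?thesis using bad by (simp add: bad_def)
      qed
      have "measure lebesgue (\<Union>i\<in>C'. cball (c i) (r i)) \<le> (\<Sum>i\<in>C'. measure lebesgue (cball (c i) (r i)))"
        using C' by (intro measure_UNION_le) auto
      also have "\<dots> \<le> (\<Sum>p\<in>C'. real (Suc k) * norm (measure lborel (I p) *\<^sub>R f (fst p) - integral (I p) f))"
        by (intro sum_mono term_le)
      also have "\<dots> = real (Suc k) * (\<Sum>(x,J)\<in>P. norm (measure lborel J *\<^sub>R f x - integral J f))"
        unfolding P_def using inj by (simp add: sum.reindex sum_distrib_left)
      also have "\<dots> \<le> real (Suc k) * e'"
        using \<gamma>[OF part fine] by (intro mult_left_mono) auto
      also have "\<dots> = e" by (simp add: e'_def)
      finally show ?thesis .
    qed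
    have "(\<Union>i\<in>C. cball (c i) (r i)) \<in> lmeasurable"
      by (rule fmeasurable_UN_bound[OF C(1) _ finite_bound]) auto
    moreover have "measure lebesgue (\<Union>i\<in>C. cball (c i) (r i)) \<le> e"
      by (rule measure_UN_bound[OF C(1) _ finite_bound]) auto
    moreover have "negligible ((N k \<union> (\<Union>i\<in>C. cball (c i) (r i))) - (\<Union>i\<in>C. cball (c i) (r i)))"
      using negC by (rule negligible_subset) auto
    ultimately show "\<exists>T. N k \<subseteq> T \<and> T \<in> lmeasurable \<and> measure lebesgue T \<le> e"
      using measure_negligible_symdiff[of "\<Union>i\<in>C. cball (c i) (r i)" "N k \<union> (\<Union>i\<in>C. cball (c i) (r i))"]
        lmeasurable_negligible_symdiff[of "\<Union>i\<in>C. cball (c i) (r i)" "N k \<union> (\<Union>i\<in>C. cball (c i) (r i))"]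
      by (intro exI[of _ "N k \<union> (\<Union>i\<in>C. cball (c i) (r i))"]) (auto simp: Un_Diff)
  qed
  have sub: "{x \<in> {a..b}. \<not> (F has_vector_derivative f x) (at x within {a..b})} \<subseteq> (\<Union>k. N k)"
  proof clarsimp
    fix x assume x: "a \<le> x" "x \<le> b" and nd: "\<not> (F has_vector_derivative f x) (at x within {a..b})"
    show "\<exists>k. x \<in> N k"
    proof (rule ccontr)
      assume "\<nexists>k. x \<in> N k"
      then have good: "\<exists>d>0. \<forall>y\<in>{a..b}. y \<noteq> x \<and> \<bar>y - x\<bar> < d \<longrightarrow> \<not> bad k x y" for k
        using x unfolding N_def by simp meson
      have "(F has_vector_derivative f x) (at x within {a..b})"
        unfolding has_vector_derivative_def has_derivative_within_alt
      proof (intro conjI allI impI)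
        show "bounded_linear (\<lambda>h. h *\<^sub>R f x)" by (rule bounded_linear_scaleR_left)
        fix e :: real assume "e > 0"
        obtain k where k: "1 / real (Suc k) < e"
          using \<open>e > 0\<close> nat_approx_posE by blast
        obtain d where "d > 0" and d: "\<And>y. y \<in> {a..b} \<Longrightarrow> y \<noteq> x \<Longrightarrow> \<bar>y - x\<bar> < d \<Longrightarrow> \<not> bad k x y"
          using good[of k] by blast
        have "norm (F y - F x - (y - x) *\<^sub>R f x) \<le> e * norm (y - x)" if "y \<in> {a..b}" "norm (y - x) < d" for y
        proof (cases "y = x")
          case False
          then have "real (Suc k) * norm (F y - F x - (y - x) *\<^sub>R f x) \<le> \<bar>y - x\<bar>"
            using d[of y] that by (auto simp: bad_def)
          then have "norm (F y - F x - (y - x) *\<^sub>R f x) \<le> (1 / real (Suc k)) * \<bar>y - x\<bar>"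
            by (simp add: field_simps)
          also have "\<dots> \<le> e * norm (y - x)"
            using k \<open>e > 0\<close> by (intro mult_mono) auto
          finally show ?thesis .
        qed simp
        then show "\<exists>d>0. \<forall>y\<in>{a..b}. norm (y - x) < d \<longrightarrow> norm (F y - F x - (y - x) *\<^sub>R f x) \<le> e * norm (y - x)"
          using \<open>d > 0\<close> by blast
      qed
      with nd show False by blast
    qed
  qed
  have "negligible (\<Union>k. N k)"
    using negl by (intro negligible_Union_nat) auto
  then show ?thesis
    using negligible_subset sub unfolding F_def by blast
qed

section \<open>Absolute continuity over finite families of intervals, and its closure
  properties\<close>

text \<open>The families quantified over in \<open>abs_cont_on\<close>, freed from their indexing by
  an initial segment of \<open>nat\<close>: later ones are indexed by pairs and by the intervals of
  a cover.\<close>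

definition nonoverlapping :: "real \<Rightarrow> real \<Rightarrow> 'i set \<Rightarrow> ('i \<Rightarrow> real) \<Rightarrow> ('i \<Rightarrow> real) \<Rightarrow> bool" where
  "nonoverlapping a b I u v \<longleftrightarrow> finite I \<and> (\<forall>i\<in>I. a \<le> u i \<and> u i \<le> v i \<and> v i \<le> b) \<and>
     (\<forall>i\<in>I. \<forall>j\<in>I. i \<noteq> j \<longrightarrow> v i \<le> u j \<or> v j \<le> u i)"

lemma abs_cont_on_nonoverlapping:
  assumes "abs_cont_on a b f" "\<epsilon> > 0"
  obtains \<delta> where "\<delta> > 0"
    "\<And>(I::'i set) u v. nonoverlapping a b I u v \<Longrightarrow> (\<Sum>i\<in>I. v i - u i) < \<delta> \<Longrightarrow> (\<Sum>i\<in>I. cmod (f (v i) - f (u i))) < \<epsilon>"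
proof -
  from assms(1)[unfolded abs_cont_on_def, THEN spec, THEN mp, OF assms(2)]
  obtain \<delta> where "\<delta> > 0" and \<delta>: "\<forall>(n::nat) u v. (\<forall>i<n. a \<le> u i \<and> u i \<le> v i \<and> v i \<le> b) \<and>
        (\<forall>i<n. \<forall>j<n. i \<noteq> j \<longrightarrow> v i \<le> u j \<or> v j \<le> u i) \<and>
        (\<Sum>i<n. v i - u i) < \<delta> \<longrightarrow> (\<Sum>i<n. cmod (f (v i) - f (u i))) < \<epsilon>"
    by (elim exE conjE)
  have "(\<Sum>i\<in>I. cmod (f (v i) - f (u i))) < \<epsilon>"
    if fam: "nonoverlapping a b I u v" and len: "(\<Sum>i\<in>I. v i - u i) < \<delta>" for I :: "'i set" and u v
  proof -
    obtain h where h: "bij_betw h {..<card I} I"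
      using fam ex_bij_betw_nat_finite[of I] by (auto simp: nonoverlapping_def atLeast0LessThan)
    have hI: "h i \<in> I" if "i < card I" for i using h that by (auto simp: bij_betw_def)
    have hinj: "h i \<noteq> h j" if "i < card I" "j < card I" "i \<noteq> j" for i j
      using h that by (auto simp: bij_betw_def inj_on_def)
    have "(\<Sum>i<card I. cmod (f (v (h i)) - f (u (h i)))) < \<epsilon>"
    proof (rule \<delta>[THEN spec, THEN spec, THEN spec, THEN mp, of _ "\<lambda>i. u (h i)"], intro conjI)
      show "(\<Sum>i<card I. v (h i) - u (h i)) < \<delta>"
        using len sum.reindex_bij_betw[OF h, of "\<lambda>i. v i - u i"] by simp
    qed (use fam hI hinj in \<open>auto simp: nonoverlapping_def\<close>)
    then show ?thesis
      using sum.reindex_bij_betw[OF h, of "\<lambda>i. cmod (f (v i) - f (u i))"] by simp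
  qed
  with \<open>\<delta> > 0\<close> show ?thesis using that by blast
qed

lemma abs_cont_onI:
  assumes "\<And>\<epsilon>. \<epsilon> > 0 \<Longrightarrow> \<exists>\<delta>>0. \<forall>(I::nat set) u v. nonoverlapping a b I u v \<longrightarrow> (\<Sum>i\<in>I. v i - u i) < \<delta>
             \<longrightarrow> (\<Sum>i\<in>I. cmod (f (v i) - f (u i))) < \<epsilon>"
  shows "abs_cont_on a b f"
  unfolding abs_cont_on_def
proof (intro allI impI)
  fix \<epsilon> :: real assume "\<epsilon> > 0"
  from assms[OF this] obtain \<delta> where "\<delta> > 0" and
    \<delta>: "\<And>(I::nat set) u v. nonoverlapping a b I u v \<Longrightarrow> (\<Sum>i\<in>I. v i - u i) < \<delta> \<Longrightarrow>
          (\<Sum>i\<in>I. cmod (f (v i) - f (u i))) < \<epsilon>" by blast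
  show "\<exists>\<delta>>0. \<forall>(n::nat) u v. (\<forall>i<n. a \<le> u i \<and> u i \<le> v i \<and> v i \<le> b) \<and>
         (\<forall>i<n. \<forall>j<n. i \<noteq> j \<longrightarrow> v i \<le> u j \<or> v j \<le> u i) \<and> (\<Sum>i<n. v i - u i) < \<delta> \<longrightarrow>
         (\<Sum>i<n. cmod (f (v i) - f (u i))) < \<epsilon>"
  proof (intro exI[of _ \<delta>] conjI allI impI)
    fix n :: nat and u v
    assume "(\<forall>i<n. a \<le> u i \<and> u i \<le> v i \<and> v i \<le> b) \<and>
         (\<forall>i<n. \<forall>j<n. i \<noteq> j \<longrightarrow> v i \<le> u j \<or> v j \<le> u i) \<and> (\<Sum>i<n. v i - u i) < \<delta>"
    then show "(\<Sum>i<n. cmod (f (v i) - f (u i))) < \<epsilon>"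
      by (intro \<delta>) (auto simp: nonoverlapping_def)
  qed fact
qed

lemma abs_cont_on_continuous:
  assumes "abs_cont_on a b f"
  shows "continuous_on {a..b} f"
  unfolding continuous_on_iff
proof (intro ballI allI impI)
  fix x \<epsilon> :: real assume x: "x \<in> {a..b}" and "\<epsilon> > 0"
  obtain \<delta> where "\<delta> > 0" and \<delta>: "\<And>(I::nat set) u v. nonoverlapping a b I u v \<Longrightarrow> (\<Sum>i\<in>I. v i - u i) < \<delta> \<Longrightarrow>
          (\<Sum>i\<in>I. cmod (f (v i) - f (u i))) < \<epsilon>"
    using abs_cont_on_nonoverlapping[OF assms \<open>\<epsilon> > 0\<close>] by blast
  have "dist (f y) (f x) < \<epsilon>" if "y \<in> {a..b}" "dist y x < \<delta>" for y
    using \<delta>[of "{0}" "\<lambda>_. min x y" "\<lambda>_. max x y"] that x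
    by (cases "x \<le> y") (auto simp: nonoverlapping_def dist_norm min_def max_def norm_minus_commute)
  then show "\<exists>d>0. \<forall>y\<in>{a..b}. dist y x < d \<longrightarrow> dist (f y) (f x) < \<epsilon>"
    using \<open>\<delta> > 0\<close> by blast
qed

text \<open>One estimate serves all closure properties: sums, multiples, conjugates, products and
  changes off the interval each have increments bounded by those of the given functions.\<close>

lemma abs_cont_on_dominated:
  assumes f: "abs_cont_on a b f" and g: "abs_cont_on a b g"
    and le: "\<And>x y. a \<le> x \<Longrightarrow> x \<le> y \<Longrightarrow> y \<le> b \<Longrightarrow> cmod (h y - h x) \<le> B * (cmod (f y - f x) + cmod (g y - g x))"
  shows "abs_cont_on a b h"
proof (rule abs_cont_onI)
  fix \<epsilon> :: real assume "\<epsilon> > 0"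
  \<comment> \<open>\<open>\<bar>B\<bar> + 1\<close> keeps the divisor positive for every
    \<open>B\<close>; the factor \<open>2\<close> shares \<epsilon> between \<open>f\<close> and
    \<open>g\<close>.\<close>
  define \<eta> where "\<eta> = \<epsilon> / (2 * (\<bar>B\<bar> + 1))"
  have "\<eta> > 0" using \<open>\<epsilon> > 0\<close> by (auto simp: \<eta>_def)
  obtain \<delta>1 where "\<delta>1 > 0" and \<delta>1: "\<And>(I::nat set) u v. nonoverlapping a b I u v \<Longrightarrow> (\<Sum>i\<in>I. v i - u i) < \<delta>1 \<Longrightarrow>
          (\<Sum>i\<in>I. cmod (f (v i) - f (u i))) < \<eta>"
    using abs_cont_on_nonoverlapping[OF f \<open>\<eta> > 0\<close>] by blast
  obtain \<delta>2 where "\<delta>2 > 0" and \<delta>2: "\<And>(I::nat set) u v. nonoverlapping a b I u v \<Longrightarrow> (\<Sum>i\<in>I. v i - u i) < \<delta>2 \<Longrightarrow>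
          (\<Sum>i\<in>I. cmod (g (v i) - g (u i))) < \<eta>"
    using abs_cont_on_nonoverlapping[OF g \<open>\<eta> > 0\<close>] by blast
  have "(\<Sum>i\<in>I. cmod (h (v i) - h (u i))) < \<epsilon>"
    if fam: "nonoverlapping a b I u v" and len: "(\<Sum>i\<in>I. v i - u i) < min \<delta>1 \<delta>2" for I :: "nat set" and u v
  proof -
    have "(\<Sum>i\<in>I. cmod (h (v i) - h (u i))) \<le> (\<Sum>i\<in>I. B * (cmod (f (v i) - f (u i)) + cmod (g (v i) - g (u i))))"
      using fam by (intro sum_mono le) (auto simp: nonoverlapping_def)
    also have "\<dots> = B * ((\<Sum>i\<in>I. cmod (f (v i) - f (u i))) + (\<Sum>i\<in>I. cmod (g (v i) - g (u i))))"
      by (simp add: sum_distrib_left sum.distrib distrib_left)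
    also have "\<dots> \<le> (\<bar>B\<bar> + 1) * ((\<Sum>i\<in>I. cmod (f (v i) - f (u i))) + (\<Sum>i\<in>I. cmod (g (v i) - g (u i))))"
      by (intro mult_right_mono add_nonneg_nonneg sum_nonneg) auto
    also have "\<dots> < (\<bar>B\<bar> + 1) * (\<eta> + \<eta>)"
      using \<delta>1[OF fam] \<delta>2[OF fam] len by (intro mult_strict_left_mono add_strict_mono) auto
    also have "\<dots> = \<epsilon>"
    proof -
      have "\<bar>B\<bar> + 1 \<noteq> 0" by linarith
      then show ?thesis unfolding \<eta>_def by (simp add: divide_simps)
    qed
    finally show ?thesis .
  qed
  then show "\<exists>\<delta>>0. \<forall>(I::nat set) u v. nonoverlapping a b I u v \<longrightarrow> (\<Sum>i\<in>I. v i - u i) < \<delta>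
             \<longrightarrow> (\<Sum>i\<in>I. cmod (h (v i) - h (u i))) < \<epsilon>"
    using \<open>\<delta>1 > 0\<close> \<open>\<delta>2 > 0\<close> by (intro exI[of _ "min \<delta>1 \<delta>2"]) auto
qed

lemma abs_cont_on_add:
  assumes "abs_cont_on a b f" "abs_cont_on a b g"
  shows "abs_cont_on a b (\<lambda>x. f x + g x)"
  by (rule abs_cont_on_dominated[OF assms, where B = 1])
     (simp add: add_diff_add norm_triangle_ineq)

lemma abs_cont_on_cmult:
  assumes "abs_cont_on a b f"
  shows "abs_cont_on a b (\<lambda>x. c * f x)"
  by (rule abs_cont_on_dominated[OF assms assms, where B = "cmod c"])
     (simp add: norm_mult flip: right_diff_distrib)

lemma abs_cont_on_const: "abs_cont_on a b (\<lambda>x. c)"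
  by (auto simp: abs_cont_on_def intro!: exI[of _ 1])

lemma abs_cont_on_cnj:
  assumes "abs_cont_on a b f"
  shows "abs_cont_on a b (\<lambda>x. cnj (f x))"
  by (rule abs_cont_on_dominated[OF assms assms, where B = 1])
     (simp flip: complex_cnj_diff)

lemma abs_cont_on_mult:
  assumes f: "abs_cont_on a b f" and g: "abs_cont_on a b g"
  shows "abs_cont_on a b (\<lambda>x. f x * g x)"
proof -
  have "bounded (f ` {a..b})" "bounded (g ` {a..b})"
    using f g by (auto intro!: compact_imp_bounded compact_continuous_image abs_cont_on_continuous)
  then obtain Bf Bg where "\<forall>z\<in>f ` {a..b}. cmod z \<le> Bf" "\<forall>z\<in>g ` {a..b}. cmod z \<le> Bg"
    unfolding bounded_iff by (elim exE)
  then have B: "cmod (f x) \<le> Bf" "cmod (g x) \<le> Bg" if "x \<in> {a..b}" for x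
    using that by simp_all
  show ?thesis
  proof (rule abs_cont_on_dominated[OF f g, where B = "\<bar>Bf\<bar> + \<bar>Bg\<bar>"])
    fix x y assume xy: "a \<le> x" "x \<le> y" "y \<le> b"
    have "f y * g y - f x * g x = f y * (g y - g x) + (f y - f x) * g x"
      by (simp add: algebra_simps)
    also have "cmod \<dots> \<le> cmod (f y) * cmod (g y - g x) + cmod (f y - f x) * cmod (g x)"
      by (metis norm_triangle_ineq norm_mult)
    also have "\<dots> \<le> (\<bar>Bf\<bar> + \<bar>Bg\<bar>) * cmod (g y - g x) + cmod (f y - f x) * (\<bar>Bf\<bar> + \<bar>Bg\<bar>)"
      using B(1)[of y] B(2)[of x] xy by (intro add_mono mult_mono) auto
    finally show "cmod (f y * g y - f x * g x) \<le> (\<bar>Bf\<bar> + \<bar>Bg\<bar>) * (cmod (f y - f x) + cmod (g y - g x))"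
      by (simp add: algebra_simps)
  qed
qed

lemma abs_cont_on_cong:
  assumes "abs_cont_on a b f" "\<And>x. x \<in> {a..b} \<Longrightarrow> f x = g x"
  shows "abs_cont_on a b g"
proof (rule abs_cont_on_dominated[OF assms(1,1), where B = 1])
  fix x y assume "a \<le> x" "x \<le> y" "y \<le> b"
  then show "cmod (g y - g x) \<le> 1 * (cmod (f y - f x) + cmod (f y - f x))"
    using assms(2)[of x] assms(2)[of y] by simp
qed

text \<open>Passing to open intervals leaves every integral unchanged and makes the family disjoint
  even where closed ones share an endpoint, so the indicators sum to at most
  \<open>1\<close>.\<close>

lemma sum_integral_nonoverlapping_le:
  fixes h :: "real \<Rightarrow> real"
  assumes h: "integrable (lebesgue_on {a..b}) h" and pos: "\<And>x. x \<in> {a..b} \<Longrightarrow> 0 \<le> h x"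
    and fam: "nonoverlapping a b I u v"
  shows "(\<Sum>i\<in>I. integral {u i..v i} h) \<le> integral {a..b} h"
proof -
  have int: "integrable (lebesgue_on {a..b}) (\<lambda>x. indicator {u i<..<v i} x *\<^sub>R h x)" if "i \<in> I" for i
    using that fam by (intro integrable_mult_indicator h) (auto simp: nonoverlapping_def sets_restrict_space_iff)
  have eq: "integral {u i..v i} h = (LINT x|lebesgue_on {a..b}. indicator {u i<..<v i} x *\<^sub>R h x)" if "i \<in> I" for i
  proof -
    have sub: "{u i<..<v i} \<subseteq> {a..b}" using that fam by (force simp: nonoverlapping_def)
    have "(LINT x|lebesgue_on {a..b}. indicator {u i<..<v i} x *\<^sub>R h x)
        = integral {a..b} (\<lambda>x. indicator {u i<..<v i} x *\<^sub>R h x)"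
      using int[OF that] by (intro lebesgue_integral_eq_integral) auto
    also have "\<dots> = integral {a..b} (\<lambda>x. if x \<in> {u i<..<v i} then h x else 0)"
      by (intro Henstock_Kurzweil_Integration.integral_cong) (auto simp: indicator_def)
    also have "\<dots> = integral {u i<..<v i} h"
      using sub by (simp only: Henstock_Kurzweil_Integration.integral_restrict_Int Int_absorb2)
    also have "\<dots> = integral {u i..v i} h"
      using integral_open_interval[of "u i" "v i" h] by simp
    finally show ?thesis by simp
  qed
  have "(\<Sum>i\<in>I. integral {u i..v i} h) = (LINT x|lebesgue_on {a..b}. (\<Sum>i\<in>I. indicator {u i<..<v i} x *\<^sub>R h x))"
    using int eq by (simp add: Bochner_Integration.integral_sum)
  also have "\<dots> \<le> (LINT x|lebesgue_on {a..b}. h x)"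
  proof (rule integral_mono[OF _ h])
    show "integrable (lebesgue_on {a..b}) (\<lambda>x. \<Sum>i\<in>I. indicator {u i<..<v i} x *\<^sub>R h x)"
      using int by (intro Bochner_Integration.integrable_sum) auto
    fix x assume "x \<in> space (lebesgue_on {a..b})"
    then have x: "x \<in> {a..b}" by simp
    have "finite I" using fam by (simp add: nonoverlapping_def)
    have "(\<Sum>i\<in>I. indicat_real {u i<..<v i} x) \<le> 1"
    proof (cases "\<exists>j\<in>I. x \<in> {u j<..<v j}")
      case True
      then obtain j where j: "j \<in> I" "x \<in> {u j<..<v j}" by blast
      have "indicat_real {u i<..<v i} x = (if i = j then 1 else 0)" if "i \<in> I" for i
        using that j fam by (force simp: nonoverlapping_def indicator_def)
      then have "(\<Sum>i\<in>I. indicat_real {u i<..<v i} x) = (\<Sum>i\<in>I. if i = j then 1 else 0)"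
        by (intro sum.cong) auto
      then show ?thesis using j \<open>finite I\<close> by simp
    next
      case False
      then have "(\<Sum>i\<in>I. indicat_real {u i<..<v i} x) = 0"
        by (intro sum.neutral) (auto simp: indicator_def)
      then show ?thesis by simp
    qed
    then have "(\<Sum>i\<in>I. indicat_real {u i<..<v i} x) * h x \<le> 1 * h x"
      using pos[OF x] by (intro mult_right_mono) auto
    then show "(\<Sum>i\<in>I. indicator {u i<..<v i} x *\<^sub>R h x) \<le> h x"
      by (simp add: sum_distrib_right)
  qed
  also have "\<dots> = integral {a..b} h"
    using h by (intro lebesgue_integral_eq_integral) auto
  finally show ?thesis .
qed

lemma integral_diff_eq:
  fixes f :: "real \<Rightarrow> 'a::euclidean_space"
  assumes "integrable (lebesgue_on {a..b}) f" "a \<le> u" "u \<le> v" "v \<le> b"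
  shows "integral {a..v} f - integral {a..u} f = integral {u..v} f"
proof -
  have "f integrable_on {a..v}"
    using assms by (intro integrable_on_lebesgue_on integrable_subinterval[OF assms(1)]) auto
  then show ?thesis
    using Henstock_Kurzweil_Integration.integral_combine[of a u v f] assms by (simp add: algebra_simps)
qed

text \<open>Cut the modulus of \<open>f\<close> at height \<open>n\<close>: the excess
  \<open>h n\<close> has small total integral by dominated convergence, and the part below
  \<open>n\<close> contributes at most \<open>n\<close> times the total length.\<close>

lemma abs_cont_on_integral:
  fixes f :: "real \<Rightarrow> complex"
  assumes f: "integrable (lebesgue_on {a..b}) f"
  shows "abs_cont_on a b (\<lambda>x. integral {a..x} f)"
proof (rule abs_cont_onI)
  fix \<epsilon> :: real assume "\<epsilon> > 0"
  let ?M = "lebesgue_on {a..b}"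
  define h where "h = (\<lambda>(n::nat) x. max 0 (cmod (f x) - real n))"
  have nf: "integrable ?M (\<lambda>x. cmod (f x))" using f by simp
  have h_int: "integrable ?M (h n)" for n
  proof (rule Bochner_Integration.integrable_bound[OF nf])
    have [measurable]: "f \<in> borel_measurable ?M" using f by (rule borel_measurable_integrable)
    show "h n \<in> borel_measurable ?M" unfolding h_def by measurable
    show "AE x in ?M. norm (h n x) \<le> norm (cmod (f x))"
      by (rule AE_I2) (auto simp: h_def)
  qed
  have "(\<lambda>n. LINT x|?M. h n x) \<longlonglongrightarrow> (LINT x|?M. (0::real))"
  proof (rule integral_dominated_convergence[where w = "\<lambda>x. cmod (f x)"])
    show "AE x in ?M. (\<lambda>n. h n x) \<longlonglongrightarrow> 0"
    proof (rule AE_I2)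
      fix x
      obtain N :: nat where "cmod (f x) \<le> real N" using real_arch_simple by blast
      then have "\<forall>n\<ge>N. h n x = 0" by (auto simp: h_def)
      then show "(\<lambda>n. h n x) \<longlonglongrightarrow> 0"
        by (intro tendsto_eventually) (auto simp: eventually_sequentially)
    qed
    show "AE x in ?M. norm (h n x) \<le> cmod (f x)" for n
      by (rule AE_I2) (auto simp: h_def)
  qed (use nf h_int in \<open>simp_all add: borel_measurable_integrable\<close>)
  from order_tendstoD(2)[OF this, of "\<epsilon> / 2"] \<open>\<epsilon> > 0\<close>
  have "\<forall>\<^sub>F n in sequentially. (LINT x|?M. h n x) < \<epsilon> / 2" by simp
  then obtain n where n: "(LINT x|?M. h n x) < \<epsilon> / 2"
    using eventually_happens'[OF sequentially_bot] by blast
  define \<delta> where "\<delta> = \<epsilon> / (2 * (real n + 1))"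
  have "(\<Sum>i\<in>I. cmod (integral {a..v i} f - integral {a..u i} f)) < \<epsilon>"
    if fam: "nonoverlapping a b I u v" and len: "(\<Sum>i\<in>I. v i - u i) < \<delta>" for I :: "nat set" and u v
  proof -
    have "(\<Sum>i\<in>I. cmod (integral {a..v i} f - integral {a..u i} f)) \<le> (\<Sum>i\<in>I. real n * (v i - u i) + integral {u i..v i} (h n))"
    proof (rule sum_mono)
      fix i assume "i \<in> I"
      then have uv: "a \<le> u i" "u i \<le> v i" "v i \<le> b" using fam by (auto simp: nonoverlapping_def)
      have sub: "{u i..v i} \<subseteq> {a..b}" using uv by simp
      have io: "f integrable_on {u i..v i}" "h n integrable_on {u i..v i}"
        using integrable_on_lebesgue_on[OF integrable_subinterval[OF f sub]]
          integrable_on_lebesgue_on[OF integrable_subinterval[OF h_int[of n] sub]] by simp_all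
      have "cmod (integral {a..v i} f - integral {a..u i} f) = cmod (integral {u i..v i} f)"
        using integral_diff_eq[OF f uv] by simp
      also have "\<dots> \<le> integral {u i..v i} (\<lambda>x. real n + h n x)"
      proof (rule integral_norm_bound_integral[OF io(1)])
        show "(\<lambda>x. real n + h n x) integrable_on {u i..v i}"
          by (intro Henstock_Kurzweil_Integration.integrable_add integrable_const_ivl io(2))
      qed (simp add: h_def)
      also have "\<dots> = real n * (v i - u i) + integral {u i..v i} (h n)"
        using Henstock_Kurzweil_Integration.integral_add[OF integrable_const_ivl io(2), of "real n"] uv by simp
      finally show "cmod (integral {a..v i} f - integral {a..u i} f) \<le> real n * (v i - u i) + integral {u i..v i} (h n)" .
    qed
    also have "\<dots> = real n * (\<Sum>i\<in>I. v i - u i) + (\<Sum>i\<in>I. integral {u i..v i} (h n))"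
      by (simp add: sum.distrib sum_distrib_left)
    also have "\<dots> \<le> real n * \<delta> + integral {a..b} (h n)"
      using len by (intro add_mono mult_left_mono sum_integral_nonoverlapping_le h_int fam) (auto simp: h_def)
    also have "integral {a..b} (h n) = (LINT x|?M. h n x)"
      using h_int by (simp add: lebesgue_integral_eq_integral)
    also have "real n * \<delta> \<le> \<epsilon> / 2"
      using \<open>\<epsilon> > 0\<close> by (simp add: \<delta>_def field_simps)
    finally show ?thesis using n by simp
  qed
  moreover have "\<delta> > 0" using \<open>\<epsilon> > 0\<close> by (simp add: \<delta>_def)
  ultimately show "\<exists>\<delta>>0. \<forall>(I::nat set) u v. nonoverlapping a b I u v \<longrightarrow> (\<Sum>i\<in>I. v i - u i) < \<delta>
             \<longrightarrow> (\<Sum>i\<in>I. cmod (integral {a..v i} f - integral {a..u i} f)) < \<epsilon>" by blast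
qed

section \<open>Density of a monotone absolutely continuous function\<close>

text \<open>The increments of \<open>G\<close> define a Stieltjes measure. The \<epsilon>-\<delta>
  condition makes it small on finite families of intervals of small total length, hence zero on
  Lebesgue null sets; its Radon-Nikodym density is the required \<open>g\<close>.\<close>

lemma mono_abs_cont_imp_density:
  fixes G :: "real \<Rightarrow> real"
  assumes ab: "a < b" and mono: "mono_on {a..b} G" and ac: "abs_cont_on a b (\<lambda>x. complex_of_real (G x))"
  obtains g where "integrable (lebesgue_on {a..b}) g" "\<And>x. x \<in> {a..b} \<Longrightarrow> G x = G a + integral {a..x} g"
proof -
  \<comment> \<open>The Stieltjes measure takes a monotone function on the whole line; clamping the
    argument continues \<open>G\<close> by constants and keeps it continuous.\<close>
  define cl where "cl = (\<lambda>x. max a (min b x))"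
  define F where "F = (\<lambda>x. G (cl x))"
  have cl: "cl x \<in> {a..b}" for x using ab by (auto simp: cl_def)
  have cl_id: "cl x = x" if "x \<in> {a..b}" for x using that by (auto simp: cl_def)
  have cl_mono: "cl x \<le> cl y" if "x \<le> y" for x y using that by (auto simp: cl_def)
  have Fmono: "F x \<le> F y" if "x \<le> y" for x y
    using mono cl cl_mono[OF that] by (auto simp: F_def mono_on_def)
  have "continuous_on {a..b} (\<lambda>x. Re (complex_of_real (G x)))"
    using abs_cont_on_continuous[OF ac] by (intro continuous_on_Re)
  then have "continuous_on {a..b} G" by simp
  moreover have "continuous_on UNIV cl"
    unfolding cl_def by (intro continuous_intros)
  ultimately have Fcont: "continuous_on UNIV F"
    unfolding F_def using cl by (intro continuous_on_compose2[of "{a..b}" G UNIV cl]) auto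
  define \<mu> where "\<mu> = interval_measure F"
  have \<mu>_Icc: "emeasure \<mu> {x..y} = ennreal (F y - F x)" if "x \<le> y" for x y
    unfolding \<mu>_def using that Fmono Fcont by (intro emeasure_interval_measure_Icc) auto
  have sets_\<mu>: "sets \<mu> = sets borel" by (simp add: \<mu>_def)
  \<comment> \<open>Cutting the measure off to \<open>{a..b}\<close> reduces the test on a null set
    to its part inside the interval, where the hypothesis on \<open>G\<close> applies.\<close>
  define \<nu> where "\<nu> = density \<mu> (indicator {a..b})"
  have sets_\<nu>: "sets \<nu> = sets borel" by (simp add: \<nu>_def sets_\<mu>)
  have \<nu>_eq: "emeasure \<nu> A = emeasure \<mu> (A \<inter> {a..b})" if "A \<in> sets borel" for A
  proof -
    have "emeasure \<nu> A = (\<integral>\<^sup>+ x. indicator {a..b} x * indicator A x \<partial>\<mu>)"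
      unfolding \<nu>_def using that by (intro emeasure_density) (auto simp: sets_\<mu> cong: measurable_cong_sets)
    also have "\<dots> = (\<integral>\<^sup>+ x. indicator (A \<inter> {a..b}) x \<partial>\<mu>)"
      by (intro nn_integral_cong) (auto simp: indicator_def)
    also have "\<dots> = emeasure \<mu> (A \<inter> {a..b})"
      using that by (intro nn_integral_indicator) (auto simp: sets_\<mu>)
    finally show ?thesis .
  qed
  have "absolutely_continuous lborel \<nu>"
    unfolding absolutely_continuous_def
  proof
    fix N :: "real set" assume N: "N \<in> null_sets lborel"
    then have Nb: "N \<in> sets borel" by auto
    define S where "S = N \<inter> {a..b}"
    have Sb: "S \<in> sets borel" using Nb by (auto simp: S_def)
    have S0: "emeasure lebesgue S = 0"
    proof -
      have "S \<in> null_sets lborel" unfolding S_def using N by (intro null_set_Int2) auto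
      then have "S \<in> null_sets lebesgue" by (rule null_sets_completionI)
      then show ?thesis by auto
    qed
    have bound: "emeasure \<mu> S \<le> ennreal \<epsilon>" if "\<epsilon> > 0" for \<epsilon>
    proof -
      obtain \<delta> where "\<delta> > 0" and \<delta>: "\<And>(I::real set set) u v. nonoverlapping a b I u v \<Longrightarrow> (\<Sum>i\<in>I. v i - u i) < \<delta> \<Longrightarrow>
          (\<Sum>i\<in>I. cmod (complex_of_real (G (v i)) - complex_of_real (G (u i)))) < \<epsilon>"
        by (rule abs_cont_on_nonoverlapping[OF ac \<open>\<epsilon> > 0\<close>]) (rule that)
      have Sl: "S \<in> sets lebesgue" using Sb by auto
      obtain U where U: "open U" "S \<subseteq> U" "U - S \<in> lmeasurable" "emeasure lebesgue (U - S) < ennreal \<delta>"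
        by (rule sets_lebesgue_outer_open[OF Sl \<open>\<delta> > 0\<close>]) (rule that)
      have Ul: "U \<in> sets lebesgue" using \<open>open U\<close> by auto
      have "emeasure lebesgue (U - S) = emeasure lebesgue U"
        using S0 Sl Ul by (intro emeasure_Diff_null_set) auto
      then have U\<delta>: "emeasure lebesgue U < ennreal \<delta>" using U by simp
      then have Ulm: "U \<in> lmeasurable" using Ul by (intro fmeasurableI) (auto intro: less_trans)
      have U\<delta>': "measure lebesgue U < \<delta>"
        using U\<delta> Ulm \<open>\<delta> > 0\<close> by (simp add: emeasure_eq_measure2 ennreal_less_iff)
      \<comment> \<open>This gauge forces every covering interval into \<open>U\<close>, because its
        tag lies in \<open>S\<close> and hence in \<open>U\<close>.\<close>
      define \<gamma> where "\<gamma> = (\<lambda>x. if x \<in> U then U else UNIV)"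
      have "gauge \<gamma>" using \<open>open U\<close> by (auto simp: gauge_def \<gamma>_def)
      have "S \<subseteq> cbox a b" "box a b \<noteq> {}" using ab by (auto simp: S_def)
      obtain \<D> where D: "countable \<D>" "\<Union>\<D> \<subseteq> cbox a b"
        "\<And>K. K \<in> \<D> \<Longrightarrow> interior K \<noteq> {} \<and> (\<exists>c d. K = cbox c d)"
        "pairwise (\<lambda>A B. interior A \<inter> interior B = {}) \<D>"
        "\<And>K. K \<in> \<D> \<Longrightarrow> \<exists>x \<in> S \<inter> K. K \<subseteq> \<gamma> x"
        "S \<subseteq> \<Union>\<D>" by (rule covering_lemma[OF \<open>S \<subseteq> cbox a b\<close> \<open>box a b \<noteq> {}\<close> \<open>gauge \<gamma>\<close>]) (rule that)
      have Kint: "\<exists>c d. c < d \<and> a \<le> c \<and> d \<le> b \<and> K = {c..d}" if K: "K \<in> \<D>" for K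
      proof -
        obtain c d where cd: "K = {c..d}" "{c<..<d} \<noteq> {}"
          using D(3)[OF K] by (auto simp: interior_cbox)
        then have "c < d" by auto
        moreover have "K \<subseteq> cbox a b" using Union_upper[OF K] D(2) by (rule subset_trans)
        then have "{c..d} \<subseteq> {a..b}" using cd by simp
        ultimately have "a \<le> c" "d \<le> b" by auto
        with \<open>c < d\<close> cd show ?thesis by auto
      qed
      \<comment> \<open>The endpoints are recovered from the interval as a set, which lets the cover
        be indexed by its own members.\<close>
      define c d where "c = (\<lambda>K::real set. Inf K)" and "d = (\<lambda>K::real set. Sup K)"
      have K: "c K < d K" "a \<le> c K" "d K \<le> b" "{c K..d K} = K" if "K \<in> \<D>" for K
        using Kint[OF that] by (auto simp: c_def d_def)
      have K_interior: "interior K = {c K<..<d K}" if "K \<in> \<D>" for K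
        using interior_atLeastAtMost_real[of "c K" "d K"] K(4)[OF that] by simp
      have K_lmeas: "K \<in> lmeasurable" "measure lebesgue K = d K - c K" if "K \<in> \<D>" for K
      proof -
        have "{c K..d K} \<in> lmeasurable" "measure lebesgue {c K..d K} = d K - c K"
          using K(1)[OF that] by (subst measure_completion | simp)+
        then show "K \<in> lmeasurable" "measure lebesgue K = d K - c K"
          using K(4)[OF that] by simp_all
      qed
      have K_\<mu>: "K \<in> fmeasurable \<mu>" "measure \<mu> K = G (d K) - G (c K)" if "K \<in> \<D>" for K
      proof -
        have "emeasure \<mu> K = ennreal (F (d K) - F (c K))"
          using \<mu>_Icc[of "c K" "d K"] K[OF that] by simp
        moreover have "F (d K) = G (d K)" "F (c K) = G (c K)"
          using cl_id[of "c K"] cl_id[of "d K"] K[OF that] by (simp_all add: F_def)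
        moreover have "G (c K) \<le> G (d K)"
          using K[OF that] by (intro mono_onD[OF mono]) auto
        moreover have "K \<in> sets \<mu>"
          using atLeastAtMost_borel[of "c K" "d K"] K(4)[OF that] by (simp add: sets_\<mu>)
        ultimately show "K \<in> fmeasurable \<mu>" "measure \<mu> K = G (d K) - G (c K)"
          by (auto simp: measure_def intro: fmeasurableI)
      qed
      have KU: "K \<subseteq> U" if KD: "K \<in> \<D>" for K
      proof -
        obtain x where "x \<in> S" "K \<subseteq> \<gamma> x" using D(5)[OF KD] by blast
        with \<open>S \<subseteq> U\<close> show ?thesis by (auto simp: \<gamma>_def split: if_splits)
      qed
      have disj: "d K \<le> c L \<or> d L \<le> c K" if KL: "K \<in> \<D>" "L \<in> \<D>" "K \<noteq> L" for K L
      proof (rule ccontr)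
        assume "\<not> ?thesis"
        then have ov: "c L < d K" "c K < d L" by auto
        have "interior K \<inter> interior L = {}"
          using D(4) KL by (simp add: pairwise_def)
        then have "{c K<..<d K} \<inter> {c L<..<d L} = {}"
          using K_interior KL by simp
        moreover have "(max (c K) (c L) + min (d K) (d L)) / 2 \<in> {c K<..<d K} \<inter> {c L<..<d L}"
          using ov K(1)[OF KL(1)] K(1)[OF KL(2)] unfolding max_def min_def by auto
        ultimately show False by blast
      qed
      \<comment> \<open>Absolute continuity controls finite families only; the bound does not depend
        on the family and so passes to the countable union below.\<close>
      have fin: "measure \<mu> (\<Union>\<D>') \<le> \<epsilon>" if \<D>': "\<D>' \<subseteq> \<D>" "finite \<D>'" for \<D>'
      proof -
        have nov: "nonoverlapping a b \<D>' c d"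
          unfolding nonoverlapping_def
        proof (intro conjI ballI impI)
          show "finite \<D>'" by fact
          show "a \<le> c L" "c L \<le> d L" "d L \<le> b" if "L \<in> \<D>'" for L
            using K(1-3)[of L] that \<D>' by (auto simp: less_imp_le)
          show "d K \<le> c L \<or> d L \<le> c K" if "K \<in> \<D>'" "L \<in> \<D>'" "K \<noteq> L" for K L
            using disj[of K L] that \<D>' by blast
        qed
        have "(\<Sum>K\<in>\<D>'. d K - c K) = (\<Sum>K\<in>\<D>'. measure lebesgue K)"
          using K_lmeas \<D>' by (intro sum.cong) auto
        also have "\<dots> = measure lebesgue (\<Union>\<D>')"
        proof (rule measure_negligible_finite_Union[symmetric])
          show "S \<in> lmeasurable" if "S \<in> \<D>'" for S
            using K_lmeas \<D>' that by auto
          show "pairwise (\<lambda>S T. negligible (S \<inter> T)) \<D>'"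
            unfolding pairwise_def
          proof (intro ballI impI)
            fix P R assume "P \<in> \<D>'" "R \<in> \<D>'" "P \<noteq> R"
            then have PR: "P \<in> \<D>" "R \<in> \<D>" "P \<noteq> R" using \<D>' by auto
            have "{c P..d P} \<inter> {c R..d R} \<subseteq> {d P, d R}"
              using disj[OF PR] K(1)[OF PR(1)] K(1)[OF PR(2)] by auto
            then have "P \<inter> R \<subseteq> {d P, d R}" using K(4) PR by simp
            then show "negligible (P \<inter> R)"
              by (rule negligible_subset[rotated]) (auto intro: negligible_finite)
          qed
        qed (use \<D>' in auto)
        also have "\<dots> \<le> measure lebesgue U"
        proof (rule measure_mono_fmeasurable)
          show "\<Union>\<D>' \<in> sets lebesgue"
            using K_lmeas \<D>' by (intro sets.finite_Union) auto
        qed (use KU \<D>' Ulm in auto)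
        finally have "(\<Sum>K\<in>\<D>'. d K - c K) < \<delta>" using U\<delta>' by simp
        from \<delta>[OF nov this] have less: "(\<Sum>K\<in>\<D>'. \<bar>G (d K) - G (c K)\<bar>) < \<epsilon>"
          by (simp flip: of_real_diff)
        have "measure \<mu> (\<Union>\<D>') \<le> (\<Sum>K\<in>\<D>'. measure \<mu> K)"
          using \<D>' K_\<mu> measure_UNION_le[of \<D>' "\<lambda>K. K" \<mu>] by (auto simp: subset_iff)
        also have "\<dots> = (\<Sum>K\<in>\<D>'. G (d K) - G (c K))"
          using K_\<mu> \<D>' by (intro sum.cong) auto
        also have "\<dots> \<le> (\<Sum>K\<in>\<D>'. \<bar>G (d K) - G (c K)\<bar>)" by (intro sum_mono) auto
        finally show ?thesis using less by simp
      qed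
      have fin': "measure \<mu> (\<Union>K\<in>\<D>'. K) \<le> \<epsilon>" if "\<D>' \<subseteq> \<D>" "finite \<D>'" for \<D>'
        using fin[OF that] by simp
      have "(\<Union>K\<in>\<D>. K) \<in> fmeasurable \<mu>" "measure \<mu> (\<Union>K\<in>\<D>. K) \<le> \<epsilon>"
        by (rule fmeasurable_UN_bound[OF D(1) K_\<mu>(1) fin'] measure_UN_bound[OF D(1) K_\<mu>(1) fin']; assumption)+
      then have "emeasure \<mu> (\<Union>\<D>) \<le> ennreal \<epsilon>"
        by (simp add: emeasure_eq_measure2 ennreal_leI)
      moreover have "emeasure \<mu> S \<le> emeasure \<mu> (\<Union>\<D>)"
        using D(6) fmeasurableD[OF \<open>(\<Union>K\<in>\<D>. K) \<in> fmeasurable \<mu>\<close>] by (intro emeasure_mono) simp_all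
      ultimately show ?thesis by simp
    qed
    have "emeasure \<mu> S \<le> 0"
      by (rule ennreal_le_epsilon) (use bound in simp)
    then have "emeasure \<nu> N = 0"
      using \<nu>_eq[OF Nb] by (simp add: S_def)
    then show "N \<in> null_sets \<nu>" using Nb by (auto simp: sets_\<nu>)
  qed
  then have "\<exists>h \<in> borel_measurable lborel. density lborel h = \<nu>"
    by (intro sigma_finite_measure.Radon_Nikodym sigma_finite_lborel) (simp_all add: sets_\<nu>)
  then obtain h where h[measurable]: "h \<in> borel_measurable borel" and \<nu>_h: "density lborel h = \<nu>" by auto
  have nn: "(\<integral>\<^sup>+ y. h y * indicator {a..x} y \<partial>lborel) = ennreal (G x - G a)" if x: "x \<in> {a..b}" for x
  proof -
    have "(\<integral>\<^sup>+ y. h y * indicator {a..x} y \<partial>lborel) = emeasure \<nu> {a..x}"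
      unfolding \<nu>_h[symmetric] by (subst emeasure_density) auto
    also have "\<dots> = emeasure \<mu> {a..x}"
      using x \<nu>_eq[of "{a..x}"] by (simp add: Int_absorb2)
    also have "\<dots> = ennreal (G x - G a)"
      using \<mu>_Icc[of a x] x ab cl_id[of x] cl_id[of a] by (simp add: F_def)
    finally show ?thesis .
  qed
  \<comment> \<open>The density is finite almost everywhere on \<open>{a..b}\<close> because its
    integral there is finite; at infinite values \<open>enn2real\<close> gives
    \<open>0\<close>.\<close>
  define g where "g = (\<lambda>y. enn2real (h y))"
  have g[measurable]: "g \<in> borel_measurable borel" unfolding g_def by measurable
  have "AE y in lborel. h y * indicator {a..b} y \<noteq> \<infinity>"
    using nn[of b] ab by (intro nn_integral_noteq_infinite) auto
  then have gh: "AE y in lborel. ennreal (g y * indicator {a..x} y) = h y * indicator {a..x} y" if "x \<in> {a..b}" for x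
  proof eventually_elim
    case (elim y)
    show ?case
    proof (cases "y \<in> {a..x}")
      case True
      then show ?thesis using that elim by (simp add: g_def less_top)
    qed simp
  qed
  have hi: "(g has_integral (G x - G a)) {a..x}" if x: "x \<in> {a..b}" for x
  proof -
    have "G a \<le> G x" using mono x by (auto simp: mono_on_def)
    have "(\<integral>\<^sup>+ y. ennreal (g y * indicator {a..x} y) \<partial>lborel) = ennreal (G x - G a)"
      unfolding nn[OF x, symmetric] by (intro nn_integral_cong_AE gh x)
    then have "((\<lambda>y. g y * indicator {a..x} y) has_integral (G x - G a)) UNIV"
    proof (rule nn_integral_has_integral[rotated 2])
      show "(\<lambda>y. g y * indicator {a..x} y) \<in> borel_measurable borel" by measurable
      show "0 \<le> g y * indicator {a..x} y" for y by (simp add: g_def)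
      show "0 \<le> G x - G a" using \<open>G a \<le> G x\<close> by simp
    qed
    moreover have "(\<lambda>y. g y * indicator {a..x} y) = (\<lambda>y. if y \<in> {a..x} then g y else 0)"
      by (rule ext) (simp add: indicator_def)
    ultimately show ?thesis by (simp only: has_integral_restrict_UNIV)
  qed
  show thesis
  proof
    have "g absolutely_integrable_on {a..b}"
      using hi[of b] ab by (intro nonnegative_absolutely_integrable_1) (auto simp: g_def)
    then show "integrable (lebesgue_on {a..b}) g"
      by (intro absolutely_integrable_imp_integrable) auto
    show "G x = G a + integral {a..x} g" if "x \<in> {a..b}" for x
      using integral_unique[OF hi[OF that]] by simp
  qed
qed

section \<open>Total variation of an absolutely continuous function\<close>

text \<open>Partitions are infinite monotone sequences of which a sum uses an initial segment, so clipping
  with \<open>min\<close> or \<open>max\<close> gives a partition of a subinterval without renumbering.\<close>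

definition partition_seq :: "real \<Rightarrow> real \<Rightarrow> (nat \<Rightarrow> real) \<Rightarrow> bool" where
  "partition_seq u v t \<longleftrightarrow> mono t \<and> (\<forall>i. u \<le> t i \<and> t i \<le> v)"

definition variation_sum :: "(real \<Rightarrow> complex) \<Rightarrow> (nat \<Rightarrow> real) \<Rightarrow> nat \<Rightarrow> real" where
  "variation_sum f t k = (\<Sum>i<k. cmod (f (t (Suc i)) - f (t i)))"

definition variation :: "(real \<Rightarrow> complex) \<Rightarrow> real \<Rightarrow> real \<Rightarrow> real" where
  "variation f u v = Sup {variation_sum f t k |t k. partition_seq u v t}"

text \<open>One of \<open>min x w\<close> and \<open>max x w\<close> is \<open>x\<close> and the
  other is \<open>w\<close>, so \<open>f x\<close> is the sum of the two clipped values minus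
  \<open>f w\<close>; the triangle inequality then separates each increment.\<close>

lemma variation_sum_split:
  "variation_sum f t k \<le> variation_sum f (\<lambda>i. min (t i) w) k + variation_sum f (\<lambda>i. max (t i) w) k"
proof -
  have f_split: "f x = f (min x w) + f (max x w) - f w" for x by (auto simp: min_def max_def)
  have "cmod (f (t (Suc i)) - f (t i)) \<le> cmod (f (min (t (Suc i)) w) - f (min (t i) w))
     + cmod (f (max (t (Suc i)) w) - f (max (t i) w))" for i
  proof -
    have "f (t (Suc i)) - f (t i) = (f (min (t (Suc i)) w) - f (min (t i) w)) + (f (max (t (Suc i)) w) - f (max (t i) w))"
      by (subst (1 2) f_split) simp
    then show ?thesis by (metis norm_triangle_ineq)
  qed
  then show ?thesis
    unfolding variation_sum_def sum.distrib[symmetric] by (intro sum_mono)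
qed

lemma partition_seq_min: "partition_seq u v t \<Longrightarrow> u \<le> w \<Longrightarrow> partition_seq u w (\<lambda>i. min (t i) w)"
  by (auto simp: partition_seq_def mono_def min_le_iff_disj)

lemma partition_seq_max: "partition_seq u v t \<Longrightarrow> w \<le> v \<Longrightarrow> partition_seq w v (\<lambda>i. max (t i) w)"
  unfolding partition_seq_def mono_def by (intro conjI allI impI max.mono) auto

lemma partition_seq_mono: "partition_seq u v t \<Longrightarrow> u' \<le> u \<Longrightarrow> v \<le> v' \<Longrightarrow> partition_seq u' v' t"
  unfolding partition_seq_def by (meson order_trans)

lemma partition_seq_const: "u \<le> v \<Longrightarrow> partition_seq u v (\<lambda>_. u)"
  by (auto simp: partition_seq_def mono_def)

text \<open>The increments of all the partitions together are again a nonoverlapping family, indexed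
  by pairs, and telescoping bounds its total length by that of the enclosing intervals.\<close>

lemma abs_cont_on_variation_sum:
  assumes "abs_cont_on a b f" "\<epsilon> > 0"
  obtains \<delta> where "\<delta> > 0"
    "\<And>(I::nat set) u v t k. nonoverlapping a b I u v \<Longrightarrow> (\<Sum>i\<in>I. v i - u i) < \<delta> \<Longrightarrow>
       \<forall>i\<in>I. partition_seq (u i) (v i) (t i) \<Longrightarrow> (\<Sum>i\<in>I. variation_sum f (t i) (k i)) < \<epsilon>"
proof -
  obtain \<delta> where "\<delta> > 0" and \<delta>: "\<And>(I::(nat\<times>nat) set) u v. nonoverlapping a b I u v \<Longrightarrow> (\<Sum>i\<in>I. v i - u i) < \<delta> \<Longrightarrow>
          (\<Sum>i\<in>I. cmod (f (v i) - f (u i))) < \<epsilon>"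
    by (rule abs_cont_on_nonoverlapping[OF assms]) (rule that)
  have "(\<Sum>i\<in>I. variation_sum f (t i) (k i)) < \<epsilon>"
    if fam: "nonoverlapping a b I u v" and len: "(\<Sum>i\<in>I. v i - u i) < \<delta>"
      and t: "\<forall>i\<in>I. partition_seq (u i) (v i) (t i)" for I :: "nat set" and u v t k
  proof -
    define J where "J = Sigma I (\<lambda>i. {..<k i::nat})"
    have I: "finite I" "\<And>i. i \<in> I \<Longrightarrow> a \<le> u i \<and> v i \<le> b"
        "\<And>i j. i \<in> I \<Longrightarrow> j \<in> I \<Longrightarrow> i \<noteq> j \<Longrightarrow> v i \<le> u j \<or> v j \<le> u i"
      using fam by (auto simp: nonoverlapping_def)
    have t': "u i \<le> t i j" "t i j \<le> v i" "j \<le> j' \<Longrightarrow> t i j \<le> t i j'" if "i \<in> I" for i j j'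
      using t[THEN bspec, OF that] by (auto simp: partition_seq_def mono_def)
    have nov: "nonoverlapping a b J (\<lambda>(i,j). t i j) (\<lambda>(i,j). t i (Suc j))"
      unfolding nonoverlapping_def
    proof (intro conjI ballI impI)
      show "finite J" using I by (auto simp: J_def)
      fix p assume "p \<in> J"
      then obtain i j where p: "p = (i,j)" "i \<in> I" by (auto simp: J_def)
      have "a \<le> u i" "v i \<le> b" using I(2)[OF \<open>i \<in> I\<close>] by auto
      then show "a \<le> (case p of (i,j) \<Rightarrow> t i j)" "(case p of (i,j) \<Rightarrow> t i j) \<le> (case p of (i,j) \<Rightarrow> t i (Suc j))"
         "(case p of (i,j) \<Rightarrow> t i (Suc j)) \<le> b"
        using t'(1)[OF \<open>i \<in> I\<close>, of j] t'(2)[OF \<open>i \<in> I\<close>, of "Suc j"] t'(3)[OF \<open>i \<in> I\<close>, of j "Suc j"] by (simp_all add: p)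
      fix q assume "q \<in> J" "p \<noteq> q"
      then obtain i' j' where q: "q = (i',j')" "i' \<in> I" by (auto simp: J_def)
      have "t i (Suc j) \<le> t i' j' \<or> t i' (Suc j') \<le> t i j"
      proof (cases "i = i'")
        case True
        then have "Suc j \<le> j' \<or> Suc j' \<le> j" using p q \<open>p \<noteq> q\<close> by auto
        then show ?thesis using t'(3)[OF \<open>i \<in> I\<close>] True by blast
      next
        case False
        then show ?thesis
          using I(3)[OF \<open>i \<in> I\<close> \<open>i' \<in> I\<close>] t'(1)[OF \<open>i \<in> I\<close>, of j] t'(2)[OF \<open>i \<in> I\<close>, of "Suc j"]
            t'(1)[OF \<open>i' \<in> I\<close>, of j'] t'(2)[OF \<open>i' \<in> I\<close>, of "Suc j'"] by linarith
      qed
      then show "(case p of (i,j) \<Rightarrow> t i (Suc j)) \<le> (case q of (i,j) \<Rightarrow> t i j)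
          \<or> (case q of (i,j) \<Rightarrow> t i (Suc j)) \<le> (case p of (i,j) \<Rightarrow> t i j)"
        by (simp add: p q)
    qed
    have "(\<Sum>p\<in>J. (case p of (i,j) \<Rightarrow> t i (Suc j)) - (case p of (i,j) \<Rightarrow> t i j)) = (\<Sum>i\<in>I. \<Sum>j<k i. t i (Suc j) - t i j)"
      unfolding J_def using I by (subst sum.Sigma) (auto intro: sum.cong)
    also have "\<dots> = (\<Sum>i\<in>I. t i (k i) - t i 0)"
      by (simp add: sum_lessThan_telescope)
    also have "\<dots> \<le> (\<Sum>i\<in>I. v i - u i)"
      using t'(1,2) by (intro sum_mono diff_mono)
    finally have "(\<Sum>p\<in>J. (case p of (i,j) \<Rightarrow> t i (Suc j)) - (case p of (i,j) \<Rightarrow> t i j)) < \<delta>" using len by simp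
    from \<delta>[OF nov this]
    have "(\<Sum>p\<in>J. cmod (f (case p of (i,j) \<Rightarrow> t i (Suc j)) - f (case p of (i,j) \<Rightarrow> t i j))) < \<epsilon>" .
    also have "(\<Sum>p\<in>J. cmod (f (case p of (i,j) \<Rightarrow> t i (Suc j)) - f (case p of (i,j) \<Rightarrow> t i j))) = (\<Sum>i\<in>I. variation_sum f (t i) (k i))"
      unfolding J_def variation_sum_def using I by (subst sum.Sigma) (auto intro: sum.cong)
    finally show ?thesis .
  qed
  with \<open>\<delta> > 0\<close> show ?thesis using that by blast
qed

text \<open>On an interval shorter than the \<delta> that belongs to \<open>1\<close>, every
  partition sum is at most \<open>1\<close>; finitely many such intervals cover the whole one, and
  clipping cuts a partition at their ends.\<close>

lemma abs_cont_on_bounded_variation: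
  assumes ac: "abs_cont_on a b f"
  obtains B where "\<And>t k. partition_seq a b t \<Longrightarrow> variation_sum f t k \<le> B"
proof -
  obtain \<delta> where "\<delta> > 0" and
    \<delta>: "\<And>(I::nat set) u v t k. nonoverlapping a b I u v \<Longrightarrow> (\<Sum>i\<in>I. v i - u i) < \<delta> \<Longrightarrow>
       \<forall>i\<in>I. partition_seq (u i) (v i) (t i) \<Longrightarrow> (\<Sum>i\<in>I. variation_sum f (t i) (k i)) < 1"
    by (rule abs_cont_on_variation_sum[OF ac, of 1]) (simp, rule that)
  have small: "variation_sum f t k \<le> 1" if "a \<le> u" "u \<le> v" "v \<le> b" "v - u < \<delta>" "partition_seq u v t" for u v t k
    using \<delta>[of "{0}" "\<lambda>_. u" "\<lambda>_. v" "\<lambda>_. t" "\<lambda>_. k"] that by (simp add: nonoverlapping_def)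
  have bound: "variation_sum f t k \<le> real n" if "a \<le> v" "v \<le> b" "v \<le> a + real n * (\<delta>/2)" "partition_seq a v t" for n v t k
    using that
  proof (induction n arbitrary: v t k)
    case 0
    then have "v = a" by simp
    with 0 have "t i = a" for i by (auto simp: partition_seq_def intro: antisym)
    then show ?case by (simp add: variation_sum_def)
  next
    case (Suc n)
    \<comment> \<open>The piece split off has length at most \<open>\<delta>/2\<close>, strictly
      below the threshold \<delta>; the maximum keeps \<open>w\<close> from falling below
      \<open>a\<close>.\<close>
    define w where "w = max a (v - \<delta>/2)"
    have "v \<le> a + (real n * (\<delta>/2) + \<delta>/2)"
      using Suc.prems(3) by (simp add: algebra_simps add_divide_distrib)
    moreover have "0 \<le> real n * (\<delta>/2)" using \<open>\<delta> > 0\<close> by simp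
    ultimately have w: "a \<le> w" "w \<le> v" "w \<le> b" "w \<le> a + real n * (\<delta>/2)" "v - w < \<delta>"
      using Suc.prems \<open>\<delta> > 0\<close> by (auto simp: w_def)
    have "variation_sum f t k \<le> variation_sum f (\<lambda>i. min (t i) w) k + variation_sum f (\<lambda>i. max (t i) w) k"
      by (rule variation_sum_split)
    also have "\<dots> \<le> real n + 1"
      using w Suc.prems by (intro add_mono Suc.IH[of w] small[of w v] partition_seq_min[of a v] partition_seq_max[of a v])
    finally show ?case by simp
  qed
  show thesis
  proof (cases "a \<le> b")
    case True
    obtain n :: nat where "(b - a) / (\<delta>/2) \<le> real n" using real_arch_simple by blast
    then have "b \<le> a + real n * (\<delta>/2)" using \<open>\<delta> > 0\<close> by (simp add: field_simps)
    then show thesis using that[of "real n"] bound[of b n] True by blast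
  next
    \<comment> \<open>For \<open>b < a\<close> the values of a partition sequence would lie in an
      empty interval, so every bound holds.\<close>
    case False
    then have "\<not> partition_seq a b t" for t
      unfolding partition_seq_def by (meson order_trans)
    then show thesis using that by blast
  qed
qed

context
  fixes a b :: real and f :: "real \<Rightarrow> complex"
  assumes ac: "abs_cont_on a b f"
begin

lemma bdd_above_variation:
  assumes "a \<le> u" "v \<le> b"
  shows "bdd_above {variation_sum f t k |t k. partition_seq u v t}"
proof -
  obtain B where B: "\<And>t k. partition_seq a b t \<Longrightarrow> variation_sum f t k \<le> B"
    by (rule abs_cont_on_bounded_variation[OF ac]) (rule that)
  show ?thesis
    unfolding bdd_above_def using B partition_seq_mono[OF _ assms] by blast
qed

lemma variation_upper: "a \<le> u \<Longrightarrow> v \<le> b \<Longrightarrow> partition_seq u v t \<Longrightarrow> variation_sum f t k \<le> variation f u v"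
  unfolding variation_def by (intro cSup_upper bdd_above_variation) auto

lemma variation_least:
  assumes "u \<le> v" "\<And>t k. partition_seq u v t \<Longrightarrow> variation_sum f t k \<le> B"
  shows "variation f u v \<le> B"
  unfolding variation_def using assms partition_seq_const[of u v] by (intro cSup_least) auto

lemma variation_increase:
  assumes "a \<le> u" "u \<le> v" "v \<le> b"
  shows "variation f a u + cmod (f v - f u) \<le> variation f a v"
proof -
  have "variation f a u \<le> variation f a v - cmod (f v - f u)"
  proof (rule variation_least)
    fix t k assume t: "partition_seq a u t"
    \<comment> \<open>The partition is continued by \<open>u\<close> and then stays at
      \<open>v\<close>. Of the two new increments only the one from \<open>u\<close> to
      \<open>v\<close> is kept; the other is nonnegative.\<close>
    define t' where "t' = (\<lambda>i. if i \<le> k then t i else if i = Suc k then u else v)"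
    have mt: "\<And>i j. i \<le> j \<Longrightarrow> t i \<le> t j" "\<And>i. a \<le> t i" "\<And>i. t i \<le> u"
      using t by (auto simp: partition_seq_def mono_def)
    have "partition_seq a v t'"
      unfolding partition_seq_def mono_def t'_def using mt assms
      by (auto intro: order_trans[OF mt(3) assms(2)])
    then have "variation_sum f t' (Suc (Suc k)) \<le> variation f a v"
      using assms by (intro variation_upper) auto
    moreover have "variation_sum f t k = (\<Sum>i<k. cmod (f (t' (Suc i)) - f (t' i)))"
      unfolding variation_sum_def by (intro sum.cong) (auto simp: t'_def)
    ultimately have "variation_sum f t k + cmod (f u - f (t k)) + cmod (f v - f u) \<le> variation f a v"
      by (simp add: variation_sum_def t'_def)
    moreover have "0 \<le> cmod (f u - f (t k))" by simp
    ultimately show "variation_sum f t k \<le> variation f a v - cmod (f v - f u)" by linarith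
  qed fact
  then show ?thesis by simp
qed

lemma variation_subadditive:
  assumes "a \<le> u" "u \<le> v" "v \<le> b"
  shows "variation f a v \<le> variation f a u + variation f u v"
proof (rule variation_least)
  fix t k assume t: "partition_seq a v t"
  have "variation_sum f t k \<le> variation_sum f (\<lambda>i. min (t i) u) k + variation_sum f (\<lambda>i. max (t i) u) k"
    by (rule variation_sum_split)
  also have "\<dots> \<le> variation f a u + variation f u v"
    using assms t by (intro add_mono variation_upper partition_seq_min[of a v] partition_seq_max[of a v]) auto
  finally show "variation_sum f t k \<le> variation f a u + variation f u v" .
qed (use assms in simp)

text \<open>Partitions that nearly attain the variation on each interval replace its increments by
  partition sums, which \<open>abs_cont_on_variation_sum\<close> makes uniformly small.\<close>

lemma abs_cont_on_variation: "abs_cont_on a b (\<lambda>x. complex_of_real (variation f a x))"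
proof (rule abs_cont_onI)
  fix \<epsilon> :: real assume "\<epsilon> > 0"
  then have "\<epsilon>/2 > 0" by simp
  obtain \<delta> where "\<delta> > 0" and
    \<delta>: "\<And>(I::nat set) u v t k. nonoverlapping a b I u v \<Longrightarrow> (\<Sum>i\<in>I. v i - u i) < \<delta> \<Longrightarrow>
       \<forall>i\<in>I. partition_seq (u i) (v i) (t i) \<Longrightarrow> (\<Sum>i\<in>I. variation_sum f (t i) (k i)) < \<epsilon>/2"
    by (rule abs_cont_on_variation_sum[OF ac \<open>\<epsilon>/2 > 0\<close>]) (rule that)
  have "(\<Sum>i\<in>I. cmod (complex_of_real (variation f a (v i)) - complex_of_real (variation f a (u i)))) < \<epsilon>"
    if fam: "nonoverlapping a b I u v" and len: "(\<Sum>i\<in>I. v i - u i) < \<delta>" for I :: "nat set" and u v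
  proof -
    have I: "finite I" "\<And>i. i \<in> I \<Longrightarrow> a \<le> u i \<and> u i \<le> v i \<and> v i \<le> b"
      using fam by (auto simp: nonoverlapping_def)
    \<comment> \<open>A slack of \<eta> for each of the \<open>card I\<close> intervals adds up to
      at most a quarter of \<epsilon>; the \<open>+ 1\<close> covers the empty family.\<close>
    define \<eta> where "\<eta> = \<epsilon> / (4 * (real (card I) + 1))"
    have "\<eta> > 0" using \<open>\<epsilon> > 0\<close> by (simp add: \<eta>_def)
    have "\<exists>t k. partition_seq (u i) (v i) t \<and> variation f (u i) (v i) < variation_sum f t k + \<eta>" if "i \<in> I" for i
    proof (rule ccontr)
      assume "\<not> ?thesis"
      then have "variation f (u i) (v i) \<le> variation f (u i) (v i) - \<eta>"
        using I(2)[OF that] by (intro variation_least) (auto simp: not_less algebra_simps)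
      then show False using \<open>\<eta> > 0\<close> by simp
    qed
    then obtain t k where t: "\<And>i. i \<in> I \<Longrightarrow> partition_seq (u i) (v i) (t i)"
      and vt: "\<And>i. i \<in> I \<Longrightarrow> variation f (u i) (v i) < variation_sum f (t i) (k i) + \<eta>"
      by metis
    have "(\<Sum>i\<in>I. cmod (complex_of_real (variation f a (v i)) - complex_of_real (variation f a (u i))))
        \<le> (\<Sum>i\<in>I. variation_sum f (t i) (k i) + \<eta>)"
    proof (rule sum_mono)
      fix i assume i: "i \<in> I"
      have "variation f a (v i) \<le> variation f a (u i) + variation f (u i) (v i)"
        using I(2)[OF i] by (intro variation_subadditive) auto
      moreover have "variation f a (u i) \<le> variation f a (v i)"
        using variation_increase[of "u i" "v i"] I(2)[OF i] norm_ge_zero[of "f (v i) - f (u i)"] by linarith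
      ultimately show "cmod (complex_of_real (variation f a (v i)) - complex_of_real (variation f a (u i)))
          \<le> variation_sum f (t i) (k i) + \<eta>"
        using vt[OF i] by (simp flip: of_real_diff)
    qed
    also have "\<dots> = (\<Sum>i\<in>I. variation_sum f (t i) (k i)) + real (card I) * \<eta>"
      by (simp add: sum.distrib)
    also have "\<dots> < \<epsilon>/2 + \<epsilon>/2"
    proof (rule add_less_le_mono)
      show "(\<Sum>i\<in>I. variation_sum f (t i) (k i)) < \<epsilon>/2" using t by (intro \<delta>[OF fam len]) blast
      have "real (card I) * \<eta> = \<epsilon>/4 * (real (card I) / (real (card I) + 1))" by (simp add: \<eta>_def)
      also have "\<dots> \<le> \<epsilon>/4 * 1" using \<open>\<epsilon> > 0\<close> by (intro mult_left_mono) auto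
      finally show "real (card I) * \<eta> \<le> \<epsilon>/2" using \<open>\<epsilon> > 0\<close> by simp
    qed
    finally show ?thesis by simp
  qed
  with \<open>\<delta> > 0\<close> show "\<exists>\<delta>>0. \<forall>(I::nat set) u v. nonoverlapping a b I u v \<longrightarrow> (\<Sum>i\<in>I. v i - u i) < \<delta>
             \<longrightarrow> (\<Sum>i\<in>I. cmod (complex_of_real (variation f a (v i)) - complex_of_real (variation f a (u i)))) < \<epsilon>"
    by blast
qed

end

section \<open>Densities of real and complex absolutely continuous functions\<close>

text \<open>Jordan decomposition with the variation \<open>?V\<close> of \<open>f\<close>: both
  \<open>?V\<close> and \<open>?V - h\<close> are monotone and absolutely continuous, and their
  densities are subtracted. Domination by \<open>f\<close> lets the real and the imaginary part
  share one variation.\<close>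

lemma abs_cont_on_real_density:
  assumes ab: "a < b" and ac: "abs_cont_on a b f" and ach: "abs_cont_on a b (\<lambda>x. complex_of_real (h x))"
    and le: "\<And>x y. a \<le> x \<Longrightarrow> x \<le> y \<Longrightarrow> y \<le> b \<Longrightarrow> \<bar>h y - h x\<bar> \<le> cmod (f y - f x)"
  obtains g :: "real \<Rightarrow> real" where "integrable (lebesgue_on {a..b}) g" "\<And>x. x \<in> {a..b} \<Longrightarrow> h x = h a + integral {a..x} g"
proof -
  let ?V = "variation f a"
  have acV: "abs_cont_on a b (\<lambda>x. complex_of_real (?V x))" by (rule abs_cont_on_variation[OF ac])
  have V: "\<bar>h y - h x\<bar> \<le> ?V y - ?V x" if "a \<le> x" "x \<le> y" "y \<le> b" for x y
    using variation_increase[OF ac that] le[OF that] by simp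
  have "mono_on {a..b} ?V"
    using V by (force simp: mono_on_def)
  then obtain g1 where g1: "integrable (lebesgue_on {a..b}) g1" "\<And>x. x \<in> {a..b} \<Longrightarrow> ?V x = ?V a + integral {a..x} g1"
    by (rule mono_abs_cont_imp_density[OF ab _ acV]) (rule that)
  have "mono_on {a..b} (\<lambda>x. ?V x - h x)"
    using V by (force simp: mono_on_def)
  moreover have "abs_cont_on a b (\<lambda>x. complex_of_real (?V x - h x))"
    using abs_cont_on_add[OF acV abs_cont_on_cmult[OF ach, of "-1"]] by simp
  ultimately obtain g2 where g2: "integrable (lebesgue_on {a..b}) g2"
      "\<And>x. x \<in> {a..b} \<Longrightarrow> ?V x - h x = ?V a - h a + integral {a..x} g2"
    by (rule mono_abs_cont_imp_density[OF ab]) (rule that)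
  show thesis
  proof
    show "integrable (lebesgue_on {a..b}) (\<lambda>x. g1 x - g2 x)" using g1(1) g2(1) by simp
    fix x assume x: "x \<in> {a..b}"
    have "{a..x} \<subseteq> {a..b}" using x by auto
    then have "g1 integrable_on {a..x}" "g2 integrable_on {a..x}"
      using integrable_on_lebesgue_on[OF integrable_subinterval[OF g1(1)], of a x]
        integrable_on_lebesgue_on[OF integrable_subinterval[OF g2(1)], of a x] by auto
    then show "h x = h a + integral {a..x} (\<lambda>x. g1 x - g2 x)"
      using g1(2)[OF x] g2(2)[OF x] by (simp add: Henstock_Kurzweil_Integration.integral_diff)
  qed
qed

lemma abs_cont_on_imp_integral:
  assumes ab: "a < b" and ac: "abs_cont_on a b f"
  obtains g where "integrable (lebesgue_on {a..b}) g" "\<And>x. x \<in> {a..b} \<Longrightarrow> f x = f a + integral {a..x} g"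
proof -
  have "abs_cont_on a b (\<lambda>x. complex_of_real (Re (f x)))"
    by (rule abs_cont_on_cong[OF abs_cont_on_cmult[OF abs_cont_on_add[OF ac abs_cont_on_cnj[OF ac]], of "1/2"]])
       (simp add: complex_eq_iff)
  moreover have "\<bar>Re (f y) - Re (f x)\<bar> \<le> cmod (f y - f x)" for x y
    using abs_Re_le_cmod[of "f y - f x"] by simp
  ultimately obtain gr where gr: "integrable (lebesgue_on {a..b}) gr" "\<And>x. x \<in> {a..b} \<Longrightarrow> Re (f x) = Re (f a) + integral {a..x} gr"
    by (rule abs_cont_on_real_density[OF ab ac]) (rule that)
  have "abs_cont_on a b (\<lambda>x. complex_of_real (Im (f x)))"
    by (rule abs_cont_on_cong[OF abs_cont_on_cmult[OF abs_cont_on_add[OF ac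
          abs_cont_on_cmult[OF abs_cont_on_cnj[OF ac], of "-1"]], of "-\<i>/2"]])
       (simp add: complex_eq_iff)
  moreover have "\<bar>Im (f y) - Im (f x)\<bar> \<le> cmod (f y - f x)" for x y
    using abs_Im_le_cmod[of "f y - f x"] by simp
  ultimately obtain gi where gi: "integrable (lebesgue_on {a..b}) gi" "\<And>x. x \<in> {a..b} \<Longrightarrow> Im (f x) = Im (f a) + integral {a..x} gi"
    by (rule abs_cont_on_real_density[OF ab ac]) (rule that)
  show thesis
  proof
    show "integrable (lebesgue_on {a..b}) (\<lambda>x. complex_of_real (gr x) + \<i> * complex_of_real (gi x))"
      using gr(1) gi(1) by simp
    fix x assume x: "x \<in> {a..b}"
    have "{a..x} \<subseteq> {a..b}" using x by auto
    then have io: "gr integrable_on {a..x}" "gi integrable_on {a..x}"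
      using integrable_on_lebesgue_on[OF integrable_subinterval[OF gr(1)], of a x]
        integrable_on_lebesgue_on[OF integrable_subinterval[OF gi(1)], of a x] by auto
    have "((\<lambda>x. complex_of_real (gr x) + \<i> * complex_of_real (gi x)) has_integral
        complex_of_real (integral {a..x} gr) + \<i> * complex_of_real (integral {a..x} gi)) {a..x}"
      using io by (intro has_integral_add has_integral_mult_right has_integral_of_real integrable_integral)
    from integral_unique[OF this] show "f x = f a + integral {a..x} (\<lambda>x. complex_of_real (gr x) + \<i> * complex_of_real (gi x))"
      using gr(2)[OF x] gi(2)[OF x] by (simp add: complex_eq_iff)
  qed
qed

section \<open>Almost everywhere equality, the fundamental theorem of calculus, integration by
  parts\<close>

lemma AE_lebesgue_on_Icc_iff: "(AE x in lebesgue_on {a..b::real}. P x) \<longleftrightarrow> negligible {x \<in> {a..b}. \<not> P x}"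
proof -
  have "(AE x in lebesgue_on {a..b}. P x) \<longleftrightarrow> (AE x in lebesgue. x \<in> {a..b} \<longrightarrow> P x)"
    by (intro AE_restrict_space_iff) simp
  also have "\<dots> \<longleftrightarrow> {x \<in> {a..b}. \<not> P x} \<in> null_sets lebesgue"
    by (simp add: completion.AE_iff_null_sets Collect_conj_eq)
  finally show ?thesis by (simp add: negligible_iff_null_sets)
qed

lemma borel_measurable_AE_cong:
  fixes f g :: "real \<Rightarrow> complex"
  assumes f: "f \<in> borel_measurable (lebesgue_on {a..b})" and "AE x in lebesgue_on {a..b}. f x = g x"
  shows "g \<in> borel_measurable (lebesgue_on {a..b})"
proof -
  let ?f = "\<lambda>x. indicator {a..b} x *\<^sub>R f x" and ?g = "\<lambda>x. indicator {a..b} x *\<^sub>R g x"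
  have "?f \<in> borel_measurable lebesgue"
    using f by (simp add: borel_measurable_restrict_space_iff)
  moreover have "AE x in lebesgue. ?f x = ?g x"
  proof -
    have "AE x in lebesgue. x \<in> {a..b} \<longrightarrow> f x = g x"
      using assms(2) by (simp add: AE_restrict_space_iff)
    then show ?thesis by eventually_elim (auto simp: indicator_def)
  qed
  ultimately have "?g \<in> borel_measurable lebesgue" by (rule borel_measurable_AE)
  then show ?thesis by (simp add: borel_measurable_restrict_space_iff)
qed

lemma integrable_AE_cong:
  fixes f g :: "real \<Rightarrow> complex"
  assumes "integrable (lebesgue_on {a..b}) f" and "AE x in lebesgue_on {a..b}. f x = g x"
  shows "integrable (lebesgue_on {a..b}) g"
  using assms borel_measurable_AE_cong[of f a b g]
  by (intro integrable_cong_AE_imp[OF assms(1)]) (auto intro: borel_measurable_integrable elim: eventually_mono)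

lemma integral_AE_cong:
  fixes f g :: "real \<Rightarrow> complex"
  assumes "AE x in lebesgue_on {a..b}. f x = g x" "{c..d} \<subseteq> {a..b}"
  shows "integral {c..d} f = integral {c..d} g"
  by (rule integral_spike[OF assms(1)[unfolded AE_lebesgue_on_Icc_iff]]) (use assms(2) in auto)

text \<open>The set of coincidence is closed, and a closed set of full measure in an open interval
  contains it; the endpoints follow by taking the closure.\<close>

lemma continuous_AE_eq_imp_eq:
  fixes f g :: "real \<Rightarrow> complex"
  assumes ab: "a < b" and f: "continuous_on {a..b} f" and g: "continuous_on {a..b} g"
    and ae: "AE x in lebesgue_on {a..b}. f x = g x" and x: "x \<in> {a..b}"
  shows "f x = g x"
proof -
  let ?C = "{x \<in> {a..b}. f x = g x}"
  have "closed ?C"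
    using continuous_closed_preimage[OF continuous_on_diff[OF f g] closed_atLeastAtMost closed_singleton[of 0]]
    by (simp add: vimage_def Int_def)
  have "y \<in> ?C" if "y \<in> {a<..<b}" for y
  proof (rule mem_closed_if_AE_lebesgue_open[OF _ \<open>closed ?C\<close> _ that])
    have "AE x in lebesgue. x \<in> {a..b} \<longrightarrow> f x = g x"
      using ae by (simp add: AE_restrict_space_iff)
    then show "AE x\<in>{a<..<b} in lebesgue. x \<in> ?C" by eventually_elim auto
  qed simp
  then have "closure {a<..<b} \<subseteq> ?C"
    using \<open>closed ?C\<close> by (intro closure_minimal) blast+
  then show ?thesis using x ab by auto
qed

lemma integrable_mult_continuous:
  fixes f g :: "real \<Rightarrow> complex"
  assumes f: "integrable (lebesgue_on {a..b}) f" and g: "continuous_on {a..b} g"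
  shows "integrable (lebesgue_on {a..b}) (\<lambda>x. f x * g x)"
proof -
  have "bounded (g ` {a..b})"
    using g by (intro compact_imp_bounded compact_continuous_image) auto
  then obtain B where "\<forall>z\<in>g ` {a..b}. cmod z \<le> B" unfolding bounded_iff by (elim exE)
  then have B: "cmod (g x) \<le> B" if "x \<in> {a..b}" for x using that by simp
  have [measurable]: "g \<in> borel_measurable (lebesgue_on {a..b})"
    using g by (intro continuous_imp_measurable_on_sets_lebesgue) auto
  have [measurable]: "f \<in> borel_measurable (lebesgue_on {a..b})"
    using f by (rule borel_measurable_integrable)
  show ?thesis
  proof (rule Bochner_Integration.integrable_bound[of _ "\<lambda>x. B * cmod (f x)"])
    show "integrable (lebesgue_on {a..b}) (\<lambda>x. B * cmod (f x))"
      using f by (intro integrable_mult_right integrable_norm)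
    show "AE x in lebesgue_on {a..b}. norm (f x * g x) \<le> norm (B * cmod (f x))"
    proof (rule AE_I2)
      fix x assume "x \<in> space (lebesgue_on {a..b})"
      then have "cmod (g x) \<le> B" using B by simp
      then have "cmod (g x) * cmod (f x) \<le> \<bar>B\<bar> * cmod (f x)" by (intro mult_right_mono) auto
      then show "norm (f x * g x) \<le> norm (B * cmod (f x))"
        by (simp add: norm_mult abs_mult mult.commute)
    qed
  qed measurable
qed

lemma dw_eqI:
  assumes "a < b" "x \<in> {a..b}" "(f has_vector_derivative f') (at x within {a..b})"
  shows "dw a b f x = f'"
  unfolding dw_def using vector_derivative_within_closed_interval[OF assms] .

lemma has_vector_derivative_cong_on:
  assumes "(f has_vector_derivative D) (at x within S)" "x \<in> S" "\<And>y. y \<in> S \<Longrightarrow> f y = g y"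
  shows "(g has_vector_derivative D) (at x within S)"
  using assms has_vector_derivative_transform[of x S g f D] by simp

lemma dw_cong:
  assumes "x \<in> {a..b}" "\<And>y. y \<in> {a..b} \<Longrightarrow> f y = g y"
  shows "dw a b f x = dw a b g x"
proof -
  have "(f has_vector_derivative D) (at x within {a..b}) \<longleftrightarrow> (g has_vector_derivative D) (at x within {a..b})" for D
    using has_vector_derivative_cong_on[of f D x "{a..b}" g] has_vector_derivative_cong_on[of g D x "{a..b}" f] assms by auto
  then show ?thesis by (simp add: dw_def vector_derivative_def)
qed

lemma indefinite_integral_derivative:
  fixes g :: "real \<Rightarrow> complex"
  assumes ab: "a < b" and g: "integrable (lebesgue_on {a..b}) g"
    and F: "\<And>x. x \<in> {a..b} \<Longrightarrow> F x = c + integral {a..x} g"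
  shows "abs_cont_on a b F"
    and "AE x in lebesgue_on {a..b}. (F has_vector_derivative g x) (at x within {a..b})"
    and "AE x in lebesgue_on {a..b}. dw a b F x = g x"
proof -
  have "abs_cont_on a b (\<lambda>x. c + integral {a..x} g)"
    by (intro abs_cont_on_add abs_cont_on_const abs_cont_on_integral g)
  then show "abs_cont_on a b F" by (rule abs_cont_on_cong) (simp add: F)
  have "AE x in lebesgue_on {a..b}. ((\<lambda>u. integral {a..u} g) has_vector_derivative g x) (at x within {a..b})"
    unfolding AE_lebesgue_on_Icc_iff
    using g by (intro indefinite_integral_has_vector_derivative_AE integrable_on_lebesgue_on) auto
  then show deriv: "AE x in lebesgue_on {a..b}. (F has_vector_derivative g x) (at x within {a..b})"
  proof (rule AE_mp[OF _ AE_I2], intro impI)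
    fix x assume x: "x \<in> space (lebesgue_on {a..b})"
      and "((\<lambda>u. integral {a..u} g) has_vector_derivative g x) (at x within {a..b})"
    then have "((\<lambda>u. c + integral {a..u} g) has_vector_derivative 0 + g x) (at x within {a..b})"
      by (intro has_vector_derivative_add has_vector_derivative_const)
    then have "((\<lambda>u. c + integral {a..u} g) has_vector_derivative g x) (at x within {a..b})" by simp
    then show "(F has_vector_derivative g x) (at x within {a..b})"
      by (rule has_vector_derivative_cong_on) (use x F in auto)
  qed
  then show "AE x in lebesgue_on {a..b}. dw a b F x = g x"
    by (rule AE_mp[OF _ AE_I2]) (use dw_eqI[OF ab] in auto)
qed

text \<open>The Radon-Nikodym density is at first only some integrable function; differentiating its
  indefinite integral shows that it equals \<open>dw a b f\<close> almost everywhere.\<close>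

lemma abs_cont_on_FTC:
  assumes ab: "a < b" and f: "abs_cont_on a b f"
  shows "AE x in lebesgue_on {a..b}. (f has_vector_derivative dw a b f x) (at x within {a..b})"
    and "integrable (lebesgue_on {a..b}) (dw a b f)"
    and "x \<in> {a..b} \<Longrightarrow> f x = f a + integral {a..x} (dw a b f)"
proof -
  obtain g where g: "integrable (lebesgue_on {a..b}) g" and fg: "\<And>x. x \<in> {a..b} \<Longrightarrow> f x = f a + integral {a..x} g"
    by (rule abs_cont_on_imp_integral[OF ab f]) (rule that)
  have d: "AE x in lebesgue_on {a..b}. (f has_vector_derivative g x) (at x within {a..b})"
    "AE x in lebesgue_on {a..b}. dw a b f x = g x"
    by (rule indefinite_integral_derivative[OF ab g], rule fg, assumption)+
  show "AE x in lebesgue_on {a..b}. (f has_vector_derivative dw a b f x) (at x within {a..b})"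
    using d by eventually_elim simp
  have ae: "AE x in lebesgue_on {a..b}. g x = dw a b f x" using d(2) by eventually_elim simp
  show "integrable (lebesgue_on {a..b}) (dw a b f)"
    by (rule integrable_AE_cong[OF g ae])
  show "f x = f a + integral {a..x} (dw a b f)" if x: "x \<in> {a..b}"
  proof -
    have "integral {a..x} g = integral {a..x} (dw a b f)"
      using x by (intro integral_AE_cong[OF ae]) auto
    then show ?thesis using fg[OF x] by simp
  qed
qed

text \<open>The derivatives enter as arbitrary almost everywhere versions \<open>f'\<close> and
  \<open>g'\<close>, so that the right-hand sides of a differential system can be inserted
  directly.\<close>

lemma abs_cont_on_product_integral:
  assumes ab: "a < b" and f: "abs_cont_on a b f" and g: "abs_cont_on a b g"
    and f': "AE x in lebesgue_on {a..b}. dw a b f x = f' x" and g': "AE x in lebesgue_on {a..b}. dw a b g x = g' x"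
  shows "integrable (lebesgue_on {a..b}) (\<lambda>x. f' x * g x + f x * g' x)"
    and "(LINT x|lebesgue_on {a..b}. f' x * g x + f x * g' x) = f b * g b - f a * g a"
    and "AE x in lebesgue_on {a..b}. dw a b (\<lambda>x. f x * g x) x = f' x * g x + f x * g' x"
proof -
  let ?h = "\<lambda>x. f x * g x"
  have h: "abs_cont_on a b ?h" by (rule abs_cont_on_mult[OF f g])
  have "AE x in lebesgue_on {a..b}. x \<in> {a..b}" by (rule AE_I2) simp
  with abs_cont_on_FTC(1)[OF ab f] abs_cont_on_FTC(1)[OF ab g] f' g'
  show ae: "AE x in lebesgue_on {a..b}. dw a b ?h x = f' x * g x + f x * g' x"
  proof eventually_elim
    case (elim x)
    have "(?h has_vector_derivative f x * dw a b g x + dw a b f x * g x) (at x within {a..b})"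
      using elim by (intro has_vector_derivative_mult)
    then have "dw a b ?h x = f x * dw a b g x + dw a b f x * g x"
      using elim by (intro dw_eqI[OF ab])
    then show ?case using elim by simp
  qed
  show int: "integrable (lebesgue_on {a..b}) (\<lambda>x. f' x * g x + f x * g' x)"
    by (rule integrable_AE_cong[OF abs_cont_on_FTC(2)[OF ab h] ae])
  have "(LINT x|lebesgue_on {a..b}. f' x * g x + f x * g' x) = integral {a..b} (\<lambda>x. f' x * g x + f x * g' x)"
    using int by (intro lebesgue_integral_eq_integral) auto
  also have "\<dots> = integral {a..b} (dw a b ?h)"
    by (rule integral_AE_cong[OF ae, symmetric]) simp
  also have "\<dots> = ?h b - ?h a"
    using abs_cont_on_FTC(3)[OF ab h, of b] ab by simp
  finally show "(LINT x|lebesgue_on {a..b}. f' x * g x + f x * g' x) = f b * g b - f a * g a" .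
qed

section \<open>Linear systems with integrable coefficients\<close>

lemma integrable_on_Icc_left:
  fixes f :: "real \<Rightarrow> 'a::euclidean_space"
  assumes "integrable (lebesgue_on {a..b}) f" "x \<in> {a..b}"
  shows "f integrable_on {a..x}" "integrable (lebesgue_on {a..x}) f"
proof -
  show "integrable (lebesgue_on {a..x}) f"
    using assms(2) by (intro integrable_subinterval[OF assms(1)]) auto
  then show "f integrable_on {a..x}"
    by (rule integrable_on_lebesgue_on) simp
qed

lemma integrable_mult_continuous_real:
  fixes f g :: "real \<Rightarrow> real"
  assumes "integrable (lebesgue_on {a..b}) f" "continuous_on {a..b} g"
  shows "integrable (lebesgue_on {a..b}) (\<lambda>x. f x * g x)"
proof -
  have "integrable (lebesgue_on {a..b}) (\<lambda>x. complex_of_real (f x) * complex_of_real (g x))"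
    using assms by (intro integrable_mult_continuous continuous_on_of_real) auto
  then have "integrable (lebesgue_on {a..b}) (\<lambda>x. complex_of_real (f x * g x))" by simp
  then show ?thesis by (simp only: complex_of_real_integrable_eq)
qed

text \<open>The induction step of the Picard estimate integrates \<open>q * p ^ n\<close>. As
  \<open>q\<close> is the derivative of \<open>p\<close> only almost everywhere, the power rule is
  built from the product rule for absolutely continuous functions.\<close>

lemma integral_power_primitive:
  fixes q :: "real \<Rightarrow> real"
  assumes ab: "a < b" and q: "integrable (lebesgue_on {a..b}) q" and x: "x \<in> {a..b}"
  defines "p \<equiv> \<lambda>x. integral {a..x} q"
  shows "((\<lambda>t. q t * p t ^ n) has_integral p x ^ Suc n / real (Suc n)) {a..x}"
proof -
  define P where "P = (\<lambda>x. complex_of_real (p x))"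
  have Q: "integrable (lebesgue_on {a..b}) (\<lambda>x. complex_of_real (q x))" using q by simp
  have P_eq: "P u = 0 + integral {a..u} (\<lambda>x. complex_of_real (q x))" if "u \<in> {a..b}" for u
  proof -
    have "((\<lambda>x. complex_of_real (q x)) has_integral complex_of_real (integral {a..u} q)) {a..u}"
      using integrable_on_Icc_left(1)[OF q that] by (intro has_integral_of_real integrable_integral)
    then show ?thesis by (simp add: P_def p_def integral_unique)
  qed
  have acP: "abs_cont_on a b P" by (rule indefinite_integral_derivative[OF ab Q]) (rule P_eq)
  have dP: "AE x in lebesgue_on {a..b}. dw a b P x = complex_of_real (q x)"
    by (rule indefinite_integral_derivative[OF ab Q]) (rule P_eq)
  have pow: "abs_cont_on a b (\<lambda>x. P x ^ Suc n) \<and>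
      (AE x in lebesgue_on {a..b}. dw a b (\<lambda>x. P x ^ Suc n) x = of_nat (Suc n) * (complex_of_real (q x) * P x ^ n))"
  proof (induction n)
    case 0
    then show ?case using acP dP by simp
  next
    case (Suc n)
    have "abs_cont_on a b (\<lambda>x. P x ^ Suc n * P x)"
      using Suc acP by (intro abs_cont_on_mult) auto
    moreover have "AE x in lebesgue_on {a..b}. dw a b (\<lambda>x. P x ^ Suc n * P x) x
        = of_nat (Suc n) * (complex_of_real (q x) * P x ^ n) * P x + P x ^ Suc n * complex_of_real (q x)"
      using Suc acP dP by (intro abs_cont_on_product_integral(3)[OF ab]) auto
    moreover have "of_nat (Suc n) * (complex_of_real (q x) * P x ^ n) * P x + P x ^ Suc n * complex_of_real (q x)
        = of_nat (Suc (Suc n)) * (complex_of_real (q x) * P x ^ Suc n)" for x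
      by (simp add: algebra_simps)
    ultimately show ?case by (simp only: power_Suc2[of _ "Suc n"] mult.commute)
  qed
  have P0: "P a = 0" by (simp add: P_def p_def)
  have ioI: "integrable (lebesgue_on {a..b}) (\<lambda>x. q x * p x ^ n)"
  proof (intro integrable_mult_continuous_real q continuous_intros)
    have "continuous_on {a..b} (\<lambda>x. Re (P x))"
      using abs_cont_on_continuous[OF acP] by (rule continuous_on_Re)
    then show "continuous_on {a..b} p" by (simp add: P_def)
  qed
  have "P x ^ Suc n = P a ^ Suc n + integral {a..x} (dw a b (\<lambda>x. P x ^ Suc n))"
    using pow by (intro abs_cont_on_FTC(3)[OF ab _ x, of "\<lambda>x. P x ^ Suc n"]) simp
  also have "\<dots> = integral {a..x} (\<lambda>x. of_nat (Suc n) * (complex_of_real (q x) * P x ^ n))"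
    using pow x by (subst integral_AE_cong[where c=a and d=x]) (auto simp: P0)
  also have "\<dots> = integral {a..x} (\<lambda>t. complex_of_real (real (Suc n) * (q t * p t ^ n)))"
    by (simp add: P_def)
  also have "\<dots> = complex_of_real (real (Suc n) * integral {a..x} (\<lambda>t. q t * p t ^ n))"
    using integrable_on_Icc_left(1)[OF ioI x]
    by (intro integral_unique has_integral_of_real has_integral_mult_right integrable_integral)
  finally have "p x ^ Suc n = real (Suc n) * integral {a..x} (\<lambda>t. q t * p t ^ n)"
    unfolding P_def of_real_power[symmetric] of_real_eq_iff .
  then have "p x ^ Suc n / real (Suc n) = integral {a..x} (\<lambda>t. q t * p t ^ n)"
    by (simp add: field_simps)
  then show ?thesis
    using integrable_on_Icc_left(1)[OF ioI x] by (simp add: integrable_integral)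
qed

text \<open>Picard iteration: the \<open>n\<close>-th increment is dominated by a multiple of \<open>p^n / n!\<close>, where \<open>p\<close> is an
  indefinite integral of the sum of the norms of the coefficients.\<close>
lemma linear_system_solution:
  fixes A :: "nat \<Rightarrow> nat \<Rightarrow> real \<Rightarrow> complex" and g :: "nat \<Rightarrow> real \<Rightarrow> complex"
  assumes ab: "a < b"
    and A: "\<And>j k. j < m \<Longrightarrow> k < m \<Longrightarrow> integrable (lebesgue_on {a..b}) (A j k)"
    and g: "\<And>j. j < m \<Longrightarrow> integrable (lebesgue_on {a..b}) (g j)"
  obtains Y where "\<And>j. j < m \<Longrightarrow> continuous_on {a..b} (Y j)"
    and "\<And>j x. j < m \<Longrightarrow> x \<in> {a..b} \<Longrightarrow> Y j x = \<alpha> j + integral {a..x} (\<lambda>t. (\<Sum>k<m. A j k t * Y k t) + g j t)"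
proof -
  let ?M = "lebesgue_on {a..b}"
  define S where "S = (\<lambda>D j t. \<Sum>k<m. A j k t * D k t)"
  \<comment> \<open>\<open>\<Delta> n\<close> is the difference of consecutive Picard iterates: the
    initial value and the inhomogeneity \<open>g\<close> occur in \<open>\<Delta> 0\<close> alone,
    and later terms only apply the homogeneous integral operator.\<close>
  define \<Delta> where "\<Delta> = rec_nat (\<lambda>j x. \<alpha> j + integral {a..x} (g j)) (\<lambda>_ D j x. integral {a..x} (S D j))"
  have \<Delta>0: "\<Delta> 0 j x = \<alpha> j + integral {a..x} (g j)" for j x by (simp add: \<Delta>_def)
  have \<Delta>Suc: "\<Delta> (Suc n) j x = integral {a..x} (S (\<Delta> n) j)" for n j x by (simp add: \<Delta>_def)
  have S_int: "integrable ?M (S D j)" if "j < m" "\<And>k. k < m \<Longrightarrow> continuous_on {a..b} (D k)" for D j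
    unfolding S_def using that A by (intro Bochner_Integration.integrable_sum integrable_mult_continuous) auto
  have int_cont: "continuous_on {a..b} (\<lambda>x. integral {a..x} f)" if "integrable ?M f" for f :: "real \<Rightarrow> complex"
    using that by (intro abs_cont_on_continuous abs_cont_on_integral)
  have \<Delta>_cont: "continuous_on {a..b} (\<Delta> n j)" if "j < m" for n j
    using that
  proof (induction n arbitrary: j)
    case 0
    then show ?case unfolding \<Delta>0[abs_def] by (intro continuous_intros int_cont g)
  next
    case (Suc n)
    then show ?case unfolding \<Delta>Suc[abs_def] by (intro int_cont S_int)
  qed
  have S\<Delta>_int: "integrable ?M (S (\<Delta> n) j)" if "j < m" for n j
    by (rule S_int[OF that]) (rule \<Delta>_cont)
  \<comment> \<open>With the norms of all entries summed, the sum \<open>N n\<close> of all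
    components obeys one scalar recursion.\<close>
  define q where "q = (\<lambda>t. \<Sum>j<m. \<Sum>k<m. cmod (A j k t))"
  define p where "p = (\<lambda>x. integral {a..x} q)"
  have q: "integrable ?M q"
    unfolding q_def using A by (intro Bochner_Integration.integrable_sum integrable_norm) auto
  have q0: "0 \<le> q t" for t unfolding q_def by (intro sum_nonneg) auto
  have p_bounds: "0 \<le> p x" "p x \<le> p b" if "x \<in> {a..b}" for x
  proof -
    show "0 \<le> p x" unfolding p_def
      using integrable_on_Icc_left(1)[OF q that] q0 by (intro Henstock_Kurzweil_Integration.integral_nonneg) auto
    have "integral {x..b} q \<ge> 0"
      using integrable_subinterval[OF q, of x b] that q0
      by (intro Henstock_Kurzweil_Integration.integral_nonneg integrable_on_lebesgue_on) auto
    then show "p x \<le> p b" unfolding p_def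
      using integral_diff_eq[OF q, of x b] that by simp
  qed
  define N where "N = (\<lambda>n x. \<Sum>j<m. cmod (\<Delta> n j x))"
  have "continuous_on {a..b} (N 0)"
    unfolding N_def by (intro continuous_intros \<Delta>_cont) auto
  then have "bounded (N 0 ` {a..b})"
    by (intro compact_imp_bounded compact_continuous_image) auto
  then obtain C where "\<forall>z\<in>N 0 ` {a..b}. norm z \<le> C" unfolding bounded_iff by (elim exE)
  then have "norm (N 0 x) \<le> C" if "x \<in> {a..b}" for x using that by simp
  then have C: "N 0 x \<le> C" if "x \<in> {a..b}" for x using that by (auto intro: order_trans[OF abs_ge_self])
  have S_le: "(\<Sum>j<m. cmod (S (\<Delta> n) j t)) \<le> q t * N n t" for n t
  proof -
    have "cmod (S (\<Delta> n) j t) \<le> (\<Sum>k<m. cmod (A j k t)) * N n t" for j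
    proof -
      have "cmod (S (\<Delta> n) j t) \<le> (\<Sum>k<m. cmod (A j k t) * cmod (\<Delta> n k t))"
        unfolding S_def by (rule order_trans[OF norm_sum]) (simp add: norm_mult)
      also have "\<dots> \<le> (\<Sum>k<m. cmod (A j k t) * N n t)"
        unfolding N_def by (intro sum_mono mult_left_mono member_le_sum) auto
      finally show ?thesis by (simp add: sum_distrib_right)
    qed
    then have "(\<Sum>j<m. cmod (S (\<Delta> n) j t)) \<le> (\<Sum>j<m. (\<Sum>k<m. cmod (A j k t)) * N n t)"
      by (intro sum_mono)
    then show ?thesis by (simp add: q_def sum_distrib_right)
  qed
  have N_le: "N n x \<le> C * p x ^ n / fact n" if "x \<in> {a..b}" for n x
    using that
  proof (induction n arbitrary: x)
    case 0
    then show ?case using C by simp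
  next
    case (Suc n)
    have qp: "((\<lambda>t. q t * p t ^ n) has_integral p x ^ Suc n / real (Suc n)) {a..x}"
      using integral_power_primitive[OF ab q Suc.prems, of n] by (simp add: p_def)
    have Sio: "S (\<Delta> n) j integrable_on {a..x}" "(\<lambda>t. cmod (S (\<Delta> n) j t)) integrable_on {a..x}" if "j < m" for j
      by (rule integrable_on_Icc_left(1)[OF S\<Delta>_int[OF that] Suc.prems]
          integrable_on_Icc_left(1)[OF integrable_norm[OF S\<Delta>_int[OF that]] Suc.prems])+
    have "N (Suc n) x = (\<Sum>j<m. cmod (integral {a..x} (S (\<Delta> n) j)))"
      by (simp add: N_def \<Delta>Suc)
    also have "\<dots> \<le> (\<Sum>j<m. integral {a..x} (\<lambda>t. cmod (S (\<Delta> n) j t)))"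
      using Sio by (intro sum_mono integral_norm_bound_integral) auto
    also have "\<dots> = integral {a..x} (\<lambda>t. \<Sum>j<m. cmod (S (\<Delta> n) j t))"
      using Sio by (intro Henstock_Kurzweil_Integration.integral_sum[symmetric]) auto
    also have "\<dots> \<le> integral {a..x} (\<lambda>t. C / fact n * (q t * p t ^ n))"
    proof (rule integral_le)
      show "(\<lambda>t. \<Sum>j<m. cmod (S (\<Delta> n) j t)) integrable_on {a..x}"
        using Sio by (intro Henstock_Kurzweil_Integration.integrable_sum) auto
      show "(\<lambda>t. C / fact n * (q t * p t ^ n)) integrable_on {a..x}"
        using has_integral_mult_right[OF qp] by blast
      fix t assume "t \<in> {a..x}"
      then have "t \<in> {a..b}" using Suc.prems by auto
      have "(\<Sum>j<m. cmod (S (\<Delta> n) j t)) \<le> q t * N n t" by (rule S_le)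
      also have "\<dots> \<le> q t * (C * p t ^ n / fact n)"
        using Suc.IH[OF \<open>t \<in> {a..b}\<close>] q0 by (intro mult_left_mono)
      finally show "(\<Sum>j<m. cmod (S (\<Delta> n) j t)) \<le> C / fact n * (q t * p t ^ n)"
        by (simp add: mult_ac)
    qed
    also have "\<dots> = C / fact n * (p x ^ Suc n / real (Suc n))"
      using has_integral_mult_right[OF qp] by (intro integral_unique)
    finally show ?case by (simp add: field_simps)
  qed
  define B where "B = (\<lambda>n. C * p b ^ n / fact n)"
  have C0: "0 \<le> C"
    using C[of a] ab sum_nonneg[of "{..<m}" "\<lambda>j. cmod (\<Delta> 0 j a)"] by (simp add: N_def)
  have N_B: "N n x \<le> B n" if "x \<in> {a..b}" for n x
  proof -
    have "N n x \<le> C * p x ^ n / fact n" by (rule N_le[OF that])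
    also have "\<dots> \<le> C * p b ^ n / fact n"
      using p_bounds[OF that] C0 by (intro divide_right_mono mult_left_mono power_mono) auto
    finally show ?thesis by (simp add: B_def)
  qed
  have B_sum: "summable B"
    unfolding B_def using summable_mult[OF summable_exp[of "p b"], of C] by (simp add: field_simps)
  have \<Delta>_B: "cmod (\<Delta> n j x) \<le> B n" if "j < m" "x \<in> {a..b}" for n j x
  proof -
    have "cmod (\<Delta> n j x) \<le> N n x" unfolding N_def using that by (intro member_le_sum) auto
    then show ?thesis using N_B[OF that(2)] by (rule order_trans)
  qed
  define Y where "Y = (\<lambda>j x. \<Sum>n. \<Delta> n j x)"
  have \<Delta>_summable: "summable (\<lambda>n. \<Delta> n j x)" if "j < m" "x \<in> {a..b}" for j x
    by (rule summable_comparison_test'[OF B_sum \<Delta>_B[OF that]])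
  have Y_cont: "continuous_on {a..b} (Y j)" if "j < m" for j
  proof -
    have "uniform_limit {a..b} (\<lambda>n x. \<Sum>i<n. \<Delta> i j x) (\<lambda>x. suminf (\<lambda>i. \<Delta> i j x)) sequentially"
      using B_sum \<Delta>_B[OF that] by (intro Weierstrass_m_test) auto
    then have "continuous_on {a..b} (\<lambda>x. suminf (\<lambda>i. \<Delta> i j x))"
      by (rule uniform_limit_theorem[rotated])
         (rule sequentially_bot, intro always_eventually allI continuous_on_sum \<Delta>_cont that)
    then show ?thesis by (simp add: Y_def)
  qed
  show thesis
  proof
    show "continuous_on {a..b} (Y j)" if "j < m" for j by (rule Y_cont[OF that])
    fix j x assume j: "j < m" and x: "x \<in> {a..b}"
    let ?L = "lebesgue_on {a..x}"
    have xs: "t \<in> {a..b}" if "t \<in> space ?L" for t using that x by auto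
    have SY: "(\<lambda>n. S (\<Delta> n) j t) sums S Y j t" if "t \<in> {a..b}" for t
      unfolding S_def Y_def using \<Delta>_summable that by (intro sums_sum sums_mult summable_sums) auto
    have S_bound: "cmod (S (\<Delta> n) j t) \<le> q t * B n" if "t \<in> {a..b}" for n t
    proof -
      have "cmod (S (\<Delta> n) j t) \<le> (\<Sum>j<m. cmod (S (\<Delta> n) j t))" using j by (intro member_le_sum) auto
      also have "\<dots> \<le> q t * N n t" by (rule S_le)
      also have "\<dots> \<le> q t * B n" using N_B[OF that] q0 by (intro mult_left_mono)
      finally show ?thesis .
    qed
    have Si: "integrable ?L (S (\<Delta> n) j)" for n
      by (rule integrable_on_Icc_left(2)[OF S\<Delta>_int[OF j] x])
    have SY_int: "integrable ?M (S Y j)" by (rule S_int[OF j]) (rule Y_cont)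
    \<comment> \<open>Termwise integration is justified by the bound \<open>q t * B n\<close>,
      integrable in \<open>t\<close> and summable in \<open>n\<close>.\<close>
    have "(\<lambda>n. integral\<^sup>L ?L (S (\<Delta> n) j)) sums (\<integral>t. (\<Sum>n. S (\<Delta> n) j t) \<partial>?L)"
    proof (rule sums_integral[OF Si])
      show "AE t in ?L. summable (\<lambda>n. norm (S (\<Delta> n) j t))"
      proof (rule AE_I2)
        fix t assume "t \<in> space ?L"
        then show "summable (\<lambda>n. norm (S (\<Delta> n) j t))"
          using S_bound[OF xs] by (intro summable_comparison_test'[OF summable_mult[OF B_sum, of "q t"]]) simp
      qed
      have "(\<integral>t. norm (S (\<Delta> n) j t) \<partial>?L) \<le> (\<integral>t. q t \<partial>?L) * B n" for n
      proof -
        have "(\<integral>t. norm (S (\<Delta> n) j t) \<partial>?L) \<le> (\<integral>t. q t * B n \<partial>?L)"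
          using Si S_bound[OF xs] integrable_on_Icc_left(2)[OF q x]
          by (intro integral_mono integrable_norm integrable_mult_left) auto
        then show ?thesis by simp
      qed
      then show "summable (\<lambda>n. \<integral>t. norm (S (\<Delta> n) j t) \<partial>?L)"
        by (intro summable_comparison_test'[OF summable_mult[OF B_sum, of "\<integral>t. q t \<partial>?L"]]) simp
    qed
    also have "(\<integral>t. (\<Sum>n. S (\<Delta> n) j t) \<partial>?L) = (\<integral>t. S Y j t \<partial>?L)"
      using SY xs by (intro Bochner_Integration.integral_cong) (auto intro!: sums_unique[symmetric])
    also have "\<dots> = integral {a..x} (S Y j)"
      by (rule lebesgue_integral_eq_integral[OF integrable_on_Icc_left(2)[OF SY_int x]]) simp
    also have "(\<lambda>n. integral\<^sup>L ?L (S (\<Delta> n) j)) = (\<lambda>n. \<Delta> (Suc n) j x)"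
      by (simp add: \<Delta>Suc lebesgue_integral_eq_integral[OF Si])
    \<comment> \<open>The integrated series starts with \<open>\<Delta> 1\<close>; adding
      \<open>\<Delta> 0\<close> completes it to the series of \<open>Y\<close>.\<close>
    finally have "(\<lambda>n. \<Delta> n j x) sums (integral {a..x} (S Y j) + \<Delta> 0 j x)"
      by (subst (asm) sums_Suc_iff) simp
    then have "Y j x = integral {a..x} (S Y j) + \<Delta> 0 j x"
      unfolding Y_def by (rule sums_unique[symmetric])
    also have "\<dots> = \<alpha> j + (integral {a..x} (S Y j) + integral {a..x} (g j))"
      by (simp add: \<Delta>0)
    also have "integral {a..x} (S Y j) + integral {a..x} (g j) = integral {a..x} (\<lambda>t. S Y j t + g j t)"
      by (rule Henstock_Kurzweil_Integration.integral_add[symmetric,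
            OF integrable_on_Icc_left(1)[OF SY_int x] integrable_on_Icc_left(1)[OF g[OF j] x]])
    finally show "Y j x = \<alpha> j + integral {a..x} (\<lambda>t. (\<Sum>k<m. A j k t * Y k t) + g j t)"
      by (simp add: S_def)
  qed
qed

section \<open>Completeness of square-integrable functions\<close>

definition L2_nsq :: "real \<Rightarrow> real \<Rightarrow> (real \<Rightarrow> complex) \<Rightarrow> real" where
  "L2_nsq a b f = (LINT x|lebesgue_on {a..b}. (cmod (f x))\<^sup>2)"

lemma L2D: "f \<in> L2 a b \<Longrightarrow> f \<in> borel_measurable (lebesgue_on {a..b})"
    "f \<in> L2 a b \<Longrightarrow> integrable (lebesgue_on {a..b}) (\<lambda>x. (cmod (f x))\<^sup>2)"
  by (simp_all add: L2_def)

lemma cmod_mult_le_squares: "cmod (x * y) \<le> (cmod x)\<^sup>2 + (cmod y)\<^sup>2"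
proof -
  have "2 * (cmod x * cmod y) \<le> (cmod x)\<^sup>2 + (cmod y)\<^sup>2" using sum_squares_bound[of "cmod x" "cmod y"] by simp
  moreover have "0 \<le> cmod x * cmod y" by simp
  ultimately show ?thesis unfolding norm_mult by linarith
qed

lemma L2_mult_integrable:
  assumes f: "f \<in> L2 a b" and g: "g \<in> L2 a b"
  shows "integrable (lebesgue_on {a..b}) (\<lambda>x. f x * cnj (g x))"
proof (rule Bochner_Integration.integrable_bound)
  show "integrable (lebesgue_on {a..b}) (\<lambda>x. (cmod (f x))\<^sup>2 + (cmod (g x))\<^sup>2)"
    using L2D(2)[OF f] L2D(2)[OF g] by (rule Bochner_Integration.integrable_add)
  have [measurable]: "f \<in> borel_measurable (lebesgue_on {a..b})" "g \<in> borel_measurable (lebesgue_on {a..b})"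
    using L2D(1) f g by auto
  have [measurable]: "cnj \<in> borel_measurable borel"
    by (intro borel_measurable_continuous_onI continuous_intros)
  show "(\<lambda>x. f x * cnj (g x)) \<in> borel_measurable (lebesgue_on {a..b})" by measurable
  show "AE x in lebesgue_on {a..b}. norm (f x * cnj (g x)) \<le> norm ((cmod (f x))\<^sup>2 + (cmod (g x))\<^sup>2)"
    using cmod_mult_le_squares[of "f x" "cnj (g x)" for x] by (intro AE_I2) simp
qed

lemma L2_cmult:
  assumes f: "f \<in> L2 a b"
  shows "(\<lambda>x. c * f x) \<in> L2 a b"
proof -
  have [measurable]: "f \<in> borel_measurable (lebesgue_on {a..b})" using L2D(1)[OF f] .
  show ?thesis
    using L2D(2)[OF f] by (simp add: L2_def norm_mult power_mult_distrib)
qed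

lemma L2_add:
  assumes f: "f \<in> L2 a b" and g: "g \<in> L2 a b"
  shows "(\<lambda>x. f x + g x) \<in> L2 a b"
proof -
  have [measurable]: "f \<in> borel_measurable (lebesgue_on {a..b})" "g \<in> borel_measurable (lebesgue_on {a..b})"
    using L2D(1) f g by auto
  have "integrable (lebesgue_on {a..b}) (\<lambda>x. (cmod (f x + g x))\<^sup>2)"
  proof (rule Bochner_Integration.integrable_bound)
    show "integrable (lebesgue_on {a..b}) (\<lambda>x. 2 * ((cmod (f x))\<^sup>2 + (cmod (g x))\<^sup>2))"
      using L2D(2)[OF f] L2D(2)[OF g] by (intro integrable_mult_right Bochner_Integration.integrable_add)
    have "(cmod (x + y))\<^sup>2 \<le> 2 * ((cmod x)\<^sup>2 + (cmod y)\<^sup>2)" for x y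
    proof -
      have "(cmod (x + y))\<^sup>2 \<le> (cmod x + cmod y)\<^sup>2" by (intro power_mono norm_triangle_ineq) auto
      then show ?thesis using sum_squares_bound[of "cmod x" "cmod y"] by (simp add: power2_sum)
    qed
    then show "AE x in lebesgue_on {a..b}. norm ((cmod (f x + g x))\<^sup>2) \<le> norm (2 * ((cmod (f x))\<^sup>2 + (cmod (g x))\<^sup>2))"
      by (intro AE_I2) simp
  qed measurable
  moreover have "(\<lambda>x. f x + g x) \<in> borel_measurable (lebesgue_on {a..b})" by measurable
  ultimately show ?thesis by (simp add: L2_def)
qed

lemma L2_diff:
  assumes "f \<in> L2 a b" "g \<in> L2 a b"
  shows "(\<lambda>x. f x - g x) \<in> L2 a b"
  using L2_add[OF assms(1) L2_cmult[OF assms(2), of "-1"]] by simp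

lemma L2_zero: "(\<lambda>x. 0) \<in> L2 a b"
  by (simp add: L2_def)

lemma L2_AE:
  assumes f: "f \<in> L2 a b" and ae: "ae_on a b f g"
  shows "g \<in> L2 a b"
proof -
  have ae': "AE x in lebesgue_on {a..b}. f x = g x" using ae by (simp add: ae_on_def)
  have g[measurable]: "g \<in> borel_measurable (lebesgue_on {a..b})"
    using borel_measurable_AE_cong[OF L2D(1)[OF f] ae'] .
  have "integrable (lebesgue_on {a..b}) (\<lambda>x. (cmod (g x))\<^sup>2)"
  proof (rule integrable_cong_AE_imp[OF L2D(2)[OF f]])
    show "AE x in lebesgue_on {a..b}. (cmod (f x))\<^sup>2 = (cmod (g x))\<^sup>2"
      using ae' by eventually_elim simp
  qed measurable
  then show ?thesis using g by (simp add: L2_def)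
qed

lemma L2_imp_integrable:
  assumes f: "f \<in> L2 a b"
  shows "integrable (lebesgue_on {a..b}) f"
proof (rule Bochner_Integration.integrable_bound)
  show "integrable (lebesgue_on {a..b}) (\<lambda>x. (cmod (f x))\<^sup>2 + 1)"
    using L2D(2)[OF f] by (intro Bochner_Integration.integrable_add) auto
  show "f \<in> borel_measurable (lebesgue_on {a..b})" using L2D(1)[OF f] .
  show "AE x in lebesgue_on {a..b}. norm (f x) \<le> norm ((cmod (f x))\<^sup>2 + 1)"
    using cmod_mult_le_squares[of "f x" 1 for x] by (intro AE_I2) simp
qed

lemma continuous_imp_L2:
  assumes f: "continuous_on {a..b} f"
  shows "f \<in> L2 a b"
proof -
  have "f \<in> borel_measurable (lebesgue_on {a..b})"
    using f by (intro continuous_imp_measurable_on_sets_lebesgue) auto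
  moreover have "integrable (lebesgue_on {a..b}) (\<lambda>x. (cmod (f x))\<^sup>2)"
    using f by (intro continuous_imp_integrable_real continuous_intros)
  ultimately show ?thesis by (simp add: L2_def)
qed

lemma L2_inner_add_left:
  assumes "f \<in> L2 a b" "g \<in> L2 a b" "h \<in> L2 a b"
  shows "L2_inner a b (\<lambda>x. f x + g x) h = L2_inner a b f h + L2_inner a b g h"
  unfolding L2_inner_def
  by (simp add: distrib_right L2_mult_integrable assms)

lemma L2_inner_cmult_left: "L2_inner a b (\<lambda>x. c * f x) h = c * L2_inner a b f h"
  by (simp add: L2_inner_def mult.assoc)

lemma L2_inner_cnj: "cnj (L2_inner a b f g) = L2_inner a b g f"
proof -
  have "cnj (L2_inner a b f g) = (LINT x|lebesgue_on {a..b}. cnj (f x * cnj (g x)))"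
    unfolding L2_inner_def by (rule Bochner_Integration.integral_cnj[symmetric])
  then show ?thesis by (simp add: L2_inner_def mult.commute)
qed

lemma L2_inner_add_right:
  assumes "f \<in> L2 a b" "g \<in> L2 a b" "h \<in> L2 a b"
  shows "L2_inner a b h (\<lambda>x. f x + g x) = L2_inner a b h f + L2_inner a b h g"
  using arg_cong[OF L2_inner_add_left[OF assms], of cnj] by (simp add: L2_inner_cnj)

lemma L2_inner_cmult_right: "L2_inner a b h (\<lambda>x. c * f x) = cnj c * L2_inner a b h f"
  using arg_cong[OF L2_inner_cmult_left[of a b c f h], of cnj] by (simp add: L2_inner_cnj)

lemma L2_inner_diff_left:
  assumes "f \<in> L2 a b" "g \<in> L2 a b" "h \<in> L2 a b"
  shows "L2_inner a b (\<lambda>x. f x - g x) h = L2_inner a b f h - L2_inner a b g h"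
  unfolding L2_inner_def
  by (simp add: left_diff_distrib L2_mult_integrable assms)

lemma L2_inner_diff_right:
  assumes "f \<in> L2 a b" "g \<in> L2 a b" "h \<in> L2 a b"
  shows "L2_inner a b h (\<lambda>x. f x - g x) = L2_inner a b h f - L2_inner a b h g"
  using arg_cong[OF L2_inner_diff_left[OF assms], of cnj] by (simp add: L2_inner_cnj)

lemma L2_inner_AE_cong:
  assumes "ae_on a b f f'" "ae_on a b g g'"
  shows "L2_inner a b f g = L2_inner a b f' g'"
proof -
  have ae: "AE x in lebesgue_on {a..b}. f x * cnj (g x) = f' x * cnj (g' x)"
    using assms unfolding ae_on_def by eventually_elim simp
  show ?thesis
  proof (cases "integrable (lebesgue_on {a..b}) (\<lambda>x. f x * cnj (g x))")
    case True
    have "integrable (lebesgue_on {a..b}) (\<lambda>x. f' x * cnj (g' x))" by (rule integrable_AE_cong[OF True ae])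
    with True ae show ?thesis unfolding L2_inner_def by (intro integral_cong_AE) auto
  next
    case False
    moreover have "AE x in lebesgue_on {a..b}. f' x * cnj (g' x) = f x * cnj (g x)"
      using ae by eventually_elim simp
    ultimately have "\<not> integrable (lebesgue_on {a..b}) (\<lambda>x. f' x * cnj (g' x))"
      using integrable_AE_cong[of a b "\<lambda>x. f' x * cnj (g' x)" "\<lambda>x. f x * cnj (g x)"] by argo
    with False show ?thesis by (simp add: L2_inner_def not_integrable_integral_eq)
  qed
qed

lemma L2_nsq_inner: "L2_inner a b f f = complex_of_real (L2_nsq a b f)"
  unfolding L2_inner_def L2_nsq_def complex_norm_square[symmetric] by (rule integral_complex_of_real)

lemma L2_nsq_nonneg: "0 \<le> L2_nsq a b f"
  by (simp add: L2_nsq_def)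

lemma L2_nsq_eq_0D:
  assumes f: "f \<in> L2 a b" and "L2_nsq a b f = 0"
  shows "ae_on a b f (\<lambda>x. 0)"
proof -
  have "AE x in lebesgue_on {a..b}. (cmod (f x))\<^sup>2 = 0"
    using assms integral_nonneg_eq_0_iff_AE[OF L2D(2)[OF f]] by (simp add: L2_nsq_def)
  then show ?thesis by (simp add: ae_on_def)
qed

lemma L2_nsq_diff_cmult:
  assumes f: "f \<in> L2 a b" and g: "g \<in> L2 a b"
  shows "L2_nsq a b (\<lambda>x. f x - t * g x) = L2_nsq a b f - 2 * Re (cnj t * L2_inner a b f g) + (cmod t)\<^sup>2 * L2_nsq a b g"
proof -
  have tg: "(\<lambda>x. t * g x) \<in> L2 a b" by (rule L2_cmult[OF g])
  have "L2_inner a b (\<lambda>x. f x - t * g x) (\<lambda>x. f x - t * g x)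
      = L2_inner a b f f - cnj t * L2_inner a b f g - (t * L2_inner a b g f - t * (cnj t * L2_inner a b g g))"
    by (simp add: L2_inner_diff_left L2_inner_diff_right L2_inner_cmult_left L2_inner_cmult_right L2_diff f g tg
        algebra_simps)
  also have "\<dots> = L2_inner a b f f - (cnj t * L2_inner a b f g + cnj (cnj t * L2_inner a b f g)) + (t * cnj t) * L2_inner a b g g"
    by (simp add: L2_inner_cnj algebra_simps)
  also have "\<dots> = complex_of_real (L2_nsq a b f - 2 * Re (cnj t * L2_inner a b f g) + (cmod t)\<^sup>2 * L2_nsq a b g)"
    unfolding L2_nsq_inner complex_add_cnj complex_norm_square[symmetric]
    by (simp only: of_real_add of_real_diff of_real_mult)
  finally show ?thesis unfolding L2_nsq_inner of_real_eq_iff .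
qed

section \<open>The Cauchy-Schwarz inequality, completeness, and density through
  orthogonality\<close>

text \<open>The discriminant argument behind Cauchy-Schwarz, with \<open>E\<close> left free: it is
  a squared norm there, and the excess over the minimal distance when almost minimisers are shown to
  be almost orthogonal.\<close>

lemma quadratic_nonneg_imp_le:
  fixes z :: complex and E V :: real
  assumes V: "0 \<le> V" and nonneg: "\<And>t::complex. 0 \<le> E - 2 * Re (cnj t * z) + (cmod t)\<^sup>2 * V"
  shows "(cmod z)\<^sup>2 \<le> E * V"
proof -
  \<comment> \<open>Only \<open>t = s * z\<close> with real \<open>s\<close> is tried, for which the
    mixed term becomes real.\<close>
  have s: "0 \<le> E - 2 * s * (cmod z)\<^sup>2 + s\<^sup>2 * (cmod z)\<^sup>2 * V" for s :: real
  proof -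
    have "cnj (complex_of_real s * z) * z = complex_of_real (s * (cmod z)\<^sup>2)"
      by (simp only: complex_cnj_mult complex_cnj_complex_of_real of_real_mult complex_norm_square mult_ac)
    then have "Re (cnj (complex_of_real s * z) * z) = s * (cmod z)\<^sup>2" by (simp only: Re_complex_of_real)
    then show ?thesis using nonneg[of "complex_of_real s * z"] by (simp add: norm_mult power_mult_distrib)
  qed
  show ?thesis
  proof (cases "V = 0")
    case True
    have "(cmod z)\<^sup>2 = 0"
    proof (rule ccontr)
      assume "(cmod z)\<^sup>2 \<noteq> 0"
      \<comment> \<open>With \<open>V = 0\<close> the expression is affine in \<open>s\<close>; this
        \<open>s\<close> forces \<open>E \<le> -2\<close>, while \<open>s = 0\<close> gives
        \<open>0 \<le> E\<close>.\<close>
      moreover have "0 \<le> E - 2 * ((E + 1) / (cmod z)\<^sup>2) * (cmod z)\<^sup>2"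
        using s[of "(E + 1) / (cmod z)\<^sup>2"] True by simp
      ultimately have "E \<le> -2" by simp
      then show False using s[of 0] by simp
    qed
    then show ?thesis using True by simp
  next
    case False
    then have "0 < V" using V by simp
    \<comment> \<open>The value \<open>s = 1/V\<close> minimises the quadratic polynomial in
      \<open>s\<close>.\<close>
    have "0 \<le> (E - 2 * (1/V) * (cmod z)\<^sup>2 + (1/V)\<^sup>2 * (cmod z)\<^sup>2 * V) * V"
      using s[of "1/V"] V by simp
    also have "\<dots> = E * V - (cmod z)\<^sup>2"
      using \<open>0 < V\<close> by (simp add: field_simps power2_eq_square)
    finally show ?thesis by simp
  qed
qed

lemma L2_Cauchy_Schwarz:
  assumes f: "f \<in> L2 a b" and g: "g \<in> L2 a b"
  shows "(cmod (L2_inner a b f g))\<^sup>2 \<le> L2_nsq a b f * L2_nsq a b g"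
proof (rule quadratic_nonneg_imp_le[OF L2_nsq_nonneg])
  show "0 \<le> L2_nsq a b f - 2 * Re (cnj t * L2_inner a b f g) + (cmod t)\<^sup>2 * L2_nsq a b g" for t
    using L2_nsq_diff_cmult[OF f g, of t] L2_nsq_nonneg[of a b "\<lambda>x. f x - t * g x"] by simp
qed

text \<open>Weighted by \<open>2 ^ n\<close>, the bound \<open>(1/4) ^ n\<close> on squared norms
  becomes a summable bound on the integrals of the increments, so the sequence converges almost
  everywhere; Fatou's lemma carries the norm bounds to the limit.\<close>

lemma L2_fast_Cauchy_limit:
  assumes p: "\<And>n. p n \<in> L2 a b"
    and fast: "\<And>n k. n \<le> k \<Longrightarrow> L2_nsq a b (\<lambda>x. p n x - p k x) \<le> (1/4) ^ n"
  obtains P where "P \<in> L2 a b" "\<And>n. L2_nsq a b (\<lambda>x. P x - p n x) \<le> (1/4) ^ n"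
proof -
  let ?M = "lebesgue_on {a..b}"
  have pm[measurable]: "p n \<in> borel_measurable ?M" for n using L2D(1)[OF p] .
  define d where "d = (\<lambda>n x. cmod (p (Suc n) x - p n x))"
  have dp: "(\<lambda>x. p (Suc n) x - p n x) \<in> L2 a b" for n by (intro L2_diff p)
  have dm[measurable]: "d n \<in> borel_measurable ?M" for n unfolding d_def by measurable
  have di: "integrable ?M (d n)" for n
    unfolding d_def using L2_imp_integrable[OF dp] by (rule integrable_norm)
  define c where "c = measure ?M {a..b}"
  have const: "integrable ?M (\<lambda>x. C::real)" for C
    by (intro continuous_imp_integrable_real continuous_intros)
  have d_le: "(LINT x|?M. d n x) \<le> (1 + c) * (1/2) ^ n" for n
  proof -
    have "(LINT x|?M. d n x) \<le> (LINT x|?M. 2 ^ n * (d n x)\<^sup>2 + (1/2) ^ n)"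
    proof (rule integral_mono[OF di])
      show "integrable ?M (\<lambda>x. 2 ^ n * (d n x)\<^sup>2 + (1/2) ^ n)"
        using L2D(2)[OF dp] const unfolding d_def
        by (intro Bochner_Integration.integrable_add integrable_mult_right)
      fix x
      \<comment> \<open>Values of at most \<open>(1/2) ^ n\<close> are absorbed by the second
        summand, larger ones by the first, since then \<open>1 \<le> 2 ^ n * d n x\<close>.\<close>
      have "d n x * 1 \<le> 2 ^ n * (d n x)\<^sup>2 + (1/2) ^ n"
      proof (cases "d n x \<le> (1/2) ^ n")
        case True
        moreover have "0 \<le> 2 ^ n * (d n x)\<^sup>2" by simp
        ultimately show ?thesis by linarith
      next
        case False
        then have "2 ^ n * (1/2) ^ n \<le> 2 ^ n * d n x" by (intro mult_left_mono) simp_all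
        then have "1 \<le> 2 ^ n * d n x" by (simp flip: power_mult_distrib)
        then have "d n x * 1 \<le> d n x * (2 ^ n * d n x)"
          by (rule mult_left_mono) (simp add: d_def)
        also have "\<dots> = 2 ^ n * (d n x)\<^sup>2" by (simp add: power2_eq_square)
        also have "\<dots> \<le> 2 ^ n * (d n x)\<^sup>2 + (1/2) ^ n" by simp
        finally show ?thesis .
      qed
      then show "d n x \<le> 2 ^ n * (d n x)\<^sup>2 + (1/2) ^ n" by simp
    qed
    also have "\<dots> = 2 ^ n * (LINT x|?M. (d n x)\<^sup>2) + (LINT x|?M. (1/2) ^ n)"
      using L2D(2)[OF dp] const unfolding d_def by simp
    also have "(LINT x|?M. (d n x)\<^sup>2) = L2_nsq a b (\<lambda>x. p n x - p (Suc n) x)"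
      by (simp add: L2_nsq_def d_def norm_minus_commute)
    also have "(LINT x|?M. ((1/2) ^ n :: real)) = c * (1/2) ^ n"
      by (simp add: c_def)
    also have "2 ^ n * L2_nsq a b (\<lambda>x. p n x - p (Suc n) x) \<le> 2 ^ n * (1/4) ^ n"
      using fast[of n "Suc n"] by (intro mult_left_mono) auto
    also have "(2::real) ^ n * (1/4) ^ n = (1/2) ^ n"
      by (simp flip: power_mult_distrib)
    finally show ?thesis by (simp add: algebra_simps)
  qed
  have c0: "0 \<le> c" by (simp add: c_def)
  have "(\<integral>\<^sup>+ x. (\<Sum>n. ennreal (d n x)) \<partial>?M) = (\<Sum>n. \<integral>\<^sup>+ x. ennreal (d n x) \<partial>?M)"
    by (intro nn_integral_suminf) measurable
  also have "\<dots> = (\<Sum>n. ennreal (LINT x|?M. d n x))"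
    by (intro suminf_cong nn_integral_eq_integral di) (simp add: d_def)
  also have "\<dots> \<le> (\<Sum>n. ennreal ((1 + c) * (1/2) ^ n))"
    using d_le by (intro suminf_le ennreal_leI) auto
  also have "\<dots> < (\<infinity>::ennreal)"
  proof -
    have "summable (\<lambda>n. (1 + c) * (1/2::real) ^ n)" by (intro summable_mult summable_geometric) simp
    then show ?thesis
      using c0 by (subst suminf_ennreal2) auto
  qed
  finally have fin: "(\<integral>\<^sup>+ x. (\<Sum>n. ennreal (d n x)) \<partial>?M) \<noteq> \<infinity>" by simp
  have "AE x in ?M. (\<Sum>n. ennreal (d n x)) \<noteq> \<infinity>"
    by (rule nn_integral_noteq_infinite[OF _ fin]) measurable
  then have conv: "AE x in ?M. convergent (\<lambda>n. p n x)"
  proof eventually_elim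
    case (elim x)
    then have "summable (\<lambda>n. d n x)"
      by (intro summable_suminf_not_top) (auto simp: d_def)
    then have "summable (\<lambda>n. p (Suc n) x - p n x)"
      unfolding d_def by (rule summable_norm_cancel)
    then have "convergent (\<lambda>n. \<Sum>i<n. p (Suc i) x - p i x)"
      by (simp add: summable_iff_convergent)
    then have "convergent (\<lambda>n. p n x - p 0 x)"
      unfolding sum_lessThan_telescope[of "\<lambda>n. p n x"] .
    from convergent_add[OF this convergent_const[of "p 0 x"]] show ?case by simp
  qed
  \<comment> \<open>Where the sequence diverges, \<open>lim\<close> has an unspecified value; this
    happens on a null set only.\<close>
  define P where "P = (\<lambda>x. lim (\<lambda>n. p n x))"
  have Pm[measurable]: "P \<in> borel_measurable ?M" unfolding P_def by measurable
  have lim: "AE x in ?M. (\<lambda>n. p n x) \<longlonglongrightarrow> P x"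
    using conv by eventually_elim (simp add: P_def convergent_LIMSEQ_iff)
  have nn: "(\<integral>\<^sup>+ x. ennreal ((cmod (P x - p n x))\<^sup>2) \<partial>?M) \<le> ennreal ((1/4) ^ n)" for n
  proof -
    have "(\<integral>\<^sup>+ x. ennreal ((cmod (P x - p n x))\<^sup>2) \<partial>?M)
        = (\<integral>\<^sup>+ x. liminf (\<lambda>k. ennreal ((cmod (p n x - p k x))\<^sup>2)) \<partial>?M)"
    proof (rule nn_integral_cong_AE)
      show "AE x in ?M. ennreal ((cmod (P x - p n x))\<^sup>2) = liminf (\<lambda>k. ennreal ((cmod (p n x - p k x))\<^sup>2))"
        using lim
      proof eventually_elim
        case (elim x)
        have "(\<lambda>k. ennreal ((cmod (p n x - p k x))\<^sup>2)) \<longlonglongrightarrow> ennreal ((cmod (p n x - P x))\<^sup>2)"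
          by (intro tendsto_ennrealI tendsto_intros elim)
        from lim_imp_Liminf[OF sequentially_bot this] show ?case
          by (simp add: norm_minus_commute)
      qed
    qed
    also have "\<dots> \<le> liminf (\<lambda>k. \<integral>\<^sup>+ x. ennreal ((cmod (p n x - p k x))\<^sup>2) \<partial>?M)"
      by (intro nn_integral_liminf) measurable
    also have "\<dots> \<le> limsup (\<lambda>k. \<integral>\<^sup>+ x. ennreal ((cmod (p n x - p k x))\<^sup>2) \<partial>?M)"
      by (intro Liminf_le_Limsup sequentially_bot)
    also have "\<dots> \<le> ennreal ((1/4) ^ n)"
    proof (rule Limsup_bounded)
      have "(\<integral>\<^sup>+ x. ennreal ((cmod (p n x - p k x))\<^sup>2) \<partial>?M) \<le> ennreal ((1/4) ^ n)" if "n \<le> k" for k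
      proof -
        have "(\<integral>\<^sup>+ x. ennreal ((cmod (p n x - p k x))\<^sup>2) \<partial>?M) = ennreal (L2_nsq a b (\<lambda>x. p n x - p k x))"
          unfolding L2_nsq_def by (intro nn_integral_eq_integral L2D(2) L2_diff p) simp
        then show ?thesis using fast[OF that] by (simp add: ennreal_leI)
      qed
      then show "\<forall>\<^sub>F k in sequentially. (\<integral>\<^sup>+ x. ennreal ((cmod (p n x - p k x))\<^sup>2) \<partial>?M) \<le> ennreal ((1/4) ^ n)"
        unfolding eventually_sequentially by (intro exI[of _ n]) simp
    qed
    finally show ?thesis .
  qed
  have Ppn: "(\<lambda>x. P x - p n x) \<in> L2 a b" for n
  proof -
    have "integrable ?M (\<lambda>x. (cmod (P x - p n x))\<^sup>2)"
    proof (rule integrableI_bounded)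
      have "(\<integral>\<^sup>+ x. ennreal (norm ((cmod (P x - p n x))\<^sup>2)) \<partial>?M) \<le> ennreal ((1/4) ^ n)"
        using nn[of n] by simp
      also have "\<dots> < \<infinity>" by simp
      finally show "(\<integral>\<^sup>+ x. ennreal (norm ((cmod (P x - p n x))\<^sup>2)) \<partial>?M) < \<infinity>" .
    qed measurable
    moreover have "(\<lambda>x. P x - p n x) \<in> borel_measurable ?M" by measurable
    ultimately show ?thesis by (simp add: L2_def)
  qed
  show thesis
  proof
    show "P \<in> L2 a b" using L2_add[OF Ppn[of 0] p[of 0]] by simp
    fix n
    have "(\<integral>\<^sup>+ x. ennreal ((cmod (P x - p n x))\<^sup>2) \<partial>?M) = ennreal (L2_nsq a b (\<lambda>x. P x - p n x))"
      unfolding L2_nsq_def by (intro nn_integral_eq_integral L2D(2) Ppn) simp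
    with nn[of n] show "L2_nsq a b (\<lambda>x. P x - p n x) \<le> (1/4) ^ n" by simp
  qed
qed

lemma L2_nsq_cmult: "L2_nsq a b (\<lambda>x. c * f x) = (cmod c)\<^sup>2 * L2_nsq a b f"
  by (simp add: L2_nsq_def norm_mult power_mult_distrib)

text \<open>\<open>V\<close> need not be closed, so the residuals of a minimising sequence are
  followed instead: they converge to some \<open>P\<close> orthogonal to \<open>V\<close>, which
  must vanish, although every residual keeps squared norm at least \<epsilon>.\<close>

lemma L2_dense_if_orthogonal_trivial:
  assumes sub: "V \<subseteq> L2 a b" and zero: "(\<lambda>x. 0) \<in> V"
    and add: "\<And>u v. u \<in> V \<Longrightarrow> v \<in> V \<Longrightarrow> (\<lambda>x. u x + v x) \<in> V"
    and scale: "\<And>c u. u \<in> V \<Longrightarrow> (\<lambda>x. c * u x) \<in> V"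
    and trivial: "\<And>p. p \<in> L2 a b \<Longrightarrow> (\<And>u. u \<in> V \<Longrightarrow> L2_inner a b p u = 0) \<Longrightarrow> ae_on a b p (\<lambda>x. 0)"
    and f: "f \<in> L2 a b" and \<epsilon>: "\<epsilon> > 0"
  shows "\<exists>u\<in>V. L2_nsq a b (\<lambda>x. f x - u x) < \<epsilon>"
proof (rule ccontr)
  assume far: "\<not> ?thesis"
  define d where "d = (INF u\<in>V. L2_nsq a b (\<lambda>x. f x - u x))"
  have d_le: "d \<le> L2_nsq a b (\<lambda>x. f x - u x)" if "u \<in> V" for u
    unfolding d_def by (rule cINF_lower[OF bdd_belowI2[of _ 0] that]) (rule L2_nsq_nonneg)
  have d_ge: "\<epsilon> \<le> d" unfolding d_def using zero far by (intro cINF_greatest) (auto simp: not_less)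
  \<comment> \<open>The parallelogram estimate below costs \<open>2 * e n + 2 * e k\<close>, at most
    \<open>4 * e n\<close>, which this choice makes equal to \<open>(1/4) ^ n\<close>.\<close>
  define e where "e = (\<lambda>n::nat. (1/4) * (1/4::real) ^ n)"
  have e_pos: "0 < e n" for n by (simp add: e_def)
  have "\<exists>u. u \<in> V \<and> L2_nsq a b (\<lambda>x. f x - u x) < d + e n" for n
  proof (rule ccontr)
    assume "\<not> ?thesis"
    then have "d + e n \<le> d" unfolding d_def using zero by (intro cINF_greatest) (auto simp: not_less)
    then show False using e_pos[of n] by simp
  qed
  then have "\<exists>u. \<forall>n. u n \<in> V \<and> L2_nsq a b (\<lambda>x. f x - u n x) < d + e n"
    by (intro choice allI)
  then obtain u where "\<forall>n. u n \<in> V \<and> L2_nsq a b (\<lambda>x. f x - u n x) < d + e n" by (elim exE)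
  then have uV: "u n \<in> V" and u_lt: "L2_nsq a b (\<lambda>x. f x - u n x) < d + e n" for n by simp_all
  define p where "p = (\<lambda>n x. f x - u n x)"
  have uL2: "v \<in> L2 a b" if "v \<in> V" for v using that sub by blast
  have pL2: "p n \<in> L2 a b" for n unfolding p_def by (intro L2_diff f uL2 uV)
  \<comment> \<open>Moving an almost minimiser along \<open>v\<close> lowers the squared distance by
    less than \<open>e n\<close>. This is a nonnegative quadratic expression in \<open>t\<close>,
    whose discriminant bounds the inner product.\<close>
  have near_orth: "(cmod (L2_inner a b (p n) v))\<^sup>2 \<le> e n * L2_nsq a b v" if v: "v \<in> V" for n v
  proof (rule quadratic_nonneg_imp_le[OF L2_nsq_nonneg])
    fix t :: complex
    have "(\<lambda>x. u n x + t * v x) \<in> V" by (intro add scale uV v)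
    from d_le[OF this] have "d \<le> L2_nsq a b (\<lambda>x. p n x - t * v x)"
      by (simp add: p_def diff_diff_eq)
    then show "0 \<le> e n - 2 * Re (cnj t * L2_inner a b (p n) v) + (cmod t)\<^sup>2 * L2_nsq a b v"
      using L2_nsq_diff_cmult[OF pL2[of n] uL2[OF v], of t] u_lt[of n] by (simp add: p_def)
  qed
  \<comment> \<open>Parallelogram law: the midpoint of \<open>u n\<close> and \<open>u k\<close>
    lies in \<open>V\<close>, so the residual there has squared norm at least
    \<open>d\<close>.\<close>
  have fast: "L2_nsq a b (\<lambda>x. p n x - p k x) \<le> (1/4) ^ n" if "n \<le> k" for n k
  proof -
    have mid: "(\<lambda>x. (1/2) * u n x + (1/2) * u k x) \<in> V" by (intro add scale uV)
    have "4 * d \<le> 4 * L2_nsq a b (\<lambda>x. f x - ((1/2) * u n x + (1/2) * u k x))"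
      using d_le[OF mid] by simp
    also have "\<dots> = L2_nsq a b (\<lambda>x. 2 * (f x - ((1/2) * u n x + (1/2) * u k x)))"
      by (subst L2_nsq_cmult) simp
    also have "(\<lambda>x. 2 * (f x - ((1/2) * u n x + (1/2) * u k x))) = (\<lambda>x. p n x - (-1) * p k x)"
      by (auto simp: p_def algebra_simps)
    also have "L2_nsq a b \<dots> = L2_nsq a b (p n) + 2 * Re (L2_inner a b (p n) (p k)) + L2_nsq a b (p k)"
      using L2_nsq_diff_cmult[OF pL2[of n] pL2[of k], of "-1"] by simp
    finally have "L2_nsq a b (\<lambda>x. p n x - p k x) \<le> 2 * L2_nsq a b (p n) + 2 * L2_nsq a b (p k) - 4 * d"
      using L2_nsq_diff_cmult[OF pL2[of n] pL2[of k], of 1] by simp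
    also have "\<dots> \<le> 2 * e n + 2 * e k"
      using u_lt[of n] u_lt[of k] unfolding p_def by linarith
    also have "e k \<le> e n"
      unfolding e_def by (rule mult_left_mono[OF power_decreasing[OF that]]) simp_all
    finally show ?thesis by (simp add: e_def)
  qed
  obtain P where P: "P \<in> L2 a b" and Pp: "\<And>n. L2_nsq a b (\<lambda>x. P x - p n x) \<le> (1/4) ^ n"
    by (rule L2_fast_Cauchy_limit[OF pL2 fast]) (assumption, rule that)
  have lim0: "(\<lambda>n. (1/4::real) ^ n * C) \<longlonglongrightarrow> 0" for C
    by (intro tendsto_mult_left_zero LIMSEQ_power_zero) simp
  have "L2_inner a b P v = 0" if v: "v \<in> V" for v
  proof -
    have bound: "(cmod (L2_inner a b P v))\<^sup>2 \<le> (1/4) ^ n * (4 * L2_nsq a b v)" for n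
    proof -
      let ?x = "L2_inner a b (\<lambda>x. P x - p n x) v" and ?y = "L2_inner a b (p n) v"
      have "L2_inner a b P v = ?x + ?y"
        using L2_inner_diff_left[OF P pL2 uL2[OF v], of n] by simp
      moreover have "(cmod ?x)\<^sup>2 \<le> (1/4) ^ n * L2_nsq a b v"
        using L2_Cauchy_Schwarz[OF L2_diff[OF P pL2] uL2[OF v], of n]
          mult_right_mono[OF Pp[of n] L2_nsq_nonneg[of a b v]] by linarith
      moreover have "(cmod ?y)\<^sup>2 \<le> (1/4) ^ n * L2_nsq a b v"
      proof -
        have "e n * L2_nsq a b v \<le> (1/4) ^ n * L2_nsq a b v"
          by (intro mult_right_mono L2_nsq_nonneg) (simp add: e_def)
        then show ?thesis using near_orth[OF v, of n] by linarith
      qed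
      moreover have "(cmod (?x + ?y))\<^sup>2 \<le> 2 * (cmod ?x)\<^sup>2 + 2 * (cmod ?y)\<^sup>2"
      proof -
        have "(cmod (?x + ?y))\<^sup>2 \<le> (cmod ?x + cmod ?y)\<^sup>2" by (intro power_mono norm_triangle_ineq) auto
        then show ?thesis using sum_squares_bound[of "cmod ?x" "cmod ?y"] by (simp add: power2_sum)
      qed
      ultimately show ?thesis by simp
    qed
    have "(cmod (L2_inner a b P v))\<^sup>2 \<le> 0"
      by (rule LIMSEQ_le_const[OF lim0[of "4 * L2_nsq a b v"]]) (intro exI allI impI bound)
    then show ?thesis by simp
  qed
  then have P0: "ae_on a b P (\<lambda>x. 0)" by (rule trivial[OF P])
  have bound: "d \<le> (1/4) ^ n * 1" for n
  proof -
    have "d \<le> L2_nsq a b (p n)" unfolding p_def by (rule d_le[OF uV])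
    also have "L2_nsq a b (p n) = L2_nsq a b (\<lambda>x. P x - p n x)"
    proof -
      have "ae_on a b (\<lambda>x. P x - p n x) (\<lambda>x. - p n x)"
        using P0 unfolding ae_on_def by eventually_elim simp
      from L2_inner_AE_cong[OF this this]
      have "L2_nsq a b (\<lambda>x. P x - p n x) = L2_nsq a b (\<lambda>x. - p n x)"
        unfolding L2_nsq_inner of_real_eq_iff .
      then show ?thesis by (simp add: L2_nsq_def)
    qed
    also have "\<dots> \<le> (1/4) ^ n * 1" using Pp[of n] by simp
    finally show ?thesis .
  qed
  have "d \<le> 0" by (rule LIMSEQ_le_const[OF lim0[of 1]]) (intro exI allI impI bound)
  with d_ge \<epsilon> show False by simp
qed

section \<open>Quasi-derivatives and the Lagrange identity\<close>

lemma dw_linear_AE: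
  assumes ab: "a < b" and f: "abs_cont_on a b f" and g: "abs_cont_on a b g"
    and f': "AE x in lebesgue_on {a..b}. dw a b f x = f' x" and g': "AE x in lebesgue_on {a..b}. dw a b g x = g' x"
  shows "AE x in lebesgue_on {a..b}. dw a b (\<lambda>x. f x + c * g x) x = f' x + c * g' x"
proof -
  have "AE x in lebesgue_on {a..b}. x \<in> {a..b}" by (rule AE_I2) simp
  with abs_cont_on_FTC(1)[OF ab f] abs_cont_on_FTC(1)[OF ab g] f' g'
  show ?thesis
  proof eventually_elim
    case (elim x)
    have "((\<lambda>x. f x + c * g x) has_vector_derivative dw a b f x + c * dw a b g x) (at x within {a..b})"
      using elim by (intro has_vector_derivative_add has_vector_derivative_mult_right)
    then show ?case using elim by (simp add: dw_eqI[OF ab])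
  qed
qed

locale quasi_differential =
  fixes a b :: real and m :: nat and Q :: "real \<Rightarrow> real"
  assumes ab: "a < b" and m3: "m \<ge> 3" and Q_int: "integrable (lebesgue_on {a..b}) Q"
begin

abbreviation "cQ x \<equiv> inverse (\<i> ^ m) * complex_of_real (Q x)"

text \<open>In \<open>solves Y h\<close> the function \<open>Y k\<close> is the quasi-derivative \<open>D^[k] y\<close> of \<open>y = Y 0\<close>, for
  \<open>k = m - 1\<close> its absolutely continuous representative, and \<open>h\<close> is \<open>D^[m] y\<close>; thus \<open>L y = i^m h\<close>.\<close>

definition qrhs :: "(nat \<Rightarrow> real \<Rightarrow> complex) \<Rightarrow> (real \<Rightarrow> complex) \<Rightarrow> nat \<Rightarrow> real \<Rightarrow> complex" where
  "qrhs Y h k x = (if Suc k = m then cQ x * Y 1 x + h x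
     else Y (Suc k) x - (if Suc (Suc k) = m then cQ x * Y 0 x else 0))"

definition solves :: "(nat \<Rightarrow> real \<Rightarrow> complex) \<Rightarrow> (real \<Rightarrow> complex) \<Rightarrow> bool" where
  "solves Y h \<longleftrightarrow> h \<in> L2 a b \<and> (\<forall>k<m. abs_cont_on a b (Y k)) \<and>
     (\<forall>k<m. AE x in lebesgue_on {a..b}. dw a b (Y k) x = qrhs Y h k x)"

lemma solvesD:
  assumes "solves Y h"
  shows "h \<in> L2 a b" "k < m \<Longrightarrow> abs_cont_on a b (Y k)"
    "k < m \<Longrightarrow> AE x in lebesgue_on {a..b}. dw a b (Y k) x = qrhs Y h k x"
  using assms by (simp_all add: solves_def)

lemma solves_continuous: "solves Y h \<Longrightarrow> k < m \<Longrightarrow> continuous_on {a..b} (Y k)"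
  by (intro abs_cont_on_continuous solvesD(2))

lemma solves_L2: "solves Y h \<Longrightarrow> k < m \<Longrightarrow> Y k \<in> L2 a b"
  by (intro continuous_imp_L2 solves_continuous)

text \<open>The relation between \<open>z\<close> and y^(m-1) is row \<open>m - 2\<close> of the
  system solved for \<open>z\<close>, and the definition of D^[m] y is row \<open>m - 1\<close>; all
  other rows are the iteration of \<open>dw\<close>.\<close>

lemma in_Dmax_imp_solves:
  assumes D: "in_Dmax a b m Q y z"
  shows "solves (qd a b m Q y z) (qd a b m Q y z m)"
  unfolding solves_def
proof (intro conjI allI impI)
  let ?D = "qd a b m Q y z"
  have "\<not> m \<le> m - 2" "m \<noteq> m - 1" using m3 by linarith+
  then have Dm: "?D m = (\<lambda>x. dw a b z x - cQ x * dw a b y x)"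
    unfolding qd_def by (simp only: if_False)
  show "?D m \<in> L2 a b"
    using D unfolding Dm in_Dmax_def by blast
  fix k assume k: "k < m"
  show "abs_cont_on a b (?D k)"
    using D k by (auto simp: qd_def in_Dmax_def)
  consider "k + 2 < m" | "k + 2 = m" | "k + 1 = m" using k by linarith
  then show "AE x in lebesgue_on {a..b}. dw a b (?D k) x = qrhs ?D (?D m) k x"
  proof cases
    case 1
    then have "?D (Suc k) = dw a b (?D k)" by (auto simp: qd_def)
    then show ?thesis using 1 by (simp add: qrhs_def)
  next
    case 2
    then have k2: "k = m - 2" "m - 1 = Suc k" using m3 by auto
    have "AE x in lebesgue_on {a..b}. z x = (dw a b ^^ (m - 1)) y x + cQ x * y x"
      using D unfolding in_Dmax_def by blast
    then show ?thesis
    proof eventually_elim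
      case (elim x)
      have "?D k = (dw a b ^^ k) y" "?D (Suc k) = z" "?D 0 = y" using k2 m3 by (auto simp: qd_def)
      then show ?case using elim k2 2 by (simp add: qrhs_def)
    qed
  next
    case 3
    then have "?D k = z" "?D 1 = dw a b y" using m3 by (auto simp: qd_def)
    then show ?thesis using 3 by (simp add: qrhs_def Dm)
  qed
qed

text \<open>In these rows the right-hand side is continuous, so the derivative exists at every point
  and not only almost everywhere. This is what identifies \<open>Y k\<close> with the pointwise
  iterates of \<open>dw\<close>.\<close>

lemma solves_has_derivative:
  assumes Y: "solves Y h" and k: "k + 2 < m" and x: "x \<in> {a..b}"
  shows "(Y k has_vector_derivative Y (Suc k) x) (at x within {a..b})"
proof -
  have km: "k < m" "Suc k < m" using k by auto
  have ae: "AE x in lebesgue_on {a..b}. dw a b (Y k) x = Y (Suc k) x"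
    using solvesD(3)[OF Y km(1)] k by (simp add: qrhs_def)
  have Yk: "Y k u = Y k a + integral {a..u} (Y (Suc k))" if u: "u \<in> {a..b}" for u
  proof -
    have "integral {a..u} (dw a b (Y k)) = integral {a..u} (Y (Suc k))"
      using u by (intro integral_AE_cong[OF ae]) auto
    then show ?thesis using abs_cont_on_FTC(3)[OF ab solvesD(2)[OF Y km(1)] u] by simp
  qed
  have "((\<lambda>u. Y k a + integral {a..u} (Y (Suc k))) has_vector_derivative 0 + Y (Suc k) x) (at x within {a..b})"
    using x solves_continuous[OF Y km(2)]
    by (intro has_vector_derivative_add has_vector_derivative_const integral_has_vector_derivative)
  then have "((\<lambda>u. Y k a + integral {a..u} (Y (Suc k))) has_vector_derivative Y (Suc k) x) (at x within {a..b})" by simp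
  then show ?thesis
    by (rule has_vector_derivative_cong_on) (rule x, rule Yk[symmetric])
qed

lemma solves_imp_in_Dmax:
  assumes Y: "solves Y h"
  shows "in_Dmax a b m Q (Y 0) (Y (m - 1))"
    and "k < m \<Longrightarrow> x \<in> {a..b} \<Longrightarrow> qd a b m Q (Y 0) (Y (m - 1)) k x = Y k x"
    and "ae_on a b h (qd a b m Q (Y 0) (Y (m - 1)) m)"
proof -
  \<comment> \<open>\<open>dw\<close> depends only on values in \<open>{a..b}\<close>, so inside it
    the iterate may be replaced by \<open>Y k\<close>, with which it agrees on that
    interval.\<close>
  have iter: "(dw a b ^^ k) (Y 0) x = Y k x" if "k + 2 \<le> m" "x \<in> {a..b}" for k x
    using that
  proof (induction k arbitrary: x)
    case (Suc k)
    have "(dw a b ^^ Suc k) (Y 0) x = dw a b (Y k) x"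
      unfolding funpow.simps comp_def using Suc.prems by (intro dw_cong Suc.IH) auto
    also have "\<dots> = Y (Suc k) x"
      using Suc.prems by (intro dw_eqI[OF ab] solves_has_derivative[OF Y]) auto
    finally show ?case .
  qed simp
  show qd_eq: "qd a b m Q (Y 0) (Y (m - 1)) k x = Y k x" if "k < m" "x \<in> {a..b}" for k x
  proof (cases "k \<le> m - 2")
    case True
    then show ?thesis using iter[of k x] that m3 by (simp add: qd_def)
  next
    case False
    then have "k = m - 1" using that by auto
    then show ?thesis using m3 by (simp add: qd_def)
  qed
  have inI: "AE x in lebesgue_on {a..b}. x \<in> {a..b}" by (rule AE_I2) simp
  have last: "AE x in lebesgue_on {a..b}. Y (m - 1) x = (dw a b ^^ (m - 1)) (Y 0) x + cQ x * Y 0 x"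
  proof -
    have "m - 2 < m" using m3 by auto
    from solvesD(3)[OF Y this] inI show ?thesis
    proof eventually_elim
      case (elim x)
      have s: "m - 1 = Suc (m - 2)" using m3 by auto
      have "(dw a b ^^ (m - 1)) (Y 0) x = dw a b (Y (m - 2)) x"
        unfolding s funpow.simps comp_def using m3 elim by (intro dw_cong iter) auto
      also have "\<dots> = Y (m - 1) x - cQ x * Y 0 x"
        using elim s m3 by (simp add: qrhs_def)
      finally show ?case by simp
    qed
  qed
  have h_eq: "AE x in lebesgue_on {a..b}. h x = dw a b (Y (m - 1)) x - cQ x * dw a b (Y 0) x"
  proof -
    have "m - 1 < m" using m3 by auto
    from solvesD(3)[OF Y this] inI show ?thesis
    proof eventually_elim
      case (elim x)
      have "dw a b (Y 0) x = Y (Suc 0) x"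
        using m3 elim by (intro dw_eqI[OF ab] solves_has_derivative[OF Y]) auto
      then show ?case using elim m3 by (simp add: qrhs_def)
    qed
  qed
  have "\<not> m \<le> m - 2" "m \<noteq> m - 1" using m3 by linarith+
  then have qdm: "qd a b m Q (Y 0) (Y (m - 1)) m = (\<lambda>x. dw a b (Y (m - 1)) x - cQ x * dw a b (Y 0) x)"
    unfolding qd_def by (simp only: if_False)
  show "ae_on a b h (qd a b m Q (Y 0) (Y (m - 1)) m)"
    unfolding qdm ae_on_def by (rule h_eq)
  show "in_Dmax a b m Q (Y 0) (Y (m - 1))"
    unfolding in_Dmax_def
  proof (intro conjI allI impI)
    fix k assume "k \<le> m - 2"
    then have k: "k < m" "k + 2 \<le> m" using m3 by auto
    show "abs_cont_on a b ((dw a b ^^ k) (Y 0))"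
      by (rule abs_cont_on_cong[OF solvesD(2)[OF Y k(1)]]) (use iter k in simp)
  next
    show "abs_cont_on a b (Y (m - 1))" using m3 by (intro solvesD(2)[OF Y]) auto
    show "AE x in lebesgue_on {a..b}. Y (m - 1) x = (dw a b ^^ (m - 1)) (Y 0) x + cQ x * Y 0 x" by (rule last)
    show "(\<lambda>x. dw a b (Y (m - 1)) x - cQ x * dw a b (Y 0) x) \<in> L2 a b"
      by (rule L2_AE[OF solvesD(1)[OF Y]]) (use h_eq in \<open>simp add: ae_on_def\<close>)
  qed
qed

lemma solves_exists:
  assumes h: "h \<in> L2 a b"
  obtains Y where "solves Y h" "\<And>k. k < m \<Longrightarrow> Y k a = \<alpha> k"
proof -
  \<comment> \<open>The companion matrix of \<open>qrhs\<close>; \<open>Q\<close> enters only in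
    rows \<open>m - 2\<close> and \<open>m - 1\<close>, and all entries are integrable.\<close>
  define A where "A = (\<lambda>j k x. if Suc j = m then (if k = 1 then cQ x else 0)
     else (if k = Suc j then 1 else 0) - (if k = 0 then (if Suc (Suc j) = m then cQ x else 0) else 0))"
  define g where "g = (\<lambda>j x. if Suc j = m then h x else 0)"
  have cQ_int: "integrable (lebesgue_on {a..b}) (\<lambda>x. cQ x)"
    using Q_int by (intro integrable_mult_right) simp
  have const_int: "integrable (lebesgue_on {a..b}) (\<lambda>x. C::complex)" for C
    by (intro continuous_imp_integrable_real continuous_intros)
  have A_int: "integrable (lebesgue_on {a..b}) (A j k)" for j k
    unfolding A_def using cQ_int const_int
    by (cases "Suc j = m"; cases "k = 1"; cases "k = Suc j"; cases "k = 0"; cases "Suc (Suc j) = m")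
       (simp_all add: Bochner_Integration.integrable_diff del: integrable_const)
  have g_int: "integrable (lebesgue_on {a..b}) (g j)" for j
    unfolding g_def using L2_imp_integrable[OF h] const_int by (cases "Suc j = m") simp_all
  obtain Y where Yc: "\<And>j. j < m \<Longrightarrow> continuous_on {a..b} (Y j)"
    and Yeq: "\<And>j x. j < m \<Longrightarrow> x \<in> {a..b} \<Longrightarrow> Y j x = \<alpha> j + integral {a..x} (\<lambda>t. (\<Sum>k<m. A j k t * Y k t) + g j t)"
    by (rule linear_system_solution[OF ab, of m A g \<alpha>]) (rule A_int g_int that; assumption)+
  have rhs: "(\<lambda>t. (\<Sum>k<m. A j k t * Y k t) + g j t) = qrhs Y h j" if j: "j < m" for j
  proof
    fix t
    have m1: "1 < m" "0 < m" using m3 by auto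
    show "(\<Sum>k<m. A j k t * Y k t) + g j t = qrhs Y h j t"
    proof (cases "Suc j = m")
      case True
      have "(\<Sum>k<m. A j k t * Y k t) = (\<Sum>k<m. if k = 1 then cQ t * Y 1 t else 0)"
        using True by (intro sum.cong) (auto simp: A_def)
      also have "\<dots> = cQ t * Y 1 t" using m1 by (subst sum.delta) auto
      finally show ?thesis using True by (simp add: qrhs_def g_def)
    next
      case False
      have "(\<Sum>k<m. A j k t * Y k t) = (\<Sum>k<m. (if k = Suc j then Y (Suc j) t else 0)
          - (if k = 0 then (if Suc (Suc j) = m then cQ t * Y 0 t else 0) else 0))"
        using False by (intro sum.cong) (auto simp: A_def)
      also have "\<dots> = Y (Suc j) t - (if Suc (Suc j) = m then cQ t * Y 0 t else 0)"
        unfolding sum_subtractf using m1 j False by (subst (1 2) sum.delta) auto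
      finally show ?thesis using False by (simp add: qrhs_def g_def)
    qed
  qed
  have qint: "integrable (lebesgue_on {a..b}) (qrhs Y h j)" if "j < m" for j
    unfolding rhs[OF that, symmetric] using that
    by (intro Bochner_Integration.integrable_add Bochner_Integration.integrable_sum integrable_mult_continuous A_int g_int Yc) auto
  have Yeq': "Y j x = \<alpha> j + integral {a..x} (qrhs Y h j)" if "j < m" "x \<in> {a..b}" for j x
    using Yeq[OF that] rhs[OF that(1)] by simp
  show thesis
  proof
    show "solves Y h"
      unfolding solves_def
    proof (intro conjI allI impI h)
      fix k assume k: "k < m"
      show "abs_cont_on a b (Y k)" 
        by (rule indefinite_integral_derivative(1)[OF ab qint[OF k]]) (rule Yeq'[OF k])
      show "AE x in lebesgue_on {a..b}. dw a b (Y k) x = qrhs Y h k x"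
        by (rule indefinite_integral_derivative(3)[OF ab qint[OF k]]) (rule Yeq'[OF k])
    qed
    show "Y k a = \<alpha> k" if "k < m" for k using Yeq'[OF that, of a] ab by simp
  qed
qed

lemma solves_linear:
  assumes Y: "solves Y h" and W: "solves W g"
  shows "solves (\<lambda>k x. Y k x + c * W k x) (\<lambda>x. h x + c * g x)"
  unfolding solves_def
proof (intro conjI allI impI)
  show "(\<lambda>x. h x + c * g x) \<in> L2 a b"
    using solvesD(1)[OF Y] solvesD(1)[OF W] by (intro L2_add L2_cmult)
  fix k assume k: "k < m"
  show "abs_cont_on a b (\<lambda>x. Y k x + c * W k x)"
    by (intro abs_cont_on_add abs_cont_on_cmult solvesD(2)[OF Y k] solvesD(2)[OF W k])
  have "AE x in lebesgue_on {a..b}. dw a b (\<lambda>x. Y k x + c * W k x) x = qrhs Y h k x + c * qrhs W g k x"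
    by (intro dw_linear_AE[OF ab] solvesD(2,3)[OF Y k] solvesD(2,3)[OF W k])
  then show "AE x in lebesgue_on {a..b}. dw a b (\<lambda>x. Y k x + c * W k x) x = qrhs (\<lambda>k x. Y k x + c * W k x) (\<lambda>x. h x + c * g x) k x"
    by eventually_elim (simp add: qrhs_def algebra_simps)
qed

lemma solves_zero: "solves (\<lambda>k x. 0) (\<lambda>x. 0)"
  unfolding solves_def
proof (intro conjI allI impI L2_zero abs_cont_on_const)
  show "AE x in lebesgue_on {a..b}. dw a b (\<lambda>x. 0) x = qrhs (\<lambda>k x. 0) (\<lambda>x. 0) k x" for k
    by (intro AE_I2) (simp add: qrhs_def dw_eqI[OF ab])
qed

lemma solves_add: "solves Y h \<Longrightarrow> solves W g \<Longrightarrow> solves (\<lambda>k x. Y k x + W k x) (\<lambda>x. h x + g x)"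
  using solves_linear[of Y h W g 1] by simp

lemma solves_diff: "solves Y h \<Longrightarrow> solves W g \<Longrightarrow> solves (\<lambda>k x. Y k x - W k x) (\<lambda>x. h x - g x)"
  using solves_linear[of Y h W g "-1"] by simp

text \<open>Read along the rows, equality of \<open>Y k\<close> and \<open>W k\<close> gives
  equality of the next components almost everywhere, hence everywhere by continuity; the last row
  then returns \<open>h\<close>.\<close>

lemma solves_unique:
  assumes Y: "solves Y h" and W: "solves W g" and ae: "ae_on a b (Y 0) (W 0)"
  shows "k < m \<Longrightarrow> x \<in> {a..b} \<Longrightarrow> Y k x = W k x" and "ae_on a b h g"
proof -
  have inI: "AE x in lebesgue_on {a..b}. x \<in> {a..b}" by (rule AE_I2) simp
  have rhs_eq: "AE x in lebesgue_on {a..b}. x \<in> {a..b} \<and> qrhs Y h k x = qrhs W g k x"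
    if k: "k < m" and eq: "\<And>x. x \<in> {a..b} \<Longrightarrow> Y k x = W k x" for k
    using solvesD(3)[OF Y k] solvesD(3)[OF W k] inI
  proof eventually_elim
    case (elim x)
    then show ?case using dw_cong[of x a b "Y k" "W k"] eq by simp
  qed
  have eqI: "\<forall>x\<in>{a..b}. Y k x = W k x" if "k < m" "AE x in lebesgue_on {a..b}. Y k x = W k x" for k
    by (intro ballI continuous_AE_eq_imp_eq[OF ab solves_continuous[OF Y that(1)] solves_continuous[OF W that(1)] that(2)])
  have eq: "\<forall>x\<in>{a..b}. Y k x = W k x" if "k < m" for k
    using that
  proof (induction k)
    case 0
    then show ?case
      using ae by (intro eqI) (simp_all add: ae_on_def)
  next
    case (Suc k)
    \<comment> \<open>Row \<open>m - 2\<close> also contains \<open>Y 0\<close>, so the equality of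
      the first components is kept at hand beside the induction hypothesis.\<close>
    have Y0: "\<forall>x\<in>{a..b}. Y 0 x = W 0 x"
      using ae Suc.prems by (intro eqI) (simp_all add: ae_on_def)
    have "AE x in lebesgue_on {a..b}. x \<in> {a..b} \<and> qrhs Y h k x = qrhs W g k x"
      using Suc.prems bspec[OF Suc.IH] by (intro rhs_eq) simp_all
    then have "AE x in lebesgue_on {a..b}. Y (Suc k) x = W (Suc k) x"
    proof eventually_elim
      case (elim x)
      then have "Y 0 x = W 0 x" using bspec[OF Y0] by blast
      then show ?case using elim Suc.prems by (simp add: qrhs_def split: if_splits)
    qed
    then show ?case by (rule eqI[OF Suc.prems])
  qed
  show "Y k x = W k x" if "k < m" "x \<in> {a..b}"
    using that(2) by (rule bspec[OF eq[OF that(1)]])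
  have m1: "m - 1 < m" "1 < m" using m3 by auto
  have "AE x in lebesgue_on {a..b}. x \<in> {a..b} \<and> qrhs Y h (m - 1) x = qrhs W g (m - 1) x"
    by (rule rhs_eq[OF m1(1)]) (rule bspec[OF eq[OF m1(1)]])
  then show "ae_on a b h g"
    unfolding ae_on_def
  proof eventually_elim
    case (elim x)
    then have "Y 1 x = W 1 x" using bspec[OF eq[OF m1(2)]] by blast
    then show ?case using elim m3 by (simp add: qrhs_def)
  qed
qed

section \<open>The boundary form and the Lagrange identity\<close>

text \<open>The boundary form of \<open>L\<close>: quasi-derivatives of orders
  \<open>m - 1 - k\<close> and \<open>k\<close> are paired with alternating signs, so that its
  derivative along two solutions telescopes.\<close>

definition bform :: "(nat \<Rightarrow> complex) \<Rightarrow> (nat \<Rightarrow> complex) \<Rightarrow> complex" where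
  "bform A B = \<i> ^ m * (\<Sum>k<m. (-1) ^ k * (A (m - 1 - k) * cnj (B k)))"

text \<open>The terms with \<open>q\<close> cancel in pairs. The identity is applied with
  \<open>I = \<i> ^ m\<close>, \<open>J = cnj I\<close> and \<open>e = (-1) ^ (m - 3)\<close>; the
  second assumption is the rule for conjugating a power of \<open>\<i>\<close>.\<close>

lemma Lagrange_algebra:
  fixes I J e q y0 y1 w0 w1 h g :: complex
  assumes "I * J = 1" "e * I = - J"
  shows "I * ((J * q * y1 + h) * w0 + J * q * y0 * w1 + e * (y1 * (I * q * w0)) + e * (y0 * (I * q * w1 + g)))
    = (I * h) * w0 - y0 * (J * g)"
proof -
  have "I * ((J * q * y1 + h) * w0 + J * q * y0 * w1 + e * (y1 * (I * q * w0)) + e * (y0 * (I * q * w1 + g)))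
      = I * J * (q * y1 * w0) + I * h * w0 + I * J * (q * y0 * w1) + e * I * (I * (q * y1 * w0))
        + e * I * (I * (q * y0 * w1)) + e * I * (y0 * g)"
    by (simp only: distrib_left distrib_right mult_ac add_ac)
  also have "\<dots> = (I * h) * w0 - y0 * (J * g)"
  proof -
    have IJ: "I * (J * z) = z" for z
      by (simp add: assms(1) flip: mult.assoc)
    show ?thesis unfolding assms by (simp add: IJ mult_ac)
  qed
  finally show ?thesis .
qed

text \<open>Differentiating the products in the boundary form raises one index in each. With
  alternating signs the shifted sums cancel, which leaves the two ends \<open>k = 0\<close> and
  \<open>k = m - 1\<close> and the terms with \<open>Q\<close>.\<close>

lemma qrhs_Lagrange:
  "\<i> ^ m * (\<Sum>k<m. (-1) ^ k * (qrhs Y h (m - 1 - k) x * cnj (W k x) + Y (m - 1 - k) x * cnj (qrhs W g k x)))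
    = (\<i> ^ m * h x) * cnj (W 0 x) - Y 0 x * cnj (\<i> ^ m * g x)"
proof -
  \<comment> \<open>Writing \<open>m\<close> as \<open>l + 3\<close> keeps the rows
    \<open>0\<close>, \<open>m - 2\<close> and \<open>m - 1\<close> distinct, so that each special
    case of \<open>qrhs\<close> concerns its own summand.\<close>
  define l where "l = m - 3"
  then have l: "m = Suc (Suc (Suc l))" using m3 by simp
  let ?c = "cQ x"
  have l_iff: "Suc k = m \<longleftrightarrow> k = Suc (Suc l)" "Suc (Suc k) = m \<longleftrightarrow> k = Suc l" for k
    using l by auto
  have l_set: "{..<m} = {..<Suc (Suc (Suc l))}" and l_diff: "m - 1 - k = Suc (Suc l) - k" for k
    using l by auto
  have "(\<Sum>k<m. (-1) ^ k * (qrhs Y h (m - 1 - k) x * cnj (W k x)))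
      = (?c * Y 1 x + h x) * cnj (W 0 x) - (\<Sum>k<Suc (Suc l). (-1) ^ k * (Y (Suc (Suc l) - k) x * cnj (W (Suc k) x)))
        + ?c * Y 0 x * cnj (W 1 x)"
  proof -
    have "(\<Sum>k<m. (-1) ^ k * (qrhs Y h (m - 1 - k) x * cnj (W k x)))
        = (?c * Y 1 x + h x) * cnj (W 0 x) - (\<Sum>k<Suc (Suc l). (-1) ^ k * (qrhs Y h (Suc l - k) x * cnj (W (Suc k) x)))"
      unfolding l_set l_diff by (subst sum.lessThan_Suc_shift) (simp add: qrhs_def l_iff sum_negf)
    also have "(\<Sum>k<Suc (Suc l). (-1) ^ k * (qrhs Y h (Suc l - k) x * cnj (W (Suc k) x)))
        = (\<Sum>k<Suc (Suc l). (-1) ^ k * (Y (Suc (Suc l) - k) x * cnj (W (Suc k) x)) - (if k = 0 then ?c * Y 0 x * cnj (W 1 x) else 0))"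
      by (intro sum.cong) (auto simp: qrhs_def l_iff Suc_diff_le algebra_simps)
    also have "\<dots> = (\<Sum>k<Suc (Suc l). (-1) ^ k * (Y (Suc (Suc l) - k) x * cnj (W (Suc k) x))) - ?c * Y 0 x * cnj (W 1 x)"
      unfolding sum_subtractf by (subst sum.delta) auto
    finally show ?thesis by simp
  qed
  moreover have "(\<Sum>k<m. (-1) ^ k * (Y (m - 1 - k) x * cnj (qrhs W g k x)))
      = (\<Sum>k<Suc (Suc l). (-1) ^ k * (Y (Suc (Suc l) - k) x * cnj (W (Suc k) x)))
        + (-1) ^ l * (Y 1 x * (cnj ?c * cnj (W 0 x))) + (-1) ^ l * (Y 0 x * (cnj ?c * cnj (W 1 x) + cnj (g x)))"
  proof -
    have "(\<Sum>k<m. (-1) ^ k * (Y (m - 1 - k) x * cnj (qrhs W g k x)))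
        = (\<Sum>k<Suc (Suc l). (-1) ^ k * (Y (Suc (Suc l) - k) x * cnj (qrhs W g k x)))
          + (-1) ^ l * (Y 0 x * (cnj ?c * cnj (W 1 x) + cnj (g x)))"
      unfolding l_set l_diff by (subst sum.lessThan_Suc) (simp add: qrhs_def l_iff)
    also have "(\<Sum>k<Suc (Suc l). (-1) ^ k * (Y (Suc (Suc l) - k) x * cnj (qrhs W g k x)))
        = (\<Sum>k<Suc (Suc l). (-1) ^ k * (Y (Suc (Suc l) - k) x * cnj (W (Suc k) x))
            + (if k = Suc l then (-1) ^ l * (Y 1 x * (cnj ?c * cnj (W 0 x))) else 0))"
      by (intro sum.cong) (auto simp: qrhs_def l_iff algebra_simps)
    also have "\<dots> = (\<Sum>k<Suc (Suc l). (-1) ^ k * (Y (Suc (Suc l) - k) x * cnj (W (Suc k) x)))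
        + (-1) ^ l * (Y 1 x * (cnj ?c * cnj (W 0 x)))"
      unfolding sum.distrib by (subst sum.delta) auto
    finally show ?thesis by simp
  qed
  ultimately have sum: "(\<Sum>k<m. (-1) ^ k * (qrhs Y h (m - 1 - k) x * cnj (W k x) + Y (m - 1 - k) x * cnj (qrhs W g k x)))
      = (?c * Y 1 x + h x) * cnj (W 0 x) + ?c * Y 0 x * cnj (W 1 x)
        + (-1) ^ l * (Y 1 x * (cnj ?c * cnj (W 0 x))) + (-1) ^ l * (Y 0 x * (cnj ?c * cnj (W 1 x) + cnj (g x)))"
    by (simp add: distrib_left sum.distrib)
  define I where "I = \<i> ^ m"
  define q where "q = complex_of_real (Q x)"
  define e where "e = (-1 :: complex) ^ l"
  have II: "I * cnj I = 1"
    by (simp add: I_def flip: power_mult_distrib)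
  have cI: "cnj I = - e * I"
  proof -
    have "cnj I = (-1 * \<i>) ^ m" by (simp add: I_def)
    also have "\<dots> = (-1) ^ m * I" unfolding I_def by (rule power_mult_distrib)
    finally show ?thesis by (simp add: l e_def)
  qed
  have c: "?c = cnj I * q"
    using inverse_unique[OF II] by (simp only: I_def q_def)
  have cc: "cnj ?c = I * q" unfolding c by (simp add: q_def)
  have "e * I = - cnj I" by (simp add: cI)
  from Lagrange_algebra[OF II this, of q "Y 1 x" "h x" "cnj (W 0 x)" "Y 0 x" "cnj (W 1 x)" "cnj (g x)"]
  have "I * ((?c * Y 1 x + h x) * cnj (W 0 x) + ?c * Y 0 x * cnj (W 1 x)
        + e * (Y 1 x * (cnj ?c * cnj (W 0 x))) + e * (Y 0 x * (cnj ?c * cnj (W 1 x) + cnj (g x))))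
      = (I * h x) * cnj (W 0 x) - Y 0 x * cnj (I * g x)"
    unfolding cc unfolding c complex_cnj_mult .
  then show ?thesis
    unfolding sum e_def[symmetric] I_def[symmetric] .
qed

text \<open>Each product in the boundary form is absolutely continuous and integrates to its
  boundary difference; \<open>qrhs_Lagrange\<close> identifies the alternating sum of the
  integrands.\<close>

theorem Lagrange_identity:
  assumes Y: "solves Y h" and W: "solves W g"
  shows "L2_inner a b (\<lambda>x. \<i> ^ m * h x) (W 0) - L2_inner a b (Y 0) (\<lambda>x. \<i> ^ m * g x)
    = bform (\<lambda>k. Y k b) (\<lambda>k. W k b) - bform (\<lambda>k. Y k a) (\<lambda>k. W k a)"
proof -
  let ?M = "lebesgue_on {a..b}"
  let ?F = "\<lambda>k x. qrhs Y h (m - 1 - k) x * cnj (W k x) + Y (m - 1 - k) x * cnj (qrhs W g k x)"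
  have F: "integrable ?M (?F k)"
      "(LINT x|?M. ?F k x) = Y (m - 1 - k) b * cnj (W k b) - Y (m - 1 - k) a * cnj (W k a)" if k: "k < m" for k
  proof -
    have k': "m - 1 - k < m" using m3 by auto
    have W': "abs_cont_on a b (\<lambda>x. cnj (W k x))"
      by (rule abs_cont_on_cnj[OF solvesD(2)[OF W k]])
    have "AE x in ?M. x \<in> {a..b}" by (rule AE_I2) simp
    with abs_cont_on_FTC(1)[OF ab solvesD(2)[OF W k]] solvesD(3)[OF W k]
    have dW': "AE x in ?M. dw a b (\<lambda>x. cnj (W k x)) x = cnj (qrhs W g k x)"
    proof eventually_elim
      case (elim x)
      have "((\<lambda>x. cnj (W k x)) has_vector_derivative cnj (dw a b (W k) x)) (at x within {a..b})"
        using elim by (intro has_vector_derivative_cnj)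
      then show ?case using elim by (simp add: dw_eqI[OF ab])
    qed
    show "integrable ?M (?F k)"
      "(LINT x|?M. ?F k x) = Y (m - 1 - k) b * cnj (W k b) - Y (m - 1 - k) a * cnj (W k a)"
      by (rule abs_cont_on_product_integral[OF ab solvesD(2)[OF Y k'] W' solvesD(3)[OF Y k'] dW'])+
  qed
  have hL2: "(\<lambda>x. \<i> ^ m * h x) \<in> L2 a b" "(\<lambda>x. \<i> ^ m * g x) \<in> L2 a b"
    by (rule L2_cmult[OF solvesD(1)[OF Y]] L2_cmult[OF solvesD(1)[OF W]])+
  have "0 < m" using m3 by simp
  note ints = L2_mult_integrable[OF hL2(1) solves_L2[OF W \<open>0 < m\<close>]] L2_mult_integrable[OF solves_L2[OF Y \<open>0 < m\<close>] hL2(2)]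
  have "L2_inner a b (\<lambda>x. \<i> ^ m * h x) (W 0) - L2_inner a b (Y 0) (\<lambda>x. \<i> ^ m * g x)
      = (LINT x|?M. (\<i> ^ m * h x) * cnj (W 0 x) - Y 0 x * cnj (\<i> ^ m * g x))"
    unfolding L2_inner_def
    by (rule Bochner_Integration.integral_diff[OF ints, symmetric])
  also have "\<dots> = (LINT x|?M. \<i> ^ m * (\<Sum>k<m. (-1) ^ k * ?F k x))"
    unfolding qrhs_Lagrange ..
  also have "\<dots> = \<i> ^ m * (\<Sum>k<m. (-1) ^ k * (LINT x|?M. ?F k x))"
  proof -
    have "integrable ?M (\<lambda>x. (-1) ^ k * ?F k x)" if "k < m" for k
      by (rule integrable_mult_right[OF F(1)[OF that]])
    then have "(LINT x|?M. (\<Sum>k<m. (-1) ^ k * ?F k x)) = (\<Sum>k<m. (LINT x|?M. (-1) ^ k * ?F k x))"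
      by (intro Bochner_Integration.integral_sum) simp
    then show ?thesis by (simp only: Bochner_Integration.integral_mult_right_zero)
  qed
  also have "\<dots> = \<i> ^ m * (\<Sum>k<m. (-1) ^ k * (Y (m - 1 - k) b * cnj (W k b) - Y (m - 1 - k) a * cnj (W k a)))"
    by (intro arg_cong[where f = "(*) (\<i> ^ m)"] sum.cong refl) (simp only: F(2) lessThan_iff)
  also have "\<dots> = bform (\<lambda>k. Y k b) (\<lambda>k. W k b) - bform (\<lambda>k. Y k a) (\<lambda>k. W k a)"
    by (simp add: bform_def right_diff_distrib sum_subtractf)
  finally show ?thesis .
qed

end

section \<open>The adjoint of the minimal operator\<close>

lemma square_system_solvable:
  fixes M :: "nat \<Rightarrow> nat \<Rightarrow> complex"
  assumes inj: "\<And>c j. (\<And>i. i < n \<Longrightarrow> (\<Sum>j<n. M i j * c j) = 0) \<Longrightarrow> j < n \<Longrightarrow> c j = 0"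
  obtains c where "\<And>i. i < n \<Longrightarrow> (\<Sum>j<n. M i j * c j) = \<beta> i"
proof -
  define A where "A = Matrix.mat n n (\<lambda>(i,j). M i j)"
  have A: "A \<in> carrier_mat n n" by (simp add: A_def)
  have A_mult: "vec_index (A *\<^sub>v v) i = (\<Sum>j<n. M i j * vec_index v j)" if "v \<in> carrier_vec n" "i < n" for v i
    using that by (simp add: A_def scalar_prod_def atLeast0LessThan)
  have "Determinant.det A \<noteq> 0"
  proof
    assume "Determinant.det A = 0"
    then obtain v where v: "v \<in> carrier_vec n" "v \<noteq> 0\<^sub>v n" "A *\<^sub>v v = 0\<^sub>v n"
      using det_0_iff_vec_prod_zero[OF A] by blast
    have "vec_index v j = 0" if "j < n" for j
    proof (rule inj[OF _ that])
      fix i assume "i < n"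
      then show "(\<Sum>j<n. M i j * vec_index v j) = 0"
        using A_mult[OF v(1), of i] v(3) by simp
    qed
    then have "v = 0\<^sub>v n" using v(1) by (intro eq_vecI) auto
    with v(2) show False by simp
  qed
  then obtain B where B: "B \<in> carrier_mat n n" "A * B = 1\<^sub>m n"
    using det_non_zero_imp_unit[OF A, of n] unfolding Units_def ring_mat_def by auto
  define b where "b = Matrix.vec n \<beta>"
  have b: "b \<in> carrier_vec n" by (simp add: b_def)
  have Bb: "B *\<^sub>v b \<in> carrier_vec n" by (rule mult_mat_vec_carrier[OF B(1) b])
  have "A *\<^sub>v (B *\<^sub>v b) = b"
    using assoc_mult_mat_vec[OF A B(1) b] B(2) b by simp
  then have "(\<Sum>j<n. M i j * vec_index (B *\<^sub>v b) j) = \<beta> i" if "i < n" for i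
    using A_mult[OF Bb that] that by (simp add: b_def)
  then show thesis by (rule that)
qed

lemma ae_on_refl: "ae_on a b f f"
  by (simp add: ae_on_def)

lemma ae_on_sym: "ae_on a b f g \<Longrightarrow> ae_on a b g f"
  unfolding ae_on_def by (erule eventually_mono) simp

lemma ae_on_trans: "ae_on a b f g \<Longrightarrow> ae_on a b g h \<Longrightarrow> ae_on a b f h"
  unfolding ae_on_def by (erule (1) eventually_elim2) simp

lemma ae_on_lincomb:
  assumes "ae_on a b f f'" "ae_on a b g g'"
  shows "ae_on a b (\<lambda>x. f x + c * g x) (\<lambda>x. f' x + c * g' x)"
  using assms unfolding ae_on_def by eventually_elim simp

lemma ae_on_cmult:
  assumes "ae_on a b f f'"
  shows "ae_on a b (\<lambda>x. c * f x) (\<lambda>x. c * f' x)"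
  using assms unfolding ae_on_def by eventually_elim simp

context quasi_differential
begin

text \<open>Elements of a graph are known only almost everywhere and have no boundary values;
  \<open>Y\<close> carries the continuous functions from which these are read off.\<close>

definition realizes :: "(real \<Rightarrow> complex) \<Rightarrow> (real \<Rightarrow> complex) \<Rightarrow> (nat \<Rightarrow> real \<Rightarrow> complex) \<Rightarrow> (real \<Rightarrow> complex) \<Rightarrow> bool" where
  "realizes u v Y h \<longleftrightarrow> solves Y h \<and> ae_on a b u (Y 0) \<and> ae_on a b v (\<lambda>x. \<i> ^ m * h x)"

lemma m_pos: "0 < m" using m3 by simp

lemma i_pow_inverse: "\<i> ^ m * (inverse (\<i> ^ m) * z) = z"
  by (simp flip: mult.assoc)

lemma realizesD:
  assumes "realizes u v Y h"
  shows "solves Y h" "ae_on a b u (Y 0)" "ae_on a b v (\<lambda>x. \<i> ^ m * h x)" "u \<in> L2 a b" "v \<in> L2 a b"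
proof -
  show Y: "solves Y h" and u: "ae_on a b u (Y 0)" and v: "ae_on a b v (\<lambda>x. \<i> ^ m * h x)"
    using assms by (simp_all add: realizes_def)
  show "u \<in> L2 a b" by (rule L2_AE[OF solves_L2[OF Y m_pos] ae_on_sym[OF u]])
  show "v \<in> L2 a b" by (rule L2_AE[OF L2_cmult[OF solvesD(1)[OF Y]] ae_on_sym[OF v]])
qed

lemma realizes_self: "solves Y h \<Longrightarrow> realizes (Y 0) (\<lambda>x. \<i> ^ m * h x) Y h"
  by (simp add: realizes_def ae_on_refl)

lemma realizes_lincomb:
  assumes "realizes u v Y h" "realizes u' v' W g"
  shows "realizes (\<lambda>x. u x + c * u' x) (\<lambda>x. v x + c * v' x) (\<lambda>k x. Y k x + c * W k x) (\<lambda>x. h x + c * g x)"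
proof -
  have "ae_on a b (\<lambda>x. v x + c * v' x) (\<lambda>x. \<i> ^ m * h x + c * (\<i> ^ m * g x))"
    by (rule ae_on_lincomb[OF realizesD(3)[OF assms(1)] realizesD(3)[OF assms(2)]])
  then have "ae_on a b (\<lambda>x. v x + c * v' x) (\<lambda>x. \<i> ^ m * (h x + c * g x))"
    by (simp add: distrib_left mult.left_commute)
  then show ?thesis
    unfolding realizes_def
    using solves_linear[OF realizesD(1)[OF assms(1)] realizesD(1)[OF assms(2)]]
      ae_on_lincomb[OF realizesD(2)[OF assms(1)] realizesD(2)[OF assms(2)]] by blast
qed

lemma realizes_unique:
  assumes "realizes u v Y h" "realizes u' v' W g" "ae_on a b u u'"
  shows "k < m \<Longrightarrow> x \<in> {a..b} \<Longrightarrow> Y k x = W k x" and "ae_on a b v v'"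
proof -
  have YW: "ae_on a b (Y 0) (W 0)"
    using ae_on_trans[OF ae_on_sym[OF realizesD(2)[OF assms(1)]] ae_on_trans[OF assms(3) realizesD(2)[OF assms(2)]]] .
  note uniq = solves_unique[OF realizesD(1)[OF assms(1)] realizesD(1)[OF assms(2)] YW]
  show "Y k x = W k x" if "k < m" "x \<in> {a..b}" by (rule uniq(1)[OF that])
  show "ae_on a b v v'"
    using ae_on_trans[OF realizesD(3)[OF assms(1)] ae_on_trans[OF ae_on_cmult[OF uniq(2)] ae_on_sym[OF realizesD(3)[OF assms(2)]]]] .
qed

text \<open>Translates the three graphs at once: \<open>P\<close> is the boundary condition on the
  states at \<open>a\<close> and \<open>b\<close>. It has to ignore indices from \<open>m\<close>
  on, because \<open>qd\<close> and \<open>Y\<close> are known to agree only below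
  \<open>m\<close>.\<close>

lemma graph_realizes_iff:
  assumes P: "\<And>A A' B B'. (\<forall>k<m. A k = A' k) \<Longrightarrow> (\<forall>k<m. B k = B' k) \<Longrightarrow> P A B \<Longrightarrow> P A' B'"
  shows "(u \<in> L2 a b \<and> v \<in> L2 a b \<and> (\<exists>y z. in_Dmax a b m Q y z \<and> ae_on a b u y \<and>
      ae_on a b v (\<lambda>x. \<i> ^ m * qd a b m Q y z m x) \<and> P (\<lambda>k. qd a b m Q y z k a) (\<lambda>k. qd a b m Q y z k b)))
    \<longleftrightarrow> (\<exists>Y h. realizes u v Y h \<and> P (\<lambda>k. Y k a) (\<lambda>k. Y k b))" (is "?L \<longleftrightarrow> ?R")
proof
  assume ?L
  then obtain y z where yz: "in_Dmax a b m Q y z" "ae_on a b u y" "ae_on a b v (\<lambda>x. \<i> ^ m * qd a b m Q y z m x)"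
    "P (\<lambda>k. qd a b m Q y z k a) (\<lambda>k. qd a b m Q y z k b)"
    by (elim conjE exE)
  have "qd a b m Q y z 0 = y" by (simp add: qd_def)
  then have "realizes u v (qd a b m Q y z) (qd a b m Q y z m)"
    unfolding realizes_def using in_Dmax_imp_solves[OF yz(1)] yz(2,3) by simp
  with yz(4) show ?R by (intro exI conjI)
next
  assume ?R
  then obtain Y h where Y: "realizes u v Y h" and PY: "P (\<lambda>k. Y k a) (\<lambda>k. Y k b)" by (elim conjE exE)
  note sD = solves_imp_in_Dmax[OF realizesD(1)[OF Y]]
  have "P (\<lambda>k. qd a b m Q (Y 0) (Y (m - 1)) k a) (\<lambda>k. qd a b m Q (Y 0) (Y (m - 1)) k b)"
    by (rule P[OF _ _ PY]) (use sD(2) ab in simp_all)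
  moreover have "ae_on a b v (\<lambda>x. \<i> ^ m * qd a b m Q (Y 0) (Y (m - 1)) m x)"
    by (rule ae_on_trans[OF realizesD(3)[OF Y] ae_on_cmult[OF sD(3)]])
  ultimately show ?L
    using realizesD(2,4,5)[OF Y] sD(1) by (intro conjI exI)
qed

lemma Lmax_graph_iff: "(u, v) \<in> Lmax_graph a b m Q \<longleftrightarrow> (\<exists>Y h. realizes u v Y h)"
  using graph_realizes_iff[of "\<lambda>_ _. True" u v] by (simp add: Lmax_graph_def)

lemma Lmin_graph_iff:
  "(u, v) \<in> Lmin_graph a b m Q \<longleftrightarrow> (\<exists>Y h. realizes u v Y h \<and> (\<forall>k<m. Y k a = 0 \<and> Y k b = 0))"
  using graph_realizes_iff[of "\<lambda>A B. \<forall>k<m. A k = 0 \<and> B k = 0" u v] by (simp add: Lmin_graph_def)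

lemma bform_zero_left: "(\<And>k. k < m \<Longrightarrow> A k = 0) \<Longrightarrow> bform A B = 0"
  unfolding bform_def by simp

lemma realizes_Lagrange:
  assumes "realizes u v Y h" "realizes u' v' W g"
  shows "L2_inner a b v u' - L2_inner a b u v' = bform (\<lambda>k. Y k b) (\<lambda>k. W k b) - bform (\<lambda>k. Y k a) (\<lambda>k. W k a)"
  unfolding Lagrange_identity[OF realizesD(1)[OF assms(1)] realizesD(1)[OF assms(2)], symmetric]
  using L2_inner_AE_cong[OF realizesD(3)[OF assms(1)] realizesD(2)[OF assms(2)]]
    L2_inner_AE_cong[OF realizesD(2)[OF assms(1)] realizesD(3)[OF assms(2)]] by simp

lemma solves_sum:
  assumes "\<And>j. j < n \<Longrightarrow> solves (Y j) (h j)"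
  shows "solves (\<lambda>k x. \<Sum>j<n. c j * Y j k x) (\<lambda>x. \<Sum>j<(n::nat). c j * h j x)"
  using assms
proof (induction n)
  case 0
  then show ?case using solves_zero by simp
next
  case (Suc n)
  have "solves (\<lambda>k x. \<Sum>j<n. c j * Y j k x) (\<lambda>x. \<Sum>j<n. c j * h j x)"
    by (rule Suc.IH) (simp add: Suc.prems)
  from solves_linear[OF this Suc.prems[of n], of "c n"] show ?case by simp
qed

text \<open>Elements of \<open>ker L_max\<close>, used as right-hand sides, steer the zero state at \<open>a\<close> to every state
  at \<open>b\<close>: by the Lagrange identity, one that steers it to the zero state is orthogonal to itself.\<close>
lemma kernel_steering:
  obtains \<nu> Y where "solves \<nu> (\<lambda>x. 0)" "solves Y (\<lambda>x. inverse (\<i> ^ m) * \<nu> 0 x)"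
    "\<And>k. k < m \<Longrightarrow> Y k a = 0" "\<And>k. k < m \<Longrightarrow> Y k b = \<beta> k"
proof -
  have "\<exists>W. solves W (\<lambda>x. 0) \<and> (\<forall>k<m. W k a = (if k = j then 1 else 0))" for j
    by (rule solves_exists[OF L2_zero, of "\<lambda>k. if k = j then 1 else 0"]) blast
  then have "\<exists>W. \<forall>j. solves (W j) (\<lambda>x. 0) \<and> (\<forall>k<m. W j k a = (if k = j then 1 else 0))"
    by (intro choice allI)
  then obtain W where "\<forall>j. solves (W j) (\<lambda>x. 0) \<and> (\<forall>k<m. W j k a = (if k = j then 1 else 0))" by (elim exE)
  then have W: "solves (W j) (\<lambda>x. 0)" and Wa: "k < m \<Longrightarrow> W j k a = (if k = j then 1 else 0)" for j k by simp_all
  \<comment> \<open>The factor \<open>inverse (\<i> ^ m)\<close> makes \<open>W j 0\<close> itself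
    the image of the solution under \<open>L_max\<close>.\<close>
  have "\<exists>Z. solves Z (\<lambda>x. inverse (\<i> ^ m) * W j 0 x) \<and> (\<forall>k<m. Z k a = 0)" for j
    by (rule solves_exists[OF L2_cmult[OF solves_L2[OF W[of j] m_pos], of "inverse (\<i> ^ m)"], where \<alpha> = "\<lambda>k. 0"]) blast
  then have "\<exists>Z. \<forall>j. solves (Z j) (\<lambda>x. inverse (\<i> ^ m) * W j 0 x) \<and> (\<forall>k<m. Z j k a = 0)"
    by (intro choice allI)
  then obtain Z where "\<forall>j. solves (Z j) (\<lambda>x. inverse (\<i> ^ m) * W j 0 x) \<and> (\<forall>k<m. Z j k a = 0)" by (elim exE)
  then have Z: "solves (Z j) (\<lambda>x. inverse (\<i> ^ m) * W j 0 x)" and Za: "k < m \<Longrightarrow> Z j k a = 0" for j k by simp_all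
  define \<nu> where "\<nu> = (\<lambda>(c::nat \<Rightarrow> complex) k x. \<Sum>j<m. c j * W j k x)"
  define Y where "Y = (\<lambda>(c::nat \<Rightarrow> complex) k x. \<Sum>j<m. c j * Z j k x)"
  have \<nu>: "solves (\<nu> c) (\<lambda>x. 0)" for c
    using solves_sum[of m W "\<lambda>j x. 0" c] W by (simp add: \<nu>_def)
  have \<nu>a: "\<nu> c k a = c k" if "k < m" for c k
  proof -
    have "\<nu> c k a = (\<Sum>j<m. if j = k then c k else 0)"
      unfolding \<nu>_def using Wa[OF that] by (intro sum.cong) auto
    then show ?thesis using that by simp
  qed
  have Y: "solves (Y c) (\<lambda>x. inverse (\<i> ^ m) * \<nu> c 0 x)" for c
  proof -
    have "(\<lambda>x. \<Sum>j<m. c j * (inverse (\<i> ^ m) * W j 0 x)) = (\<lambda>x. inverse (\<i> ^ m) * \<nu> c 0 x)"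
      by (simp add: \<nu>_def sum_distrib_left mult.left_commute)
    then show ?thesis
      using solves_sum[of m Z "\<lambda>j x. inverse (\<i> ^ m) * W j 0 x" c] Z by (simp add: Y_def)
  qed
  have Ya: "Y c k a = 0" if "k < m" for c k
    using Za[OF that] by (simp add: Y_def)
  obtain c where c: "\<And>k. k < m \<Longrightarrow> (\<Sum>j<m. Z j k b * c j) = \<beta> k"
  proof (rule square_system_solvable[of m "\<lambda>k j. Z j k b" \<beta>])
    fix c j assume c0: "\<And>k. k < m \<Longrightarrow> (\<Sum>j<m. Z j k b * c j) = 0" and j: "j < m"
    have Yb: "Y c k b = 0" if "k < m" for k
      using c0[OF that] by (simp add: Y_def mult.commute)
    have "L2_inner a b (\<lambda>x. \<i> ^ m * (inverse (\<i> ^ m) * \<nu> c 0 x)) (\<nu> c 0) - L2_inner a b (Y c 0) (\<lambda>x. \<i> ^ m * 0) = 0"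
      unfolding Lagrange_identity[OF Y \<nu>] using Yb Ya by (simp add: bform_zero_left)
    then have "L2_nsq a b (\<nu> c 0) = 0"
      unfolding i_pow_inverse by (simp add: L2_nsq_inner) (simp add: L2_inner_def)
    then have "ae_on a b (\<nu> c 0) (\<lambda>x. 0)"
      by (rule L2_nsq_eq_0D[OF solves_L2[OF \<nu> m_pos]])
    from solves_unique(1)[OF \<nu> solves_zero this j, of a] have "\<nu> c j a = 0" using ab by simp
    then show "c j = 0" using \<nu>a[OF j] by simp
  qed (rule that)
  show thesis
    by (rule that[OF \<nu> Y[of c] Ya]) (use c in \<open>simp_all add: Y_def mult.commute\<close>)
qed

section \<open>Prescribed boundary values, the adjoint, and density of the minimal domain\<close>

text \<open>A homogeneous solution takes the prescribed state at \<open>a\<close>; a steering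
  solution, zero at \<open>a\<close>, then corrects the state at \<open>b\<close>.\<close>

lemma boundary_values_surjective:
  obtains Y h where "solves Y h" "\<And>k. k < m \<Longrightarrow> Y k a = \<alpha> k" "\<And>k. k < m \<Longrightarrow> Y k b = \<beta> k"
proof -
  obtain W where W: "solves W (\<lambda>x. 0)" "\<And>k. k < m \<Longrightarrow> W k a = \<alpha> k"
    by (rule solves_exists[OF L2_zero]) (rule that)
  obtain \<nu> Z where Z: "solves Z (\<lambda>x. inverse (\<i> ^ m) * \<nu> 0 x)" "\<And>k. k < m \<Longrightarrow> Z k a = 0"
      "\<And>k. k < m \<Longrightarrow> Z k b = \<beta> k - W k b"
    by (rule kernel_steering[of "\<lambda>k. \<beta> k - W k b"]) (rule that)
  show thesis
    by (rule that[OF solves_add[OF W(1) Z(1)]]) (use W(2) Z(2,3) in simp_all)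
qed

text \<open>With \<open>L_max W = g\<close>, the hypothesis and the Lagrange identity make
  \<open>p = f - W\<close> orthogonal to the range of \<open>L_min\<close>. The kernel correction
  puts \<open>r = p - \<nu>\<close> into that range, where it is orthogonal to itself, and
  \<open>f = W + \<nu>\<close> remains.\<close>

theorem Lmin_adjoint_subset_Lmax:
  assumes f: "f \<in> L2 a b" and g: "g \<in> L2 a b"
    and adj: "\<And>u v. (u, v) \<in> Lmin_graph a b m Q \<Longrightarrow> L2_inner a b v f = L2_inner a b u g"
  shows "(f, g) \<in> Lmax_graph a b m Q"
proof -
  let ?c = "inverse (\<i> ^ m)"
  obtain W where W: "solves W (\<lambda>x. ?c * g x)"
    by (rule solves_exists[OF L2_cmult[OF g, of ?c], where \<alpha> = "\<lambda>k. 0"]) (rule that)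
  have rW: "realizes (W 0) g W (\<lambda>x. ?c * g x)"
    using realizes_self[OF W] unfolding i_pow_inverse .
  define p where "p = (\<lambda>x. f x - W 0 x)"
  have W0: "W 0 \<in> L2 a b" by (rule solves_L2[OF W m_pos])
  have p: "p \<in> L2 a b" unfolding p_def by (rule L2_diff[OF f W0])
  obtain Z where Z: "solves Z (\<lambda>x. ?c * p x)" "\<And>k. k < m \<Longrightarrow> Z k a = 0"
    by (rule solves_exists[OF L2_cmult[OF p, of ?c], where \<alpha> = "\<lambda>k. 0"]) (rule that)
  obtain \<nu> X where \<nu>: "solves \<nu> (\<lambda>x. 0)" and X: "solves X (\<lambda>x. ?c * \<nu> 0 x)" "\<And>k. k < m \<Longrightarrow> X k a = 0"
      "\<And>k. k < m \<Longrightarrow> X k b = Z k b"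
    by (rule kernel_steering[of "\<lambda>k. Z k b"]) (rule that)
  define r where "r = (\<lambda>x. p x - \<nu> 0 x)"
  define Y where "Y = (\<lambda>k x. Z k x - X k x)"
  have \<nu>0: "\<nu> 0 \<in> L2 a b" by (rule solves_L2[OF \<nu> m_pos])
  have r: "r \<in> L2 a b" unfolding r_def by (rule L2_diff[OF p \<nu>0])
  have "solves Y (\<lambda>x. ?c * p x - ?c * \<nu> 0 x)" unfolding Y_def by (rule solves_diff[OF Z(1) X(1)])
  then have Y: "solves Y (\<lambda>x. ?c * r x)" by (simp add: r_def right_diff_distrib)
  have rY: "realizes (Y 0) r Y (\<lambda>x. ?c * r x)"
    using realizes_self[OF Y] unfolding i_pow_inverse .
  have Y0: "Y k a = 0" "Y k b = 0" if "k < m" for k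
    using Z(2)[OF that] X(2,3)[OF that] by (simp_all add: Y_def)
  have "L2_inner a b r f = L2_inner a b (Y 0) g"
    by (rule adj) (use rY Y0 in \<open>auto simp: Lmin_graph_iff\<close>)
  moreover have "L2_inner a b r (W 0) - L2_inner a b (Y 0) g = 0"
    unfolding realizes_Lagrange[OF rY rW] using Y0 by (simp add: bform_zero_left)
  ultimately have rp: "L2_inner a b r p = 0"
    unfolding p_def by (simp add: L2_inner_diff_right[OF f W0 r])
  have "L2_inner a b r (\<nu> 0) - L2_inner a b (Y 0) (\<lambda>x. \<i> ^ m * 0) = 0"
    unfolding realizes_Lagrange[OF rY realizes_self[OF \<nu>]] using Y0 by (simp add: bform_zero_left)
  then have r\<nu>: "L2_inner a b r (\<nu> 0) = 0" by (simp add: L2_inner_def)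
  have "L2_inner a b r r = L2_inner a b r p - L2_inner a b r (\<nu> 0)"
    using L2_inner_diff_right[OF p \<nu>0 r] by (simp add: r_def)
  then have "L2_nsq a b r = 0" using rp r\<nu> by (simp add: L2_nsq_inner)
  then have "ae_on a b r (\<lambda>x. 0)" by (rule L2_nsq_eq_0D[OF r])
  then have fW: "ae_on a b f (\<lambda>x. W 0 x + \<nu> 0 x)"
    unfolding ae_on_def r_def p_def by eventually_elim (simp add: algebra_simps)
  have "solves (\<lambda>k x. W k x + \<nu> k x) (\<lambda>x. ?c * g x)"
    using solves_add[OF W \<nu>] by simp
  then have "realizes f g (\<lambda>k x. W k x + \<nu> k x) (\<lambda>x. ?c * g x)"
    unfolding realizes_def i_pow_inverse using fW by (simp add: ae_on_refl)
  then show ?thesis by (auto simp: Lmax_graph_iff)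
qed

text \<open>If \<open>p\<close> is orthogonal to the domain, then \<open>(0, p)\<close> satisfies
  the adjoint relation and lies in the graph of \<open>L_max\<close>; this graph is single-valued,
  so \<open>p\<close> vanishes almost everywhere.\<close>

theorem Lmin_densely_defined: "densely_defined a b (Lmin_graph a b m Q)"
  unfolding densely_defined_def
proof (intro ballI allI impI)
  fix f \<epsilon> assume f: "f \<in> L2 a b" and \<epsilon>: "\<epsilon> > (0::real)"
  define V where "V = {u. \<exists>v. (u, v) \<in> Lmin_graph a b m Q}"
  have VI: "u \<in> V" if "realizes u v Y h" "\<forall>k<m. Y k a = 0 \<and> Y k b = 0" for u v Y h
    unfolding V_def using that Lmin_graph_iff by blast
  have VE: "\<exists>v Y h. realizes u v Y h \<and> (\<forall>k<m. Y k a = 0 \<and> Y k b = 0)" if "u \<in> V" for u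
    using that unfolding V_def Lmin_graph_iff by blast
  have zeroR: "realizes (\<lambda>x. 0) (\<lambda>x. 0) (\<lambda>k x. 0) (\<lambda>x. 0)"
    using realizes_self[OF solves_zero] by simp
  have zero: "(\<lambda>x. 0) \<in> V" by (rule VI[OF zeroR]) simp
  have lin: "(\<lambda>x. u x + c * w x) \<in> V" if u: "u \<in> V" and w: "w \<in> V" for u w c
  proof -
    obtain v Y h where 1: "realizes u v Y h" "\<forall>k<m. Y k a = 0 \<and> Y k b = 0" using VE[OF u] by (elim exE conjE)
    obtain v' Y' h' where 2: "realizes w v' Y' h'" "\<forall>k<m. Y' k a = 0 \<and> Y' k b = 0" using VE[OF w] by (elim exE conjE)
    show ?thesis by (rule VI[OF realizes_lincomb[OF 1(1) 2(1)]]) (use 1(2) 2(2) in simp)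
  qed
  have "\<exists>u\<in>V. L2_nsq a b (\<lambda>x. f x - u x) < \<epsilon>"
  proof (rule L2_dense_if_orthogonal_trivial[OF _ zero _ _ _ f \<epsilon>])
    show "V \<subseteq> L2 a b"
    proof
      fix u assume "u \<in> V"
      from VE[OF this] obtain v Y h where "realizes u v Y h" by (elim exE conjE)
      then show "u \<in> L2 a b" by (rule realizesD)
    qed
    show "(\<lambda>x. u x + v x) \<in> V" if "u \<in> V" "v \<in> V" for u v using lin[OF that, of 1] by simp
    show "(\<lambda>x. c * u x) \<in> V" if "u \<in> V" for c u using lin[OF zero that, of c] by simp
    fix p assume p: "p \<in> L2 a b" and orth: "\<And>u. u \<in> V \<Longrightarrow> L2_inner a b p u = 0"
    have "((\<lambda>x. 0), p) \<in> Lmax_graph a b m Q"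
    proof (rule Lmin_adjoint_subset_Lmax[OF L2_zero p])
      fix u v assume "(u, v) \<in> Lmin_graph a b m Q"
      then have "u \<in> V" by (auto simp: V_def)
      then have "L2_inner a b u p = 0" using orth L2_inner_cnj[of a b p u] by simp
      then show "L2_inner a b v (\<lambda>x. 0) = L2_inner a b u p" by (simp add: L2_inner_def)
    qed
    then obtain Y h where "realizes (\<lambda>x. 0) p Y h" by (auto simp: Lmax_graph_iff)
    from realizes_unique(2)[OF this zeroR ae_on_refl] show "ae_on a b p (\<lambda>x. 0)" .
  qed
  then obtain u where "u \<in> V" "L2_nsq a b (\<lambda>x. f x - u x) < \<epsilon>" by blast
  then show "\<exists>u v. (u, v) \<in> Lmin_graph a b m Q \<and> (LINT x|lebesgue_on {a..b}. (cmod (f x - u x))\<^sup>2) < \<epsilon>"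
    unfolding V_def L2_nsq_def by blast
qed

end

section \<open>Extension of partial contractions\<close>

text \<open>Vectors are functions on all of \<open>nat\<close>, of which only the entries below
  \<open>m\<close> are seen; hence \<open>cinner m v v = 0\<close> gives zeros only there, and
  equalities obtained from it are restricted to such indices.\<close>

definition cinner :: "nat \<Rightarrow> (nat \<Rightarrow> complex) \<Rightarrow> (nat \<Rightarrow> complex) \<Rightarrow> complex" where
  "cinner m v w = (\<Sum>i<m. v i * cnj (w i))"

definition csubspace :: "(nat \<Rightarrow> complex) set \<Rightarrow> bool" where
  "csubspace D \<longleftrightarrow> (\<lambda>i. 0) \<in> D \<and> (\<forall>v\<in>D. \<forall>w\<in>D. \<forall>c. (\<lambda>i. v i + c * w i) \<in> D)"

lemma cinner_add_left: "cinner m (\<lambda>i. v i + w i) u = cinner m v u + cinner m w u"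
  by (simp add: cinner_def distrib_right sum.distrib)

lemma cinner_diff_left: "cinner m (\<lambda>i. v i - w i) u = cinner m v u - cinner m w u"
  by (simp add: cinner_def left_diff_distrib sum_subtractf)

lemma cinner_cmult_left: "cinner m (\<lambda>i. c * v i) u = c * cinner m v u"
  by (simp add: cinner_def sum_distrib_left mult.assoc)

lemma cinner_sum_left: "cinner m (\<lambda>i. \<Sum>j\<in>J. c j * v j i) u = (\<Sum>j\<in>J. c j * cinner m (v j) u)"
proof -
  have "cinner m (\<lambda>i. \<Sum>j\<in>J. c j * v j i) u = (\<Sum>i<m. \<Sum>j\<in>J. c j * v j i * cnj (u i))"
    by (simp add: cinner_def sum_distrib_right)
  also have "\<dots> = (\<Sum>j\<in>J. \<Sum>i<m. c j * v j i * cnj (u i))" by (rule sum.swap)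
  finally show ?thesis by (simp add: cinner_def sum_distrib_left mult.assoc)
qed

lemma cinner_cnj: "cnj (cinner m v w) = cinner m w v"
  by (simp add: cinner_def mult.commute)

lemma cinner_self: "cinner m v v = complex_of_real (\<Sum>i<m. (cmod (v i))\<^sup>2)"
  unfolding cinner_def of_real_sum complex_norm_square ..

lemma cinner_self_eq_0_iff: "cinner m v v = 0 \<longleftrightarrow> (\<forall>i<m. v i = 0)"
  unfolding cinner_self of_real_eq_0_iff by (subst sum_nonneg_eq_0_iff) auto

lemma cinner_Pythagoras:
  assumes "cinner m v w = 0"
  shows "(\<Sum>i<m. (cmod (v i + w i))\<^sup>2) = (\<Sum>i<m. (cmod (v i))\<^sup>2) + (\<Sum>i<m. (cmod (w i))\<^sup>2)"
proof -
  have wv: "cinner m w v = 0" using assms cinner_cnj[of m v w] by simp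
  have r: "cinner m u (\<lambda>i. v i + w i) = cinner m u v + cinner m u w" for u
    by (simp add: cinner_def distrib_left sum.distrib)
  have "cinner m (\<lambda>i. v i + w i) (\<lambda>i. v i + w i) = cinner m v v + cinner m w w"
    by (simp add: cinner_add_left r assms wv)
  then show ?thesis unfolding cinner_self of_real_add[symmetric] of_real_eq_iff .
qed

lemma csubspace_lincomb:
  assumes "csubspace D" "v \<in> D" "w \<in> D"
  shows "(\<lambda>i. v i + c * w i) \<in> D"
  by (rule spec[OF bspec[OF bspec[OF conjunct2[OF assms(1)[unfolded csubspace_def]] assms(2)] assms(3)]])

lemma csubspace_sum:
  assumes D: "csubspace D" and v: "\<And>j. j \<in> J \<Longrightarrow> v j \<in> D"
  shows "(\<lambda>i. \<Sum>j\<in>J. c j * v j i) \<in> D"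
  using v
proof (induction J rule: infinite_finite_induct)
  case (insert x F)
  then have "(\<lambda>i. (\<Sum>j\<in>F. c j * v j i) + c x * v x i) \<in> D"
    using D by (simp add: csubspace_def)
  then show ?case using insert by (simp add: add.commute)
qed (use D in \<open>simp_all add: csubspace_def\<close>)

section \<open>Orthonormal systems and orthogonal projection\<close>

definition orthonormal :: "nat \<Rightarrow> (nat \<Rightarrow> nat \<Rightarrow> complex) \<Rightarrow> nat \<Rightarrow> bool" where
  "orthonormal m e r \<longleftrightarrow> (\<forall>i<r. \<forall>j<r. cinner m (e i) (e j) = (if i = j then 1 else 0))"

lemma orthonormal_residual:
  assumes e: "orthonormal m e r" and k: "k < r"
  shows "cinner m (\<lambda>i. v i - (\<Sum>j<r. cinner m v (e j) * e j i)) (e k) = 0"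
proof -
  have "(\<Sum>j<r. cinner m v (e j) * cinner m (e j) (e k)) = (\<Sum>j<r. if j = k then cinner m v (e k) else 0)"
    using e k by (intro sum.cong) (auto simp: orthonormal_def)
  also have "\<dots> = cinner m v (e k)" using k by simp
  finally show ?thesis by (simp add: cinner_diff_left cinner_sum_left)
qed

lemma orthonormal_Bessel:
  assumes e: "orthonormal m e r"
  shows "(\<Sum>k<r. (cmod (cinner m v (e k)))\<^sup>2) \<le> (\<Sum>i<m. (cmod (v i))\<^sup>2)"
proof -
  let ?p = "\<lambda>i. \<Sum>j<r. cinner m v (e j) * e j i"
  let ?q = "\<lambda>i. v i - ?p i"
  have "cinner m ?p ?q = (\<Sum>j<r. cinner m v (e j) * cinner m (e j) ?q)" by (rule cinner_sum_left)
  also have "\<dots> = 0"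
  proof (intro sum.neutral ballI)
    fix j assume "j \<in> {..<r}"
    then have "cinner m ?q (e j) = 0" using orthonormal_residual[OF e] by simp
    then have "cinner m (e j) ?q = 0" using cinner_cnj[of m ?q "e j"] by simp
    then show "cinner m v (e j) * cinner m (e j) ?q = 0" by simp
  qed
  finally have pq: "cinner m ?p ?q = 0" .
  have "cinner m ?p ?p = (\<Sum>j<r. cinner m v (e j) * cinner m (e j) ?p)" by (rule cinner_sum_left)
  also have "\<dots> = (\<Sum>j<r. cinner m v (e j) * cnj (cinner m v (e j)))"
  proof (rule sum.cong)
    fix j assume "j \<in> {..<r}"
    then have "cinner m ?q (e j) = 0" using orthonormal_residual[OF e] by simp
    then have "cinner m ?p (e j) = cinner m v (e j)" by (simp add: cinner_diff_left)
    then have "cinner m (e j) ?p = cnj (cinner m v (e j))" using cinner_cnj[of m ?p "e j"] by simp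
    then show "cinner m v (e j) * cinner m (e j) ?p = cinner m v (e j) * cnj (cinner m v (e j))" by simp
  qed simp
  also have "\<dots> = complex_of_real (\<Sum>k<r. (cmod (cinner m v (e k)))\<^sup>2)"
    unfolding of_real_sum complex_norm_square ..
  finally have "(\<Sum>i<m. (cmod (?p i))\<^sup>2) = (\<Sum>k<r. (cmod (cinner m v (e k)))\<^sup>2)"
    unfolding cinner_self of_real_eq_iff .
  moreover have "(\<Sum>i<m. (cmod (?p i + ?q i))\<^sup>2) = (\<Sum>i<m. (cmod (?p i))\<^sup>2) + (\<Sum>i<m. (cmod (?q i))\<^sup>2)"
    by (rule cinner_Pythagoras[OF pq])
  moreover have "0 \<le> (\<Sum>i<m. (cmod (?q i))\<^sup>2)" by (intro sum_nonneg) simp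
  ultimately show ?thesis by simp
qed

text \<open>Bessel's inequality for each of the \<open>m\<close> unit vectors, summed over them,
  bounds the sum of the squared norms of all \<open>e k\<close>, which is \<open>r\<close>.\<close>

lemma orthonormal_card_le:
  assumes e: "orthonormal m e r"
  shows "r \<le> m"
proof -
  have "real r = (\<Sum>k<r. \<Sum>i<m. (cmod (e k i))\<^sup>2)"
  proof -
    have "(\<Sum>i<m. (cmod (e k i))\<^sup>2) = 1" if "k < r" for k
      using e that cinner_self[of m "e k"] unfolding orthonormal_def by (simp del: of_real_sum)
    then show ?thesis by simp
  qed
  also have "\<dots> = (\<Sum>i<m. \<Sum>k<r. (cmod (e k i))\<^sup>2)" by (rule sum.swap)
  also have "\<dots> \<le> (\<Sum>i<m. 1)"
  proof (rule sum_mono)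
    fix i assume i: "i \<in> {..<m}"
    let ?v = "\<lambda>j. if j = i then 1 else (0::complex)"
    have "cinner m ?v (e k) = cnj (e k i)" for k
    proof -
      have "cinner m ?v (e k) = (\<Sum>j<m. if j = i then cnj (e k i) else 0)"
        unfolding cinner_def by (intro sum.cong) auto
      then show ?thesis using i by simp
    qed
    then have "(\<Sum>k<r. (cmod (e k i))\<^sup>2) = (\<Sum>k<r. (cmod (cinner m ?v (e k)))\<^sup>2)" by simp
    also have "\<dots> \<le> (\<Sum>j<m. (cmod (?v j))\<^sup>2)" by (rule orthonormal_Bessel[OF e])
    also have "\<dots> = (\<Sum>j<m. if j = i then 1 else 0)" by (intro sum.cong) auto
    also have "\<dots> = 1" using i by simp
    finally show "(\<Sum>k<r. (cmod (e k i))\<^sup>2) \<le> 1" .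
  qed
  finally show ?thesis by simp
qed

text \<open>Orthonormal systems in \<open>D\<close> have bounded size, so a largest one exists. A
  nonzero residual of a vector of \<open>D\<close> could be normalised and added to it; hence the
  system already represents all of \<open>D\<close>.\<close>

lemma csubspace_projection:
  assumes D: "csubspace D"
  obtains p where "p \<in> D" "\<And>w. w \<in> D \<Longrightarrow> cinner m (\<lambda>i. v i - p i) w = 0"
proof -
  define R where "R = {r. \<exists>e. (\<forall>i<r. e i \<in> D) \<and> orthonormal m e r}"
  have "0 \<in> R" by (simp add: R_def orthonormal_def)
  have "R \<subseteq> {..m}" using orthonormal_card_le by (auto simp: R_def)
  then have "finite R" by (rule finite_subset) simp
  define r where "r = Max R"
  have "r \<in> R" unfolding r_def using \<open>finite R\<close> \<open>0 \<in> R\<close> by (intro Max_in) auto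
  then obtain e where eD: "\<And>i. i < r \<Longrightarrow> e i \<in> D" and e: "orthonormal m e r" by (auto simp: R_def)
  have "Suc r \<notin> R" using Max_ge[OF \<open>finite R\<close>, of "Suc r"] by (auto simp: r_def)
  define proj where "proj = (\<lambda>v i. \<Sum>j<r. cinner m v (e j) * e j i)"
  have projD: "proj v \<in> D" for v unfolding proj_def using eD by (intro csubspace_sum D) auto
  have res: "cinner m (\<lambda>i. v i - proj v i) (e k) = 0" if "k < r" for v k
    unfolding proj_def by (rule orthonormal_residual[OF e that])
  have inD: "\<forall>i<m. w i - proj w i = 0" if w: "w \<in> D" for w
  proof (rule ccontr)
    assume ne: "\<not> ?thesis"
    let ?q = "\<lambda>i. w i - proj w i"
    define N where "N = (\<Sum>i<m. (cmod (?q i))\<^sup>2)"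
    have "cinner m ?q ?q \<noteq> 0" using ne by (simp add: cinner_self_eq_0_iff)
    then have "N \<noteq> 0" unfolding cinner_self N_def of_real_eq_0_iff .
    moreover have "0 \<le> N" unfolding N_def by (intro sum_nonneg) simp
    ultimately have "0 < N" by simp
    have "(\<lambda>i. w i + (-1) * proj w i) \<in> D" by (rule csubspace_lincomb[OF D w projD])
    then have qD: "?q \<in> D" by simp
    define s where "s = complex_of_real (1 / sqrt N)"
    have "(\<lambda>i. 0) \<in> D" using D by (simp add: csubspace_def)
    from csubspace_lincomb[OF D this qD, of s] have "(\<lambda>i. 0 + s * ?q i) \<in> D" .
    then have sq: "(\<lambda>i. s * ?q i) \<in> D" by simp
    define e' where "e' = (\<lambda>k. if k < r then e k else (\<lambda>i. s * ?q i))"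
    have "orthonormal m e' (Suc r)"
      unfolding orthonormal_def
    proof (intro allI impI)
      fix i j assume "i < Suc r" "j < Suc r"
      have new_old: "cinner m (\<lambda>i. s * ?q i) (e k) = 0" if "k < r" for k
        by (simp add: cinner_cmult_left res[OF that])
      have old_new: "cinner m (e k) (\<lambda>i. s * ?q i) = 0" if "k < r" for k
        using new_old[OF that] cinner_cnj[of m "\<lambda>i. s * ?q i" "e k"] by simp
      have new_new: "cinner m (\<lambda>i. s * ?q i) (\<lambda>i. s * ?q i) = 1"
      proof -
        have "(\<Sum>i<m. (cmod (s * ?q i))\<^sup>2) = (cmod s)\<^sup>2 * N"
          by (simp add: N_def norm_mult power_mult_distrib sum_distrib_left)
        also have "\<dots> = 1" using \<open>0 < N\<close> by (simp add: s_def norm_divide power_divide)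
        finally show ?thesis unfolding cinner_self by simp
      qed
      show "cinner m (e' i) (e' j) = (if i = j then 1 else 0)"
        using \<open>i < Suc r\<close> \<open>j < Suc r\<close> e new_old old_new new_new
        by (cases "i < r"; cases "j < r") (auto simp: e'_def orthonormal_def less_Suc_eq)
    qed
    moreover have "\<forall>i<Suc r. e' i \<in> D" using eD sq by (simp add: e'_def)
    ultimately have "Suc r \<in> R" unfolding R_def by blast
    with \<open>Suc r \<notin> R\<close> show False by simp
  qed
  show thesis
  proof
    show "proj v \<in> D" by (rule projD)
    fix w assume w: "w \<in> D"
    let ?q = "\<lambda>i. v i - proj v i"
    have "cinner m w ?q = cinner m (proj w) ?q"
      using inD[OF w] unfolding cinner_def by (intro sum.cong) auto
    also have "\<dots> = (\<Sum>j<r. cinner m w (e j) * cinner m (e j) ?q)"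
      by (subst proj_def[THEN fun_cong, of w]) (rule cinner_sum_left)
    also have "\<dots> = 0"
    proof (intro sum.neutral ballI)
      fix j assume "j \<in> {..<r}"
      then have "cinner m ?q (e j) = 0" using res by simp
      then have "cinner m (e j) ?q = 0" using cinner_cnj[of m ?q "e j"] by simp
      then show "cinner m w (e j) * cinner m (e j) ?q = 0" by simp
    qed
    finally show "cinner m ?q w = 0" using cinner_cnj[of m w ?q] by simp
  qed
qed

text \<open>A pair in \<open>S\<close> consists of output and input, in this order. The norm bound
  on differences makes \<open>S\<close> a function on the space \<open>D\<close> of inputs, and
  \<open>K\<close> is that function after the orthogonal projection onto \<open>D\<close>, which
  does not increase norms.\<close>

lemma contraction_extension:
  fixes S :: "((nat \<Rightarrow> complex) \<times> (nat \<Rightarrow> complex)) set"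
  assumes zero: "((\<lambda>i. 0), (\<lambda>i. 0)) \<in> S"
    and lin: "\<And>p q p' q' c. (p, q) \<in> S \<Longrightarrow> (p', q') \<in> S \<Longrightarrow> ((\<lambda>i. p i + c * p' i), (\<lambda>i. q i + c * q' i)) \<in> S"
    and contr: "\<And>p q. (p, q) \<in> S \<Longrightarrow> (\<Sum>i<m. (cmod (p i))\<^sup>2) \<le> (\<Sum>i<m. (cmod (q i))\<^sup>2)"
  obtains K where "contraction m K" "\<And>p q i. (p, q) \<in> S \<Longrightarrow> i < m \<Longrightarrow> mv m K q i = p i"
proof -
  define D where "D = snd ` S"
  have D: "csubspace D"
    unfolding csubspace_def
  proof (intro conjI ballI allI)
    show "(\<lambda>i. 0) \<in> D" using zero unfolding D_def by force
    fix v w c assume "v \<in> D" "w \<in> D"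
    then obtain p p' where "(p, v) \<in> S" "(p', w) \<in> S" by (auto simp: D_def)
    from lin[OF this, of c] show "(\<lambda>i. v i + c * w i) \<in> D" unfolding D_def by force
  qed
  \<comment> \<open>The projection of the \<open>j\<close>-th unit vector and an output belonging to
    it are chosen together; this output becomes column \<open>j\<close> of \<open>K\<close>.\<close>
  have "\<exists>sp. sp \<in> S \<and> (\<forall>w\<in>D. cinner m (\<lambda>i. (if i = j then 1 else 0) - snd sp i) w = 0)" for j
  proof -
    obtain p where "p \<in> D" and p: "\<And>w. w \<in> D \<Longrightarrow> cinner m (\<lambda>i. (if i = j then 1 else 0) - p i) w = 0"
      by (rule csubspace_projection[OF D]) (rule that)
    then obtain s where "(s, p) \<in> S" by (auto simp: D_def)
    with p show ?thesis by (intro exI[of _ "(s, p)"]) simp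
  qed
  then have "\<exists>f. \<forall>j. f j \<in> S \<and> (\<forall>w\<in>D. cinner m (\<lambda>i. (if i = j then 1 else 0) - snd (f j) i) w = 0)"
    by (intro choice allI)
  then obtain f where f: "\<forall>j. f j \<in> S \<and> (\<forall>w\<in>D. cinner m (\<lambda>i. (if i = j then 1 else 0) - snd (f j) i) w = 0)"
    by (elim exE)
  define s p where "s = (\<lambda>j. fst (f j))" and "p = (\<lambda>j. snd (f j))"
  have sp: "(s j, p j) \<in> S" for j using f by (simp add: s_def p_def)
  have p: "cinner m (\<lambda>i. (if i = j then 1 else 0) - p j i) w = 0" if "w \<in> D" for j w
    using f that by (simp add: p_def)
  define K where "K = (\<lambda>i j. if i < m \<and> j < m then s j i else (0::complex))"
  have KV: "\<exists>x q. (x, q) \<in> S \<and> (\<forall>i<m. mv m K v i = x i) \<and> (\<forall>w\<in>D. cinner m (\<lambda>i. v i - q i) w = 0)" for v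
  proof -
    have comb: "((\<lambda>i. \<Sum>j<n. v j * s j i), (\<lambda>i. \<Sum>j<n. v j * p j i)) \<in> S" for n
    proof (induction n)
      case (Suc n)
      from lin[OF Suc sp[of n], of "v n"] show ?case by simp
    qed (use zero in simp)
    have 1: "\<forall>i<m. mv m K v i = (\<Sum>j<m. v j * s j i)"
      by (simp add: mv_def K_def mult.commute)
    have "cinner m (\<lambda>i. v i - (\<Sum>j<m. v j * p j i)) w = 0" if w: "w \<in> D" for w
    proof -
      have "cinner m (\<lambda>i. v i - (\<Sum>j<m. v j * p j i)) w
          = cinner m (\<lambda>i. \<Sum>j<m. v j * ((if i = j then 1 else 0) - p j i)) w"
        unfolding cinner_def
      proof (rule sum.cong)
        fix i assume "i \<in> {..<m}"
        then have "(\<Sum>j<m. v j * ((if i = j then 1 else 0) - p j i)) = v i - (\<Sum>j<m. v j * p j i)"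
          by (simp add: right_diff_distrib sum_subtractf if_distrib[of "(*) _"] cong: if_cong)
        then show "(v i - (\<Sum>j<m. v j * p j i)) * cnj (w i)
            = (\<Sum>j<m. v j * ((if i = j then 1 else 0) - p j i)) * cnj (w i)" by simp
      qed simp
      also have "\<dots> = 0" using p[OF w] by (simp add: cinner_sum_left)
      finally show ?thesis .
    qed
    with comb[of m] 1 show ?thesis by (intro exI conjI ballI)
  qed
  have contrK: "contraction m K"
    unfolding contraction_def
  proof (intro conjI allI)
    show "K \<in> cmat m" by (auto simp: cmat_def K_def)
    fix v
    obtain x q where xq: "(x, q) \<in> S" "\<And>i. i < m \<Longrightarrow> mv m K v i = x i" "\<And>w. w \<in> D \<Longrightarrow> cinner m (\<lambda>i. v i - q i) w = 0"
      using KV[of v] by (elim exE conjE) (rule that, assumption, drule spec, erule (1) mp, erule (1) bspec)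
    have "q \<in> D" using xq(1) by (force simp: D_def)
    have "(\<Sum>i<m. (cmod (mv m K v i))\<^sup>2) = (\<Sum>i<m. (cmod (x i))\<^sup>2)" using xq(2) by simp
    also have "\<dots> \<le> (\<Sum>i<m. (cmod (q i))\<^sup>2)" by (rule contr[OF xq(1)])
    also have "\<dots> \<le> (\<Sum>i<m. (cmod (v i - q i))\<^sup>2) + (\<Sum>i<m. (cmod (q i))\<^sup>2)"
      using sum_nonneg[of "{..<m}" "\<lambda>i. (cmod (v i - q i))\<^sup>2"] by simp
    also have "\<dots> = (\<Sum>i<m. (cmod (v i))\<^sup>2)"
      using cinner_Pythagoras[OF xq(3)[OF \<open>q \<in> D\<close>]] by simp
    finally show "vnorm m (mv m K v) \<le> vnorm m v" by (simp add: vnorm_def)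
  qed
  show thesis
  proof (rule that[OF contrK])
    fix p0 q0 i assume S0: "(p0, q0) \<in> S" and i: "i < m"
    obtain x q where xq: "(x, q) \<in> S" "\<And>i. i < m \<Longrightarrow> mv m K q0 i = x i" "\<And>w. w \<in> D \<Longrightarrow> cinner m (\<lambda>i. q0 i - q i) w = 0"
      using KV[of q0] by (elim exE conjE) (rule that, assumption, drule spec, erule (1) mp, erule (1) bspec)
    from lin[OF S0 xq(1), of "-1"] have diff: "((\<lambda>i. p0 i - x i), (\<lambda>i. q0 i - q i)) \<in> S" by simp
    \<comment> \<open>\<open>q0 - q\<close> lies in \<open>D\<close> and is orthogonal to
      \<open>D\<close>, so it vanishes below \<open>m\<close>; the norm bound then makes
      \<open>p0 - x\<close> vanish there as well.\<close>
    then have "(\<lambda>i. q0 i - q i) \<in> D" by (force simp: D_def)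
    from xq(3)[OF this] have "\<forall>i<m. q0 i - q i = 0" by (simp only: cinner_self_eq_0_iff)
    then have "(\<Sum>i<m. (cmod (p0 i - x i))\<^sup>2) \<le> 0" using contr[OF diff] by simp
    moreover have "(cmod (p0 i - x i))\<^sup>2 \<le> (\<Sum>i<m. (cmod (p0 i - x i))\<^sup>2)"
      using i by (intro member_le_sum) auto
    ultimately have "(cmod (p0 i - x i))\<^sup>2 \<le> 0" by linarith
    then have "p0 i = x i" by simp
    then show "mv m K q0 i = p0 i" using xq(2)[OF i] by simp
  qed
qed

section \<open>Boundary values\<close>

lemma sum_lessThan_halves:
  fixes F :: "nat \<Rightarrow> complex"
  assumes n: "n = m div 2"
  shows "(\<Sum>j<m. F j) = (\<Sum>j<n. F j) + (\<Sum>j<n. F (n + j)) + (if odd m then F (2 * n) else 0)"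
proof -
  have "(\<Sum>j<k + l. F j) = (\<Sum>j<k. F j) + (\<Sum>j<l. F (k + j))" for k l :: nat
    by (induction l) (simp_all add: add.assoc)
  from this[of n n] have nn: "(\<Sum>j<2 * n. F j) = (\<Sum>j<n. F j) + (\<Sum>j<n. F (n + j))"
    by (simp add: mult_2)
  show ?thesis
  proof (cases "odd m")
    case True
    then have "m = Suc (2 * n)" using n by presburger
    then have "(\<Sum>j<m. F j) = (\<Sum>j<2 * n. F j) + F (2 * n)" by (simp only: sum.lessThan_Suc)
    then show ?thesis using True nn by simp
  next
    case False
    then have "m = 2 * n" using n by presburger
    then have "(\<Sum>j<m. F j) = (\<Sum>j<2 * n. F j)" by (simp only:)
    then show ?thesis using False nn by simp
  qed
qed

text \<open>The pairing of \<open>j\<close> with \<open>m - 1 - j\<close> is that of the boundary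
  form; for odd \<open>m\<close> the index \<open>n\<close> is its own partner.\<close>

lemma sum_lessThan_reflected_halves:
  fixes F :: "nat \<Rightarrow> complex"
  assumes n: "n = m div 2"
  shows "(\<Sum>j<m. F j) = (\<Sum>j<n. F j) + (\<Sum>j<n. F (m - 1 - j)) + (if odd m then F n else 0)"
proof -
  have nm: "n \<le> m" using n by simp
  have refl: "(\<Sum>j<n. F (m - 1 - j)) = (\<Sum>j\<in>{m - n..<m}. F j)"
    by (rule sum.reindex_bij_witness[of _ "\<lambda>j. m - 1 - j" "\<lambda>j. m - 1 - j"]) (use nm in auto)
  show ?thesis
  proof (cases "odd m")
    case True
    then have mm: "m - n = Suc n" "n < m" using n by presburger+
    have "{..<m} = {..<n} \<union> {n} \<union> {Suc n..<m}" using mm by auto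
    moreover have "{..<n} \<inter> {n} = {}" "({..<n} \<union> {n}) \<inter> {Suc n..<m} = {}" by auto
    ultimately have "(\<Sum>j<m. F j) = (\<Sum>j<n. F j) + F n + (\<Sum>j\<in>{Suc n..<m}. F j)"
      by (simp only: sum.union_disjoint finite_lessThan finite.intros finite_Un finite_atLeastLessThan) simp
    then show ?thesis using True unfolding refl mm by simp
  next
    case False
    then have mm: "m - n = n" using n by presburger
    have "{..<m} = {..<n} \<union> {n..<m}" using nm by auto
    moreover have "{..<n} \<inter> {n..<m} = {}" by auto
    ultimately have "(\<Sum>j<m. F j) = (\<Sum>j<n. F j) + (\<Sum>j\<in>{n..<m}. F j)"
      by (simp only: sum.union_disjoint finite_lessThan finite_atLeastLessThan)
    then show ?thesis using False unfolding refl mm by simp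
  qed
qed

lemma mv_lincomb: "i < m \<Longrightarrow> mv m K (\<lambda>j. v j + c * w j) i = mv m K v i + c * mv m K w i"
  by (simp add: mv_def distrib_left sum.distrib sum_distrib_left mult.left_commute)

lemma mv_cong: "(\<And>j. j < m \<Longrightarrow> v j = w j) \<Longrightarrow> mv m K v = mv m K w"
  unfolding mv_def by (intro ext if_cong sum.cong refl) simp

lemma cmod_plus_minus_i_squares:
  "(cmod (x + \<i> * y))\<^sup>2 - (cmod (x - \<i> * y))\<^sup>2 = 4 * Im (x * cnj y)"
  unfolding cmod_power2 by (simp add: power2_eq_square algebra_simps)

context quasi_differential
begin

definition nh :: nat where "nh = m div 2"

lemma nh_bounds: "odd m \<Longrightarrow> m = 2 * nh + 1" "even m \<Longrightarrow> m = 2 * nh" "nh < m" "0 < nh" "2 * nh \<le> m"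
  using m3 unfolding nh_def by presburger+

lemma boundary_index_cases:
  assumes "j < m"
  obtains "j < nh" | "nh \<le> j" "j < 2 * nh" | "odd m" "j = 2 * nh"
  using assms nh_bounds(1,2) by (cases "odd m"; cases "j < nh"; cases "j < 2 * nh") auto

text \<open>\<open>Gamma1\<close> as a function of the states at the two endpoints, so that the
  algebra below concerns vectors alone; \<open>bG2\<close> does the same for
  \<open>Gamma2\<close>.\<close>

definition bG1 :: "(nat \<Rightarrow> complex) \<Rightarrow> (nat \<Rightarrow> complex) \<Rightarrow> nat \<Rightarrow> complex" where
  "bG1 A B j = (if j < nh then \<i> ^ m * (-1) ^ (j + 1) * A (m - (j + 1))
      else if j < 2 * nh then \<i> ^ m * (-1) ^ (j - nh) * B (m - (j - nh + 1))
      else if odd m \<and> j = 2 * nh then \<i> ^ m * (B nh + A nh)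
      else 0)"

definition bG2 :: "(nat \<Rightarrow> complex) \<Rightarrow> (nat \<Rightarrow> complex) \<Rightarrow> nat \<Rightarrow> complex" where
  "bG2 A B j = (if j < nh then A j
      else if j < 2 * nh then B (j - nh)
      else if odd m \<and> j = 2 * nh
        then ((-1) ^ nh / 2 + \<i>) * B nh + ((-1) ^ (nh + 1) / 2 + \<i>) * A nh
      else 0)"

lemma Gamma_eq_bG:
  "Gamma1 a b m Q y z = bG1 (\<lambda>k. qd a b m Q y z k a) (\<lambda>k. qd a b m Q y z k b)"
  "Gamma2 a b m Q y z = bG2 (\<lambda>k. qd a b m Q y z k a) (\<lambda>k. qd a b m Q y z k b)"
  by (rule ext, simp only: Gamma1_def bG1_def nh_def Let_def) (rule ext, simp only: Gamma2_def bG2_def nh_def Let_def)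

lemma bG_cong:
  assumes A: "\<And>k. k < m \<Longrightarrow> A k = A' k" and B: "\<And>k. k < m \<Longrightarrow> B k = B' k"
  shows "bG1 A B j = bG1 A' B' j" "bG2 A B j = bG2 A' B' j"
proof -
  have E: "A (m - (j + 1)) = A' (m - (j + 1))" "B (m - (j - nh + 1)) = B' (m - (j - nh + 1))"
      "A nh = A' nh" "B nh = B' nh"
    using m_pos nh_bounds(3) by (auto intro!: A B)
  show "bG1 A B j = bG1 A' B' j"
    unfolding bG1_def by (simp only: E)
  show "bG2 A B j = bG2 A' B' j"
    unfolding bG2_def E using nh_bounds(3,5) A[of j] B[of "j - nh"] by auto
qed

lemma bG_lincomb:
  "bG1 (\<lambda>k. A k + c * A' k) (\<lambda>k. B k + c * B' k) j = bG1 A B j + c * bG1 A' B' j"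
  "bG2 (\<lambda>k. A k + c * A' k) (\<lambda>k. B k + c * B' k) j = bG2 A B j + c * bG2 A' B' j"
  by (simp_all add: bG1_def bG2_def algebra_simps add_divide_distrib diff_divide_distrib)

lemma cnj_i_power: "cnj (\<i> ^ m) = (-1) ^ m * \<i> ^ m"
proof -
  have "cnj (\<i> ^ m) = (-1 * \<i>) ^ m" by simp
  also have "\<dots> = (-1) ^ m * \<i> ^ m" by (rule power_mult_distrib)
  finally show ?thesis .
qed

section \<open>The abstract Green identity and surjectivity of the boundary maps\<close>

text \<open>With \<open>e = (-1) ^ nh\<close> the coefficients are \<gamma>, \<delta> and their
  conjugates. They satisfy \<open>\<gamma> + cnj \<gamma> = e\<close>,
  \<open>\<delta> + cnj \<delta> = - e\<close> and \<open>cnj \<gamma> + \<delta> = 0\<close>, so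
  the mixed terms between the endpoints cancel. The two products are added because
  \<open>\<i> ^ m\<close> is purely imaginary for odd \<open>m\<close>.\<close>

lemma Green_odd_algebra:
  fixes I e a0 b0 a1 b1 :: complex
  shows "I * (b0 + a0) * ((e / 2 - \<i>) * b1 + (- e / 2 - \<i>) * a1) + ((e / 2 + \<i>) * b0 + (- e / 2 + \<i>) * a0) * (I * (b1 + a1))
    = I * (e * (b0 * b1)) - I * (e * (a0 * a1))"
  by (simp add: field_simps)

text \<open>The sum in \<open>bform\<close> is folded at its middle. The sign at index
  \<open>m - 1 - j\<close> is \<open>(-1) ^ m\<close> times \<open>- ((-1) ^ j)\<close>, and
  \<open>(-1) ^ m\<close> is also the factor that conjugation puts on \<open>\<i> ^ m\<close>; thus
  one half gives the pairing of \<open>bG1\<close> with \<open>bG2\<close> and the other the pairing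
  of \<open>bG2\<close> with \<open>bG1\<close>.\<close>

theorem boundary_Green:
  "bform B B' - bform A A' = cinner m (bG1 A B) (bG2 A' B') - cinner m (bG2 A B) (bG1 A' B')"
proof -
  define I where "I = \<i> ^ m"
  define e where "e = (-1 :: complex) ^ nh"
  define s where "s = (-1 :: complex) ^ m"
  have cI: "cnj I = s * I" unfolding I_def s_def by (rule cnj_i_power)
  have ce: "cnj e = e" by (simp add: e_def)
  define S1 where "S1 = (\<lambda>A A'. \<Sum>j<nh. (-1) ^ j * (A (m - 1 - j) * cnj (A' j)) :: complex)"
  define S2 where "S2 = (\<lambda>A A'. \<Sum>j<nh. (-1) ^ j * (A j * cnj (A' (m - 1 - j))) :: complex)"
  have bf: "bform A A' = I * S1 A A' - I * (s * S2 A A') + (if odd m then I * (e * (A nh * cnj (A' nh))) else 0)" for A A'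
  proof -
    have sgn: "(-1 :: complex) ^ (m - 1 - j) = - (s * (-1) ^ j)" if "j < nh" for j
    proof -
      have "even (m - 1 - j) = (\<not> even (m + j))" using that nh_bounds(3) by presburger
      then show ?thesis by (simp add: s_def minus_one_power_iff)
    qed
    have idx: "m - 1 - (m - 1 - j) = j" if "j < nh" for j using that nh_bounds(3) by simp
    have mid: "m - 1 - nh = nh" if "odd m" using nh_bounds(1)[OF that] by simp
    have "(\<Sum>j<m. (-1) ^ j * (A (m - 1 - j) * cnj (A' j))) =
      S1 A A' + (\<Sum>j<nh. (-1) ^ (m - 1 - j) * (A (m - 1 - (m - 1 - j)) * cnj (A' (m - 1 - j))))
      + (if odd m then (-1) ^ nh * (A (m - 1 - nh) * cnj (A' nh)) else 0)"
      unfolding S1_def by (rule sum_lessThan_reflected_halves[OF nh_def])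
    also have "(\<Sum>j<nh. (-1) ^ (m - 1 - j) * (A (m - 1 - (m - 1 - j)) * cnj (A' (m - 1 - j)))) = (\<Sum>j<nh. - s * ((-1) ^ j * (A j * cnj (A' (m - 1 - j)))))"
      by (intro sum.cong refl) (simp only: lessThan_iff sgn idx mult.assoc mult_minus_left)
    also have "\<dots> = - s * S2 A A'" unfolding S2_def by (rule sum_distrib_left[symmetric])
    finally have eq: "(\<Sum>j<m. (-1) ^ j * (A (m - 1 - j) * cnj (A' j)))
      = S1 A A' + - s * S2 A A' + (if odd m then (-1) ^ nh * (A (m - 1 - nh) * cnj (A' nh)) else 0)" .
    show ?thesis
      unfolding bform_def I_def[symmetric] eq e_def[symmetric]
      using mid by (cases "odd m") (simp_all add: algebra_simps)
  qed
  have low: "bG1 A B j = - (I * ((-1) ^ j * A (m - 1 - j)))" "bG2 A B j = A j" if "j < nh" for A B j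
    using that by (simp_all add: bG1_def bG2_def I_def)
  have high: "bG1 A B (nh + j) = I * ((-1) ^ j * B (m - 1 - j))" "bG2 A B (nh + j) = B j" if "j < nh" for A B j
    using that by (simp_all add: bG1_def bG2_def I_def)
  have top: "bG1 A B (2 * nh) = I * (B nh + A nh)" "bG2 A B (2 * nh) = (e / 2 + \<i>) * B nh + (- e / 2 + \<i>) * A nh" if "odd m" for A B
    using that by (simp_all add: bG1_def bG2_def I_def e_def)
  have c12: "cinner m (bG1 A B) (bG2 A' B') = I * S1 B B' - I * S1 A A'
      + (if odd m then I * (B nh + A nh) * ((e / 2 - \<i>) * cnj (B' nh) + (- e / 2 - \<i>) * cnj (A' nh)) else 0)"
  proof -
    have "cinner m (bG1 A B) (bG2 A' B') = (\<Sum>j<nh. bG1 A B j * cnj (bG2 A' B' j)) + (\<Sum>j<nh. bG1 A B (nh + j) * cnj (bG2 A' B' (nh + j)))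
      + (if odd m then bG1 A B (2 * nh) * cnj (bG2 A' B' (2 * nh)) else 0)"
      unfolding cinner_def by (rule sum_lessThan_halves[OF nh_def])
    also have "(\<Sum>j<nh. bG1 A B j * cnj (bG2 A' B' j)) = - (I * S1 A A')"
      unfolding S1_def sum_distrib_left sum_negf[symmetric] by (intro sum.cong) (simp_all add: low mult_ac)
    also have "(\<Sum>j<nh. bG1 A B (nh + j) * cnj (bG2 A' B' (nh + j))) = I * S1 B B'"
      unfolding S1_def sum_distrib_left by (intro sum.cong) (simp_all add: high mult_ac)
    also have "(if odd m then bG1 A B (2 * nh) * cnj (bG2 A' B' (2 * nh)) else 0)
        = (if odd m then I * (B nh + A nh) * ((e / 2 - \<i>) * cnj (B' nh) + (- e / 2 - \<i>) * cnj (A' nh)) else 0)"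
      by (simp add: top ce)
    finally show ?thesis by simp
  qed
  have c21: "cinner m (bG2 A B) (bG1 A' B') = cnj I * S2 B B' - cnj I * S2 A A'
      + (if odd m then ((e / 2 + \<i>) * B nh + (- e / 2 + \<i>) * A nh) * (cnj I * (cnj (B' nh) + cnj (A' nh))) else 0)"
  proof -
    have "cinner m (bG2 A B) (bG1 A' B') = (\<Sum>j<nh. bG2 A B j * cnj (bG1 A' B' j)) + (\<Sum>j<nh. bG2 A B (nh + j) * cnj (bG1 A' B' (nh + j)))
      + (if odd m then bG2 A B (2 * nh) * cnj (bG1 A' B' (2 * nh)) else 0)"
      unfolding cinner_def by (rule sum_lessThan_halves[OF nh_def])
    also have "(\<Sum>j<nh. bG2 A B j * cnj (bG1 A' B' j)) = - (cnj I * S2 A A')"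
      unfolding S2_def sum_distrib_left sum_negf[symmetric] by (intro sum.cong) (simp_all add: low mult_ac)
    also have "(\<Sum>j<nh. bG2 A B (nh + j) * cnj (bG1 A' B' (nh + j))) = cnj I * S2 B B'"
      unfolding S2_def sum_distrib_left by (intro sum.cong) (simp_all add: high mult_ac)
    also have "(if odd m then bG2 A B (2 * nh) * cnj (bG1 A' B' (2 * nh)) else 0)
        = (if odd m then ((e / 2 + \<i>) * B nh + (- e / 2 + \<i>) * A nh) * (cnj I * (cnj (B' nh) + cnj (A' nh))) else 0)"
      by (simp add: top)
    finally show ?thesis by simp
  qed
  show ?thesis
  proof (cases "odd m")
    case True
    then have s: "s = -1" by (simp add: s_def)
    show ?thesis
      unfolding bf c12 c21 cI s
      using True Green_odd_algebra[of I "B nh" "A nh" e "cnj (B' nh)" "cnj (A' nh)"] by (simp add: algebra_simps)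
  next
    case False
    then have s: "s = 1" by (simp add: s_def)
    show ?thesis
      unfolding bf c12 c21 cI s using False by (simp add: algebra_simps)
  qed
qed

text \<open>The lower half of each state is read off from \<open>g2\<close>, the upper half from
  \<open>g1\<close>. For odd \<open>m\<close> the two middle entries solve a two by two system whose
  determinant is, up to sign, \<open>\<gamma> - \<delta> = e\<close>, and \<open>e\<close> is its
  own inverse.\<close>

lemma bG_surjective:
  obtains A B where "\<And>j. j < m \<Longrightarrow> bG1 A B j = g1 j" "\<And>j. j < m \<Longrightarrow> bG2 A B j = g2 j"
proof -
  define I where "I = \<i> ^ m"
  define e where "e = (-1 :: complex) ^ nh"
  have I0: "I \<noteq> 0" by (simp add: I_def)
  have ee: "e * e = 1" by (simp add: e_def flip: power_mult_distrib)
  have sq: "(-1) ^ i * ((-1) ^ i * z) = (z::complex)" for i z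
    by (simp flip: mult.assoc power_mult_distrib)
  \<comment> \<open>\<open>sg\<close> and \<open>tg\<close> are the required values of
    \<open>B nh + A nh\<close> and \<open>\<gamma> * B nh + \<delta> * A nh\<close>; the middle
    entries defined next are Cramer's rule for this system.\<close>
  define sg where "sg = g1 (2 * nh) / I"
  define tg where "tg = g2 (2 * nh)"
  define A where "A = (\<lambda>j. if j < nh then g2 j else if odd m \<and> j = nh then e * ((e / 2 + \<i>) * sg - tg)
     else - ((-1) ^ (m - 1 - j) * g1 (m - 1 - j)) / I)"
  define B where "B = (\<lambda>j. if j < nh then g2 (nh + j) else if odd m \<and> j = nh then e * (tg - (- e / 2 + \<i>) * sg)
     else (-1) ^ (m - 1 - j) * g1 (nh + (m - 1 - j)) / I)"
  have upper: "\<not> m - 1 - j < nh" "\<not> (odd m \<and> m - 1 - j = nh)" "m - 1 - (m - 1 - j) = j" if "j < nh" for j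
  proof -
    show "\<not> m - 1 - j < nh" "m - 1 - (m - 1 - j) = j" using that nh_bounds(3,5) by auto
    show "\<not> (odd m \<and> m - 1 - j = nh)" using that nh_bounds(1) by auto
  qed
  have Aup: "A (m - 1 - j) = - ((-1) ^ j * g1 j) / I" and Bup: "B (m - 1 - j) = (-1) ^ j * g1 (nh + j) / I" if "j < nh" for j
    unfolding A_def B_def by (simp_all only: upper[OF that] if_False)
  show thesis
  proof
    fix j assume j: "j < m"
    show "bG1 A B j = g1 j"
      using j
    proof (cases rule: boundary_index_cases)
      case 1
      then have "bG1 A B j = I * (-1) ^ (j + 1) * A (m - 1 - j)" by (simp add: bG1_def I_def)
      then show ?thesis unfolding Aup[OF 1] using I0 by (simp add: sq mult.assoc)
    next
      case 2
      then have j': "j - nh < nh" "nh + (j - nh) = j" by auto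
      have "bG1 A B j = I * (-1) ^ (j - nh) * B (m - 1 - (j - nh))" using 2 by (simp add: bG1_def I_def)
      then show ?thesis unfolding Bup[OF j'(1)] j'(2) using I0 by (simp add: sq mult.assoc)
    next
      case 3
      then have "bG1 A B j = I * (B nh + A nh)" by (simp add: bG1_def I_def)
      also have "B nh + A nh = e * (e * sg)" using 3 by (simp add: A_def B_def algebra_simps)
      also have "\<dots> = sg" using ee by (simp flip: mult.assoc)
      finally show ?thesis using I0 3 by (simp add: sg_def)
    qed
    show "bG2 A B j = g2 j"
      using j
    proof (cases rule: boundary_index_cases)
      case 1
      then show ?thesis by (simp add: bG2_def A_def)
    next
      case 2
      then have j': "j - nh < nh" "nh + (j - nh) = j" by auto
      have "bG2 A B j = B (j - nh)" using 2 by (simp add: bG2_def)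
      also have "\<dots> = g2 (nh + (j - nh))" unfolding B_def using j'(1) by (simp only: if_True)
      finally show ?thesis unfolding j'(2) .
    next
      case 3
      then have "bG2 A B j = (e / 2 + \<i>) * B nh + (- e / 2 + \<i>) * A nh" by (simp add: bG2_def e_def)
      also have "\<dots> = e * (e * tg)" using 3 by (simp add: A_def B_def field_simps)
      also have "\<dots> = tg" using ee by (simp flip: mult.assoc)
      finally show ?thesis using 3 by (simp add: tg_def)
    qed
  qed
qed


section \<open>The combinations of the boundary maps between which \<open>K\<close> acts\<close>

definition bplus :: "(nat \<Rightarrow> complex) \<Rightarrow> (nat \<Rightarrow> complex) \<Rightarrow> nat \<Rightarrow> complex" where
  "bplus A B j = bG1 A B j + \<i> * bG2 A B j"

definition bminus :: "(nat \<Rightarrow> complex) \<Rightarrow> (nat \<Rightarrow> complex) \<Rightarrow> nat \<Rightarrow> complex" where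
  "bminus A B j = bG1 A B j - \<i> * bG2 A B j"

lemma bpm_cong:
  assumes "\<And>k. k < m \<Longrightarrow> A k = A' k" "\<And>k. k < m \<Longrightarrow> B k = B' k"
  shows "bplus A B = bplus A' B'" "bminus A B = bminus A' B'"
  using bG_cong[OF assms] by (auto simp: bplus_def bminus_def)

lemma bpm_lincomb:
  "bplus (\<lambda>k. A k + c * A' k) (\<lambda>k. B k + c * B' k) = (\<lambda>j. bplus A B j + c * bplus A' B' j)"
  "bminus (\<lambda>k. A k + c * A' k) (\<lambda>k. B k + c * B' k) = (\<lambda>j. bminus A B j + c * bminus A' B' j)"
  by (rule ext, simp add: bplus_def bminus_def bG_lincomb algebra_simps)+

lemma bpm_zero: "bplus (\<lambda>k. 0) (\<lambda>k. 0) = (\<lambda>j. 0)" "bminus (\<lambda>k. 0) (\<lambda>k. 0) = (\<lambda>j. 0)"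
  by (simp_all add: bplus_def bminus_def bG1_def bG2_def fun_eq_iff)

lemma bpm_surjective:
  obtains Y h where "solves Y h" "\<And>j. j < m \<Longrightarrow> bplus (\<lambda>k. Y k a) (\<lambda>k. Y k b) j = p j"
    "\<And>j. j < m \<Longrightarrow> bminus (\<lambda>k. Y k a) (\<lambda>k. Y k b) j = q j"
proof -
  \<comment> \<open>Sum and difference of the prescribed vectors are \<open>2 * bG1\<close> and
    \<open>2 * \<i> * bG2\<close>.\<close>
  obtain A B where AB: "\<And>j. j < m \<Longrightarrow> bG1 A B j = (p j + q j) / 2" "\<And>j. j < m \<Longrightarrow> bG2 A B j = (p j - q j) / (2 * \<i>)"
    by (rule bG_surjective[of "\<lambda>j. (p j + q j) / 2" "\<lambda>j. (p j - q j) / (2 * \<i>)"]) (rule that)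
  obtain Y h where Y: "solves Y h" "\<And>k. k < m \<Longrightarrow> Y k a = A k" "\<And>k. k < m \<Longrightarrow> Y k b = B k"
    by (rule boundary_values_surjective) (rule that)
  have eq: "bplus (\<lambda>k. Y k a) (\<lambda>k. Y k b) = bplus A B" "bminus (\<lambda>k. Y k a) (\<lambda>k. Y k b) = bminus A B"
    by (rule bpm_cong; erule Y)+
  show thesis
  proof (rule that[OF Y(1)])
    fix j assume j: "j < m"
    have half: "\<i> * ((p j - q j) / (2 * \<i>)) = (p j - q j) / 2"
      unfolding times_divide_eq_right mult.commute[of 2 \<i>]
      by (rule nonzero_mult_divide_mult_cancel_left) simp
    show "bplus (\<lambda>k. Y k a) (\<lambda>k. Y k b) j = p j" "bminus (\<lambda>k. Y k a) (\<lambda>k. Y k b) j = q j"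
      unfolding eq unfolding bplus_def bminus_def AB[OF j] half by (simp_all add: field_simps)
  qed
qed

text \<open>Output before input: \<open>contraction_extension\<close> treats the second component as
  the argument of the contraction.\<close>

definition bpair :: "(nat \<Rightarrow> real \<Rightarrow> complex) \<Rightarrow> (nat \<Rightarrow> complex) \<times> (nat \<Rightarrow> complex)" where
  "bpair Y = (bplus (\<lambda>k. Y k a) (\<lambda>k. Y k b), bminus (\<lambda>k. Y k a) (\<lambda>k. Y k b))"

text \<open>The Green identity with equal arguments equates the imaginary part of
  \<open>L2_inner a b v u\<close> with that of a boundary pairing, which componentwise polarisation
  rewrites as a difference of squared norms.\<close>

lemma energy_balance:
  assumes Y: "realizes u v Y h"
  shows "(\<Sum>j<m. (cmod (fst (bpair Y) j))\<^sup>2) - (\<Sum>j<m. (cmod (snd (bpair Y) j))\<^sup>2) = 4 * Im (L2_inner a b v u)"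
proof -
  let ?A = "\<lambda>k. Y k a" and ?B = "\<lambda>k. Y k b"
  let ?z = "cinner m (bG1 ?A ?B) (bG2 ?A ?B)"
  have "L2_inner a b v u - cnj (L2_inner a b v u) = ?z - cnj ?z"
    using realizes_Lagrange[OF Y Y] unfolding boundary_Green L2_inner_cnj cinner_cnj .
  then have "Im (L2_inner a b v u - cnj (L2_inner a b v u)) = Im (?z - cnj ?z)" by (rule arg_cong)
  then have im: "Im (L2_inner a b v u) = Im ?z" by simp
  have "(\<Sum>j<m. (cmod (fst (bpair Y) j))\<^sup>2) - (\<Sum>j<m. (cmod (snd (bpair Y) j))\<^sup>2)
      = (\<Sum>j<m. 4 * Im (bG1 ?A ?B j * cnj (bG2 ?A ?B j)))"
    unfolding sum_subtractf[symmetric] bpair_def fst_conv snd_conv bplus_def bminus_def cmod_plus_minus_i_squares ..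
  also have "\<dots> = 4 * Im ?z" by (simp add: cinner_def sum_distrib_left)
  finally show ?thesis using im by simp
qed

lemma LK_graph_iff:
  "(u, v) \<in> LK_graph a b m Q K \<longleftrightarrow>
    (\<exists>Y h. realizes u v Y h \<and> (\<forall>i<m. mv m K (snd (bpair Y)) i = fst (bpair Y) i))"
proof -
  define P where "P = (\<lambda>A B. \<forall>i<m. mv m K (bminus A B) i = bplus A B i)"
  have cond: "(\<forall>i<m. (mv m K (bG1 A B) i - bG1 A B i) - \<i> * (mv m K (bG2 A B) i + bG2 A B i) = 0) \<longleftrightarrow> P A B" for A B
  proof -
    have mve: "mv m K (bminus A B) i = mv m K (bG1 A B) i - \<i> * mv m K (bG2 A B) i" if "i < m" for i
      using mv_lincomb[OF that, of K "bG1 A B" "-\<i>" "bG2 A B"] by (simp add: bminus_def[abs_def])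
    show ?thesis
      unfolding P_def by (intro all_cong) (simp only: mve bplus_def, simp add: algebra_simps)
  qed
  have "P A' B'" if "\<forall>k<m. A k = A' k" "\<forall>k<m. B k = B' k" "P A B" for A A' B B'
  proof -
    have "bplus A B = bplus A' B'" "bminus A B = bminus A' B'" using bpm_cong[of A A' B B'] that(1,2) by simp_all
    then show ?thesis using that(3) by (simp add: P_def)
  qed
  from graph_realizes_iff[of P u v, OF this]
  show ?thesis
    unfolding LK_graph_def Gamma_eq_bG cond mem_Collect_eq case_prod_conv bpair_def fst_conv snd_conv
    by (simp only: P_def)
qed

lemma bpair_surjective:
  obtains W k where "solves W k" "\<And>j. j < m \<Longrightarrow> fst (bpair W) j = p j" "\<And>j. j < m \<Longrightarrow> snd (bpair W) j = q j"
proof -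
  obtain W k where W: "solves W k" "\<And>j. j < m \<Longrightarrow> bplus (\<lambda>k. W k a) (\<lambda>k. W k b) j = p j"
    "\<And>j. j < m \<Longrightarrow> bminus (\<lambda>k. W k a) (\<lambda>k. W k b) j = q j"
    by (rule bpm_surjective[of p q]) (rule that)
  show thesis by (rule that[OF W(1)]) (simp_all add: bpair_def W(2,3))
qed

lemma bpair_lincomb:
  "bpair (\<lambda>k x. Y k x + c * W k x) = (\<lambda>j. fst (bpair Y) j + c * fst (bpair W) j, \<lambda>j. snd (bpair Y) j + c * snd (bpair W) j)"
  by (simp add: bpair_def bpm_lincomb)

lemma bpair_zero: "bpair (\<lambda>k x. 0) = (\<lambda>j. 0, \<lambda>j. 0)"
  by (simp add: bpair_def bpm_zero)

text \<open>Boundary vectors belong to the class of \<open>u\<close> in L2, because its continuous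
  representative is unique; every realization of a pair may thus be used to compute them.\<close>

lemma bpair_unique:
  assumes "realizes u v Y h" "realizes u' v' W g" "ae_on a b u u'"
  shows "bpair Y = bpair W"
proof -
  have "Y k a = W k a" "Y k b = W k b" if "k < m" for k
    using realizes_unique(1)[OF assms that] ab by simp_all
  then show ?thesis
    unfolding bpair_def using bpm_cong[of "\<lambda>k. Y k a" "\<lambda>k. W k a" "\<lambda>k. Y k b" "\<lambda>k. W k b"] by simp
qed

lemma Lmin_subset_LK: "Lmin_graph a b m Q \<subseteq> LK_graph a b m Q K"
proof (rule subrelI)
  fix u v assume "(u, v) \<in> Lmin_graph a b m Q"
  then obtain Y h where Y: "realizes u v Y h" "\<forall>k<m. Y k a = 0 \<and> Y k b = 0"
    unfolding Lmin_graph_iff by (elim exE conjE)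
  have "bpair Y = (\<lambda>j. 0, \<lambda>j. 0)"
    unfolding bpair_def using bpm_cong[of "\<lambda>k. Y k a" "\<lambda>k. 0" "\<lambda>k. Y k b" "\<lambda>k. 0"] Y(2) by (simp add: bpm_zero)
  then show "(u, v) \<in> LK_graph a b m Q K"
    unfolding LK_graph_iff using Y(1) by (intro exI[of _ Y] exI[of _ h]) (simp add: mv_def)
qed

section \<open>Maximal accumulative extensions\<close>

lemma vnorm_le_iff: "vnorm m v \<le> vnorm m w \<longleftrightarrow> (\<Sum>i<m. (cmod (v i))\<^sup>2) \<le> (\<Sum>i<m. (cmod (w i))\<^sup>2)"
  by (simp add: vnorm_def)

lemma densely_defined_mono: "densely_defined a b G \<Longrightarrow> G \<subseteq> G' \<Longrightarrow> densely_defined a b G'"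
  unfolding densely_defined_def by (meson subsetD)

text \<open>Density of the domain is inherited from \<open>L_min\<close>, and the sign of the
  imaginary part is the contraction bound read through the energy balance.\<close>

lemma LK_accumulative:
  assumes K: "contraction m K"
  shows "accumulative a b (LK_graph a b m Q K)"
  unfolding accumulative_def
proof (intro conjI allI impI)
  let ?G = "LK_graph a b m Q K"
  show "densely_defined a b ?G"
    by (rule densely_defined_mono[OF Lmin_densely_defined Lmin_subset_LK])
  show "Im (L2_inner a b g f) \<le> 0" if fg: "(f, g) \<in> ?G" for f g
  proof -
    obtain Y h where Y: "realizes f g Y h" "\<forall>i<m. mv m K (snd (bpair Y)) i = fst (bpair Y) i"
      using fg unfolding LK_graph_iff by (elim exE conjE)
    have "vnorm m (mv m K (snd (bpair Y))) \<le> vnorm m (snd (bpair Y))" using K by (simp add: contraction_def)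
    then have "(\<Sum>i<m. (cmod (fst (bpair Y) i))\<^sup>2) \<le> (\<Sum>i<m. (cmod (snd (bpair Y) i))\<^sup>2)"
      using Y(2) by (simp add: vnorm_le_iff)
    then show ?thesis using energy_balance[OF Y(1)] by linarith
  qed
  have lin: "((\<lambda>x. f x + c * f' x), (\<lambda>x. g x + c * g' x)) \<in> ?G"
    if fg: "(f, g) \<in> ?G" and fg': "(f', g') \<in> ?G" for f g f' g' c
  proof -
    obtain Y h where Y: "realizes f g Y h" "\<forall>i<m. mv m K (snd (bpair Y)) i = fst (bpair Y) i"
      using fg unfolding LK_graph_iff by (elim exE conjE)
    obtain W k where W: "realizes f' g' W k" "\<forall>i<m. mv m K (snd (bpair W)) i = fst (bpair W) i"
      using fg' unfolding LK_graph_iff by (elim exE conjE)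
    have "\<forall>i<m. mv m K (snd (bpair (\<lambda>k x. Y k x + c * W k x))) i = fst (bpair (\<lambda>k x. Y k x + c * W k x)) i"
      using Y(2) W(2) by (simp add: bpair_lincomb mv_lincomb)
    with realizes_lincomb[OF Y(1) W(1), of c] show ?thesis
      unfolding LK_graph_iff by (intro exI conjI)
  qed
  have zero: "((\<lambda>x. 0), (\<lambda>x. 0)) \<in> ?G"
    using realizes_self[OF solves_zero] unfolding LK_graph_iff
    by (intro exI[of _ "\<lambda>k x. 0"] exI[of _ "\<lambda>x. 0"]) (simp add: bpair_zero mv_def)
  show "is_operator a b ?G"
    unfolding is_operator_def
  proof (intro conjI allI impI)
    show "?G \<subseteq> L2 a b \<times> L2 a b"
      unfolding LK_graph_def by blast
    show "((\<lambda>x. 0), (\<lambda>x. 0)) \<in> ?G" by (rule zero)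
    show "((\<lambda>x. f x + f' x), (\<lambda>x. g x + g' x)) \<in> ?G" if "(f, g) \<in> ?G \<and> (f', g') \<in> ?G" for f g f' g'
      using lin[OF conjunct1[OF that] conjunct2[OF that], of 1] by simp
    show "((\<lambda>x. c * f x), (\<lambda>x. c * g x)) \<in> ?G" if "(f, g) \<in> ?G" for c f g
      using lin[OF zero that, of c] by simp
    show "(f', g') \<in> ?G" if *: "(f, g) \<in> ?G \<and> ae_on a b f f' \<and> ae_on a b g g'" for f g f' g'
    proof -
      have fg: "(f, g) \<in> ?G" and ae: "ae_on a b f f'" "ae_on a b g g'" using * by blast+
      obtain Y h where Y: "realizes f g Y h" "\<forall>i<m. mv m K (snd (bpair Y)) i = fst (bpair Y) i"
        using fg unfolding LK_graph_iff by (elim exE conjE)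
      have "realizes f' g' Y h"
        unfolding realizes_def
        using realizesD(1)[OF Y(1)] ae_on_trans[OF ae_on_sym[OF ae(1)] realizesD(2)[OF Y(1)]]
          ae_on_trans[OF ae_on_sym[OF ae(2)] realizesD(3)[OF Y(1)]] by (intro conjI)
      then show ?thesis unfolding LK_graph_iff using Y(2) by (intro exI conjI)
    qed
    show "ae_on a b g g'" if *: "(f, g) \<in> ?G \<and> (f', g') \<in> ?G \<and> ae_on a b f f'" for f g f' g'
    proof -
      have fg: "(f, g) \<in> ?G" and fg': "(f', g') \<in> ?G" and ae: "ae_on a b f f'" using * by blast+
      obtain Y h where Y: "realizes f g Y h" using fg unfolding LK_graph_iff by (elim exE conjE)
      obtain W k where W: "realizes f' g' W k" using fg' unfolding LK_graph_iff by (elim exE conjE)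
      show ?thesis by (rule realizes_unique(2)[OF Y W ae])
    qed
  qed
qed

section \<open>Accumulative extensions of \<open>L_min\<close> and their boundary relations\<close>

lemma is_operator_lincomb:
  assumes G: "is_operator a b G" and "(f, g) \<in> G" "(f', g') \<in> G"
  shows "((\<lambda>x. f x + c * f' x), (\<lambda>x. g x + c * g' x)) \<in> G"
proof -
  have "((\<lambda>x. c * f' x), (\<lambda>x. c * g' x)) \<in> G"
    using G assms(3) unfolding is_operator_def by (elim conjE) blast
  moreover have "\<forall>f g f' g'. (f, g) \<in> G \<and> (f', g') \<in> G \<longrightarrow> ((\<lambda>x. f x + f' x), (\<lambda>x. g x + g' x)) \<in> G"
    using G unfolding is_operator_def by (elim conjE)
  ultimately show ?thesis using assms(2) by simp
qed

lemma accumulative_L2: "accumulative a b G \<Longrightarrow> (f, g) \<in> G \<Longrightarrow> f \<in> L2 a b \<and> g \<in> L2 a b"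
proof -
  assume G: "accumulative a b G" and fg: "(f, g) \<in> G"
  have "G \<subseteq> L2 a b \<times> L2 a b"
    using G unfolding accumulative_def is_operator_def by (elim conjE)
  with fg show ?thesis by auto
qed

text \<open>For \<open>(u, v)\<close> in the graph of \<open>L_min\<close> the quantity \<open>Im (v, u)\<close> vanishes, so accumulativity at
  \<open>(f + t u, g + t v)\<close> bounds an expression that is affine in \<open>t\<close>; its slope must be zero.\<close>
theorem accumulative_extension_subset_Lmax:
  assumes G: "accumulative a b G" and ext: "Lmin_graph a b m Q \<subseteq> G" and fg: "(f, g) \<in> G"
  shows "(f, g) \<in> Lmax_graph a b m Q"
proof (rule Lmin_adjoint_subset_Lmax)
  have fL: "f \<in> L2 a b" and gL: "g \<in> L2 a b" using accumulative_L2[OF G fg] by simp_all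
  show "f \<in> L2 a b" "g \<in> L2 a b" by fact+
  fix u v assume uv: "(u, v) \<in> Lmin_graph a b m Q"
  then obtain Y h where Y: "realizes u v Y h" "\<forall>k<m. Y k a = 0 \<and> Y k b = 0"
    unfolding Lmin_graph_iff by (elim exE conjE)
  have uL: "u \<in> L2 a b" and vL: "v \<in> L2 a b" using realizesD(4,5)[OF Y(1)] by simp_all
  have real: "Im (L2_inner a b v u) = 0"
  proof -
    have "L2_inner a b v u - cnj (L2_inner a b v u) = 0"
      using realizes_Lagrange[OF Y(1) Y(1)] Y(2) by (simp add: bform_zero_left L2_inner_cnj)
    then have "Im (L2_inner a b v u - cnj (L2_inner a b v u)) = 0" by simp
    then show ?thesis by simp
  qed
  define z where "z = L2_inner a b v f - L2_inner a b u g"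
  have bound: "Im (L2_inner a b g f) + Im (t * z) \<le> 0" for t
  proof -
    have tu: "(\<lambda>x. t * u x) \<in> L2 a b" and tv: "(\<lambda>x. t * v x) \<in> L2 a b" by (rule L2_cmult[OF uL] L2_cmult[OF vL])+
    have "((\<lambda>x. f x + t * u x), (\<lambda>x. g x + t * v x)) \<in> G"
      using G ext uv fg by (intro is_operator_lincomb) (auto simp: accumulative_def)
    then have "Im (L2_inner a b (\<lambda>x. g x + t * v x) (\<lambda>x. f x + t * u x)) \<le> 0"
      using G unfolding accumulative_def by (elim conjE) simp
    also have "L2_inner a b (\<lambda>x. g x + t * v x) (\<lambda>x. f x + t * u x)
        = L2_inner a b g f + cnj t * L2_inner a b g u + (t * L2_inner a b v f + t * (cnj t * L2_inner a b v u))"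
      by (simp add: L2_inner_add_left[OF gL tv L2_add[OF fL tu]] L2_inner_add_right[OF fL tu gL]
          L2_inner_add_right[OF fL tu vL] L2_inner_cmult_left L2_inner_cmult_right L2_inner_add_right[OF fL tu tv] distrib_left)
    \<comment> \<open>The quadratic term is a real multiple of \<open>L2_inner a b v u\<close>,
      which is real, so it drops out of the imaginary part.\<close>
    also have "t * (cnj t * L2_inner a b v u) = complex_of_real ((cmod t)\<^sup>2) * L2_inner a b v u"
      unfolding complex_norm_square by (simp add: mult.assoc)
    also have "Im (L2_inner a b g f + cnj t * L2_inner a b g u + (t * L2_inner a b v f + complex_of_real ((cmod t)\<^sup>2) * L2_inner a b v u))
        = Im (L2_inner a b g f) + Im (t * z)"
    proof -
      have "Im (cnj t * L2_inner a b g u) = - Im (t * L2_inner a b u g)"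
        unfolding L2_inner_cnj[of a b u g, symmetric] by simp
      then show ?thesis using real by (simp add: z_def right_diff_distrib)
    qed
    finally show ?thesis .
  qed
  have "z = 0"
  proof (rule ccontr)
    assume "z \<noteq> 0"
    then have z2: "0 < (cmod z)\<^sup>2" by simp
    \<comment> \<open>With \<open>t = s * \<i> * cnj z\<close> the imaginary part of
      \<open>t * z\<close> is \<open>s\<close> times the squared modulus of \<open>z\<close>; this
      \<open>s\<close> makes it \<open>1 - Im (L2_inner a b g f)\<close>, and the bound would read
      \<open>1 \<le> 0\<close>.\<close>
    define s where "s = (1 - Im (L2_inner a b g f)) / (cmod z)\<^sup>2"
    have "complex_of_real s * \<i> * cnj z * z = complex_of_real (s * (cmod z)\<^sup>2) * \<i>"
      unfolding of_real_mult complex_norm_square by (simp add: mult_ac)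
    also have "s * (cmod z)\<^sup>2 = 1 - Im (L2_inner a b g f)" using z2 by (simp add: s_def)
    finally have "complex_of_real s * \<i> * cnj z * z = complex_of_real (1 - Im (L2_inner a b g f)) * \<i>" .
    from bound[of "complex_of_real s * \<i> * cnj z", unfolded this] show False by simp
  qed
  then show "L2_inner a b v f = L2_inner a b u g" by (simp add: z_def)
qed

text \<open>Kept as a relation, since different pairs in \<open>G\<close> may share their second
  boundary vector; below index \<open>m\<close> single-valuedness comes from the contraction bound
  on differences.\<close>

definition boundary_relation :: "((real \<Rightarrow> complex) \<times> (real \<Rightarrow> complex)) set \<Rightarrow> ((nat \<Rightarrow> complex) \<times> (nat \<Rightarrow> complex)) set" where
  "boundary_relation G = {bpair Y |u v Y h. (u, v) \<in> G \<and> realizes u v Y h}"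

lemma boundary_relationI: "(u, v) \<in> G \<Longrightarrow> realizes u v Y h \<Longrightarrow> bpair Y \<in> boundary_relation G"
  unfolding boundary_relation_def by blast

lemma boundary_relation_lincomb:
  assumes G: "is_operator a b G" and pq: "(p, q) \<in> boundary_relation G" and pq': "(p', q') \<in> boundary_relation G"
  shows "((\<lambda>i. p i + c * p' i), (\<lambda>i. q i + c * q' i)) \<in> boundary_relation G"
proof -
  obtain u v Y h where Y: "(p, q) = bpair Y" "(u, v) \<in> G" "realizes u v Y h"
    using pq unfolding boundary_relation_def mem_Collect_eq by (elim exE conjE)
  obtain u' v' W k where W: "(p', q') = bpair W" "(u', v') \<in> G" "realizes u' v' W k"
    using pq' unfolding boundary_relation_def mem_Collect_eq by (elim exE conjE)
  have "bpair (\<lambda>k x. Y k x + c * W k x) = ((\<lambda>i. p i + c * p' i), (\<lambda>i. q i + c * q' i))"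
    unfolding bpair_lincomb Y(1)[symmetric] W(1)[symmetric] by simp
  with boundary_relationI[OF is_operator_lincomb[OF G Y(2) W(2), of c] realizes_lincomb[OF Y(3) W(3), of c]]
  show ?thesis by simp
qed

lemma boundary_relation_contractive:
  assumes G: "accumulative a b G" and pq: "(p, q) \<in> boundary_relation G"
  shows "(\<Sum>i<m. (cmod (p i))\<^sup>2) \<le> (\<Sum>i<m. (cmod (q i))\<^sup>2)"
proof -
  obtain u v Y h where Y: "(p, q) = bpair Y" "(u, v) \<in> G" "realizes u v Y h"
    using pq unfolding boundary_relation_def mem_Collect_eq by (elim exE conjE)
  have "Im (L2_inner a b v u) \<le> 0" using G Y(2) unfolding accumulative_def by (elim conjE) simp
  then show ?thesis
    using energy_balance[OF Y(3)] unfolding Y(1)[symmetric] fst_conv snd_conv by linarith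
qed

text \<open>For \<open>(u, v)\<close> in a larger accumulative graph, some element of
  \<open>L^K\<close> has the same \<open>bminus\<close>. Their difference also lies in the larger
  graph, so its \<open>bplus\<close> has norm at most zero; hence \<open>(u, v)\<close> satisfies
  the condition of \<open>L^K\<close>.\<close>

lemma LK_max_accumulative:
  assumes K: "contraction m K"
  shows "max_accumulative a b (LK_graph a b m Q K)"
  unfolding max_accumulative_def
proof (intro conjI allI impI)
  show "accumulative a b (LK_graph a b m Q K)" by (rule LK_accumulative[OF K])
  fix G assume *: "accumulative a b G \<and> LK_graph a b m Q K \<subseteq> G"
  then have G: "accumulative a b G" and LG: "LK_graph a b m Q K \<subseteq> G" by blast+
  have op: "is_operator a b G" using G by (simp add: accumulative_def)
  have "G \<subseteq> LK_graph a b m Q K"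
  proof (rule subrelI)
    fix u v assume uv: "(u, v) \<in> G"
    have "(u, v) \<in> Lmax_graph a b m Q"
      by (rule accumulative_extension_subset_Lmax[OF G _ uv]) (use Lmin_subset_LK LG in \<open>rule subset_trans\<close>)
    then obtain Y h where Y: "realizes u v Y h" unfolding Lmax_graph_iff by (elim exE)
    obtain W k where W: "solves W k" "\<And>j. j < m \<Longrightarrow> fst (bpair W) j = mv m K (snd (bpair Y)) j"
        "\<And>j. j < m \<Longrightarrow> snd (bpair W) j = snd (bpair Y) j"
      by (rule bpair_surjective[of "mv m K (snd (bpair Y))" "snd (bpair Y)"]) (rule that)
    have "mv m K (snd (bpair W)) = mv m K (snd (bpair Y))" by (rule mv_cong) (rule W(3))
    then have "(W 0, \<lambda>x. \<i> ^ m * k x) \<in> LK_graph a b m Q K"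
      unfolding LK_graph_iff using realizes_self[OF W(1)] W(2) by (intro exI[of _ W] exI[of _ k]) simp
    then have WG: "(W 0, \<lambda>x. \<i> ^ m * k x) \<in> G" using LG by blast
    have "((\<lambda>i. fst (bpair Y) i + (-1) * fst (bpair W) i), (\<lambda>i. snd (bpair Y) i + (-1) * snd (bpair W) i)) \<in> boundary_relation G"
      by (rule boundary_relation_lincomb[OF op]; simp; rule boundary_relationI[OF uv Y] boundary_relationI[OF WG realizes_self[OF W(1)]])
    from boundary_relation_contractive[OF G this]
    have le: "(\<Sum>i<m. (cmod (fst (bpair Y) i - fst (bpair W) i))\<^sup>2) \<le> 0"
      using W(3) by simp
    have "mv m K (snd (bpair Y)) i = fst (bpair Y) i" if i: "i < m" for i
    proof -
      have "(cmod (fst (bpair Y) i - fst (bpair W) i))\<^sup>2 \<le> (\<Sum>i<m. (cmod (fst (bpair Y) i - fst (bpair W) i))\<^sup>2)"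
        using i by (intro member_le_sum) auto
      then have "(cmod (fst (bpair Y) i - fst (bpair W) i))\<^sup>2 \<le> 0" using le by linarith
      then show ?thesis using W(2)[OF i] by simp
    qed
    then show "(u, v) \<in> LK_graph a b m Q K"
      unfolding LK_graph_iff using Y by (intro exI[of _ Y] exI[of _ h]) simp
  qed
  with LG show "G = LK_graph a b m Q K" by blast
qed

text \<open>Extending the boundary relation of \<open>L\<close> to a contraction gives
  \<open>L \<subseteq> L^K\<close>; as \<open>L^K\<close> is accumulative, maximality of
  \<open>L\<close> forces equality.\<close>

lemma max_accumulative_is_LK:
  assumes L: "max_accumulative a b L" and ext: "Lmin_graph a b m Q \<subseteq> L"
  shows "\<exists>K. contraction m K \<and> L = LK_graph a b m Q K"
proof -
  have acc: "accumulative a b L" using L by (simp add: max_accumulative_def)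
  have op: "is_operator a b L" using acc by (simp add: accumulative_def)
  have zero: "((\<lambda>i. 0), (\<lambda>i. 0)) \<in> boundary_relation L"
  proof -
    have "((\<lambda>x. 0), (\<lambda>x. 0)) \<in> L" using op by (simp add: is_operator_def)
    moreover have "realizes (\<lambda>x. 0) (\<lambda>x. 0) (\<lambda>k x. 0) (\<lambda>x. 0)" using realizes_self[OF solves_zero] by simp
    ultimately show ?thesis using boundary_relationI bpair_zero by metis
  qed
  obtain K where K: "contraction m K" "\<And>p q i. (p, q) \<in> boundary_relation L \<Longrightarrow> i < m \<Longrightarrow> mv m K q i = p i"
    by (rule contraction_extension[OF zero boundary_relation_lincomb[OF op] boundary_relation_contractive[OF acc]])
       (assumption | rule that)+
  have "L \<subseteq> LK_graph a b m Q K"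
  proof (rule subrelI)
    fix u v assume uv: "(u, v) \<in> L"
    then have "(u, v) \<in> Lmax_graph a b m Q" by (rule accumulative_extension_subset_Lmax[OF acc ext])
    then obtain Y h where Y: "realizes u v Y h" unfolding Lmax_graph_iff by (elim exE)
    have "(fst (bpair Y), snd (bpair Y)) \<in> boundary_relation L" using boundary_relationI[OF uv Y] by simp
    from K(2)[OF this] show "(u, v) \<in> LK_graph a b m Q K"
      unfolding LK_graph_iff using Y by (intro exI[of _ Y] exI[of _ h]) simp
  qed
  then have "LK_graph a b m Q K = L"
    using L LK_accumulative[OF K(1)] by (simp add: max_accumulative_def)
  with K(1) show ?thesis by (intro exI[of _ K]) simp
qed

text \<open>Some element of \<open>L^K\<close> has the \<open>j\<close>-th unit vector as
  \<open>bminus\<close>, and its \<open>bplus\<close> is then column \<open>j\<close> of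
  \<open>K\<close>. Equal graphs therefore have equal columns, and outside the \<open>m\<close> by
  \<open>m\<close> block \<open>cmat\<close> prescribes zeros.\<close>

lemma LK_graph_inj: "inj_on (LK_graph a b m Q) {K. contraction m K}"
proof (rule inj_onI, elim CollectE)
  fix K K' assume K: "contraction m K" and K': "contraction m K'" and eq: "LK_graph a b m Q K = LK_graph a b m Q K'"
  have cm: "K \<in> cmat m" "K' \<in> cmat m" using K K' by (simp_all add: contraction_def)
  show "K = K'"
  proof (intro ext)
    fix i j
    show "K i j = K' i j"
    proof (cases "i < m \<and> j < m")
      case True
      let ?e = "\<lambda>l. if l = j then 1 else (0::complex)"
      have col: "mv m M ?e i = M i j" for M
      proof -
        have "M i l * ?e l = (if l = j then M i l else 0)" for l by simp
        then show ?thesis using True unfolding mv_def by simp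
      qed
      obtain W k where W: "solves W k" "\<And>l. l < m \<Longrightarrow> fst (bpair W) l = mv m K ?e l"
          "\<And>l. l < m \<Longrightarrow> snd (bpair W) l = ?e l"
        by (rule bpair_surjective[of "mv m K ?e" ?e]) (rule that)
      have snd_eq: "mv m M (snd (bpair W)) = mv m M ?e" for M by (rule mv_cong) (rule W(3))
      have "(W 0, \<lambda>x. \<i> ^ m * k x) \<in> LK_graph a b m Q K"
        unfolding LK_graph_iff using realizes_self[OF W(1)] W(2) snd_eq by (intro exI[of _ W] exI[of _ k]) simp
      then obtain Y h where Y: "realizes (W 0) (\<lambda>x. \<i> ^ m * k x) Y h"
          "\<forall>i<m. mv m K' (snd (bpair Y)) i = fst (bpair Y) i"
        unfolding eq LK_graph_iff by (elim exE conjE)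
      have YW: "bpair Y = bpair W" by (rule bpair_unique[OF Y(1) realizes_self[OF W(1)] ae_on_refl])
      have "mv m K' ?e i = mv m K' (snd (bpair W)) i" by (simp only: snd_eq)
      also have "\<dots> = fst (bpair W) i" using Y(2)[unfolded YW] True by blast
      also have "\<dots> = mv m K ?e i" using W(2) True by blast
      finally have "mv m K' ?e i = mv m K ?e i" .
      then show ?thesis by (simp add: col)
    next
      case False
      then have "m \<le> i \<or> m \<le> j" by auto
      then have "K i j = 0" "K' i j = 0" using cm unfolding cmat_def by blast+
      then show ?thesis by simp
    qed
  qed
qed

end

theorem theorem6:
  fixes a b :: real and m :: nat and Q :: "real \<Rightarrow> real"
  assumes "a < b" and "m \<ge> 3" and "integrable (lebesgue_on {a..b}) Q"
  shows "(\<forall>K. contraction m K \<longrightarrow>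
            max_accumulative a b (LK_graph a b m Q K) \<and> Lmin_graph a b m Q \<subseteq> LK_graph a b m Q K)
       \<and> (\<forall>L. max_accumulative a b L \<and> Lmin_graph a b m Q \<subseteq> L \<longrightarrow>
            (\<exists>K. contraction m K \<and> L = LK_graph a b m Q K))
       \<and> bij_betw (LK_graph a b m Q) {K. contraction m K}
            {L. max_accumulative a b L \<and> Lmin_graph a b m Q \<subseteq> L}"
proof -
  interpret quasi_differential a b m Q by unfold_locales fact+
  have 1: "\<forall>K. contraction m K \<longrightarrow>
      max_accumulative a b (LK_graph a b m Q K) \<and> Lmin_graph a b m Q \<subseteq> LK_graph a b m Q K"
    using LK_max_accumulative Lmin_subset_LK by simp
  have 2: "\<forall>L. max_accumulative a b L \<and> Lmin_graph a b m Q \<subseteq> L \<longrightarrow>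
      (\<exists>K. contraction m K \<and> L = LK_graph a b m Q K)"
    using max_accumulative_is_LK by simp
  have "LK_graph a b m Q ` {K. contraction m K} = {L. max_accumulative a b L \<and> Lmin_graph a b m Q \<subseteq> L}"
  proof (intro equalityI subsetI)
    fix L assume "L \<in> LK_graph a b m Q ` {K. contraction m K}"
    then obtain K where "contraction m K" "L = LK_graph a b m Q K" by (elim imageE CollectE)
    then show "L \<in> {L. max_accumulative a b L \<and> Lmin_graph a b m Q \<subseteq> L}" using 1 by simp
  next
    fix L assume "L \<in> {L. max_accumulative a b L \<and> Lmin_graph a b m Q \<subseteq> L}"
    then obtain K where "contraction m K" "L = LK_graph a b m Q K"
      using 2 by (elim CollectE) blast
    then show "L \<in> LK_graph a b m Q ` {K. contraction m K}" by simp
  qed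
  then have 3: "bij_betw (LK_graph a b m Q) {K. contraction m K}
      {L. max_accumulative a b L \<and> Lmin_graph a b m Q \<subseteq> L}"
    using LK_graph_inj by (simp add: bij_betw_def)
  from 1 2 3 show ?thesis by (intro conjI)
qed

end
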